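(* Let $\mathbb{F}$ be an infinite field. Let $L$ and $N$ be matroids with disjoint ground sets, let $p,q$ be distinct elements of $L$, and let $(A,B)$ be a partition of $E(N)$ into two bases of $N$. Suppose that (i) $L$ is an excluded minor for the class of $\mathbb{F}$-representable matroids; (ii) $\{p,q\}$ is an incomparable pair of elements of $L$ such that $L_{p\rightarrow q}$ and $L_{q\rightarrow p}$ are both $\mathbb{F}$-representable; (iii) $N$ is $\mathbb{F}$-representable. Then $M(L,p,q;N,A,B)$ is an excluded minor for the class of $\mathbb{F}$-representable matroids.
   Context: Freely placing a new element $x$ in a flat $F$ of a matroid $M$ means forming the principal extension $M'$ on $E(M)\cup\{x\}$ with $M'\setminus x=M$ and such that a subset of $E(M)$ spans $x$ iff it spans $F$. An excluded minor for a class is a matroid not in the class all of whose proper minors are in it. Distinct elements $p,q$ of $L$ form an incomparable pair if some subset of $E(L)\setminus\{p,q\}$ spans $p$ but not $q$ and some subset spans $q$ but not $p$. For distinct elements $a,b$ of a matroid $K$, $K_{a\rightarrow b}$ is obtained by freely placing a new element $c$ in $\mathrm{cl}_K(\{a,b\})$, deleting $a$, and relabelling $c$ as $a$. Construction: $M_1(L,p,q;N,A,B)$ is obtained from $N\oplus L$ by freely placing new elements $a$ and $b$ in the flats spanned by $E(N)\cup\{p\}$ and $E(N)\cup\{q\}$ respectively, then, for each $x\in A$, freely placing a new element $x_a$ in the flat spanned by $\{x,a\}$, and for each $y\in B$, freely placing a new element $y_b$ in the flat spanned by $\{y,b\}$. $M_2(L,p,q;N,A,B)$ is obtained from $M_1(L,p,q;N,A,B)$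 by deleting every $x\in A$ and $y\in B$ and relabelling each $x_a$ as $x$ and each $y_b$ as $y$. Finally $M(L,p,q;N,A,B)=M_2(L,p,q;N,A,B)\setminus\{p,q\}$, a matroid on $(E(L)\setminus\{p,q\})\cup E(N)\cup\{a,b\}$. *)

theory Defs
  imports Main
begin

section \<open>Matroids\<close>

record 'a matroid =
  ground :: "'a set"
  indeps :: "'a set set"

definition is_matroid :: "'a matroid \<Rightarrow> bool" where
  "is_matroid M \<longleftrightarrow>
     finite (ground M) \<and>
     indeps M \<subseteq> Pow (ground M) \<and>
     {} \<in> indeps M \<and>
     (\<forall>I J. J \<in> indeps M \<and> I \<subseteq> J \<longrightarrow> I \<in> indeps M) \<and>
     (\<forall>I J. I \<in> indeps M \<and> J \<in> indeps M \<and> card I < card J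
        \<longrightarrow> (\<exists>e \<in> J - I. insert e I \<in> indeps M))"

definition rk :: "'a matroid \<Rightarrow> 'a set \<Rightarrow> nat" where
  "rk M X = Max (card ` {I \<in> indeps M. I \<subseteq> X})"

definition cl :: "'a matroid \<Rightarrow> 'a set \<Rightarrow> 'a set" where
  "cl M X = {e \<in> ground M. rk M (insert e X) = rk M X}"

definition spans :: "'a matroid \<Rightarrow> 'a set \<Rightarrow> 'a set \<Rightarrow> bool" where
  "spans M X Y \<longleftrightarrow> Y \<subseteq> cl M X"

definition basis_of :: "'a matroid \<Rightarrow> 'a set \<Rightarrow> 'a set \<Rightarrow> bool" where
  "basis_of M X B \<longleftrightarrow>
     B \<in> indeps M \<and> B \<subseteq> X \<and> (\<forall>I \<in> indeps M. I \<subseteq> X \<longrightarrow> B \<subseteq> I \<longrightarrow> I = B)"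

abbreviation is_basis :: "'a matroid \<Rightarrow> 'a set \<Rightarrow> bool" where
  "is_basis M \<equiv> basis_of M (ground M)"

definition deletion :: "'a matroid \<Rightarrow> 'a set \<Rightarrow> 'a matroid" where
  "deletion M X = \<lparr>ground = ground M - X, indeps = {I \<in> indeps M. I \<subseteq> ground M - X}\<rparr>"

definition contraction :: "'a matroid \<Rightarrow> 'a set \<Rightarrow> 'a matroid" where
  "contraction M X = \<lparr>ground = ground M - X,
     indeps = {I. I \<subseteq> ground M - X \<and> (\<exists>B. basis_of M X B \<and> I \<union> B \<in> indeps M)}\<rparr>"

definition proper_minor :: "'a matroid \<Rightarrow> 'a matroid \<Rightarrow> bool" where
  "proper_minor N M \<longleftrightarrow>
     (\<exists>X Y. X \<subseteq> ground M \<and> Y \<subseteq> ground M \<and> X \<inter> Y = {} \<and> X \<union> Y \<noteq> {}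
        \<and> N = deletion (contraction M X) Y)"

definition excluded_minor :: "('a matroid \<Rightarrow> bool) \<Rightarrow> 'a matroid \<Rightarrow> bool" where
  "excluded_minor P M \<longleftrightarrow> is_matroid M \<and> \<not> P M \<and> (\<forall>N. proper_minor N M \<longrightarrow> P N)"

definition direct_sum :: "'a matroid \<Rightarrow> 'a matroid \<Rightarrow> 'a matroid" where
  "direct_sum M N = \<lparr>ground = ground M \<union> ground N,
     indeps = {I \<union> J | I J. I \<in> indeps M \<and> J \<in> indeps N}\<rparr>"

definition relabel :: "('a \<Rightarrow> 'b) \<Rightarrow> 'a matroid \<Rightarrow> 'b matroid" where
  "relabel f M = \<lparr>ground = f ` ground M, indeps = (\<lambda>I. f ` I) ` indeps M\<rparr>"

text \<open>
  \<open>D\<close> is a matrix with \<open>n\<close> rows whose columns are indexed by the elements of the matroid;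
  the columns indexed by \<open>I\<close> are linearly independent as a family, so that
  equal columns give parallel elements.
\<close>

definition representable :: "'f::field itself \<Rightarrow> 'a matroid \<Rightarrow> bool" where
  "representable F M \<longleftrightarrow> is_matroid M \<and>
     (\<exists>(n::nat) (D :: nat \<Rightarrow> 'a \<Rightarrow> 'f). \<forall>I \<subseteq> ground M.
        I \<in> indeps M \<longleftrightarrow>
          (\<forall>c :: 'a \<Rightarrow> 'f. (\<forall>i<n. (\<Sum>x\<in>I. c x * D i x) = 0) \<longrightarrow> (\<forall>x\<in>I. c x = 0)))"


section \<open>Free placement in a flat\<close>

definition is_free_placement :: "'a matroid \<Rightarrow> 'a set \<Rightarrow> 'a \<Rightarrow> 'a matroid \<Rightarrow> bool" where
  "is_free_placement M F x M' \<longleftrightarrow>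
     is_matroid M' \<and> ground M' = insert x (ground M) \<and> deletion M' {x} = M \<and>
     (\<forall>X \<subseteq> ground M. spans M' X {x} \<longleftrightarrow> spans M X F)"

definition free_place :: "'a matroid \<Rightarrow> 'a set \<Rightarrow> 'a \<Rightarrow> 'a matroid" where
  "free_place M F x = (THE M'. is_free_placement M F x M')"

lemma matroidD:
  assumes "is_matroid M"
  shows "finite (ground M)" "{} \<in> indeps M" "finite (indeps M)"
    and "\<And>I. I \<in> indeps M \<Longrightarrow> I \<subseteq> ground M"
    and "\<And>I. I \<in> indeps M \<Longrightarrow> finite I"
    and "\<And>I J. J \<in> indeps M \<Longrightarrow> I \<subseteq> J \<Longrightarrow> I \<in> indeps M"
    and "\<And>I J. I \<in> indeps M \<Longrightarrow> J \<in> indeps M \<Longrightarrow> card I < card J \<Longrightarrow>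
           \<exists>e \<in> J - I. insert e I \<in> indeps M"
proof -
  note M = assms[unfolded is_matroid_def]
  show fin: "finite (ground M)" and "{} \<in> indeps M" using M by simp_all
  show sub: "\<And>I. I \<in> indeps M \<Longrightarrow> I \<subseteq> ground M" using M by auto
  show "finite (indeps M)" by (rule finite_subset[of _ "Pow (ground M)"]) (use fin sub in auto)
  show "\<And>I. I \<in> indeps M \<Longrightarrow> finite I" using sub fin by (rule finite_subset)
qed (use assms[unfolded is_matroid_def] in blast)+

lemma rk_basis:
  assumes "is_matroid M" "basis_of M X B"
  shows "rk M X = card B"
proof -
  have fin: "finite (indeps M)" by (rule matroidD(3)[OF assms(1)])
  have B: "B \<in> indeps M" "B \<subseteq> X" using assms(2) by (auto simp: basis_of_def)
  have "card I \<le> card B" if I: "I \<in> indeps M" "I \<subseteq> X" for I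
  proof (rule ccontr)
    assume "\<not> card I \<le> card B"
    then have "card B < card I" by simp
    from matroidD(7)[OF assms(1) B(1) I(1) this]
    obtain e where e: "e \<in> I - B" "insert e B \<in> indeps M" by blast
    have "insert e B \<subseteq> X" using e(1) I B by auto
    then have "insert e B = B" using assms(2) e(2) by (simp add: basis_of_def subset_insertI)
    then show False using e(1) by auto
  qed
  then show ?thesis unfolding rk_def
    by (intro Max_eqI) (use fin B in auto)
qed

lemma basis_extend:
  assumes "is_matroid M" "I \<in> indeps M" "I \<subseteq> X"
  obtains B where "basis_of M X B" "I \<subseteq> B"
proof -
  have fin: "finite (indeps M)" by (rule matroidD(3)[OF assms(1)])
  let ?S = "{J \<in> indeps M. I \<subseteq> J \<and> J \<subseteq> X}"
  have "finite ?S" "I \<in> ?S" using fin assms by auto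
  then obtain B where "B \<in> ?S" "\<forall>J \<in> ?S. B \<subseteq> J \<longrightarrow> J = B"
    by (metis (no_types, lifting) finite_has_maximal2)
  then have B: "B \<in> indeps M" "I \<subseteq> B" "B \<subseteq> X"
    and max: "\<And>J. J \<in> indeps M \<Longrightarrow> I \<subseteq> J \<Longrightarrow> J \<subseteq> X \<Longrightarrow> B \<subseteq> J \<Longrightarrow> J = B"
    by simp_all
  have "basis_of M X B"
    unfolding basis_of_def using B max[OF _ subset_trans[OF B(2)]] by auto
  then show thesis using that B(2) by blast
qed

lemma mem_cl_basis:
  assumes M: "is_matroid M" and B: "basis_of M X B"
  shows "e \<in> cl M X \<longleftrightarrow> e \<in> ground M \<and> (e \<in> B \<or> insert e B \<notin> indeps M)"
proof (cases "e \<in> ground M \<and> e \<notin> B")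
  case True
  have finB: "finite B" using matroidD(5)[OF M] B by (auto simp: basis_of_def)
  have BI: "B \<in> indeps M" "B \<subseteq> insert e X" using B by (auto simp: basis_of_def)
  show ?thesis
  proof (cases "insert e B \<in> indeps M")
    case indep: True
    moreover have "insert e B \<subseteq> insert e X" using BI B by (auto simp: basis_of_def)
    ultimately obtain C where C: "basis_of M (insert e X) C" "insert e B \<subseteq> C"
      using basis_extend[OF M] by blast
    have "finite C" using matroidD(5)[OF M] C by (auto simp: basis_of_def)
    then have "card B < card C" using C(2) True finB
      by (metis card_insert_disjoint card_mono less_eq_Suc_le)
    then show ?thesis using rk_basis[OF M C(1)] rk_basis[OF M B] True indep
      by (auto simp: cl_def)
  next
    case dep: False
    have "basis_of M (insert e X) B"
      unfolding basis_of_def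
    proof (intro conjI ballI impI)
      fix I assume I: "I \<in> indeps M" "I \<subseteq> insert e X" "B \<subseteq> I"
      have "e \<notin> I"
        using I dep matroidD(6)[OF M I(1), of "insert e B"] by auto
      then show "I = B" using I B unfolding basis_of_def by blast
    qed (use BI in auto)
    then show ?thesis using rk_basis[OF M] B True dep by (auto simp: cl_def)
  qed
next
  case False
  moreover have "insert e X = X" if "e \<in> B"
    using that B by (auto simp: basis_of_def)
  ultimately show ?thesis by (auto simp: cl_def)
qed

lemma basis_of_indep: "I \<in> indeps M \<Longrightarrow> basis_of M I I"
  by (auto simp: basis_of_def)

lemma mem_cl_indep:
  assumes "is_matroid M" "I \<in> indeps M"
  shows "e \<in> cl M I \<longleftrightarrow> e \<in> ground M \<and> (e \<in> I \<or> insert e I \<notin> indeps M)"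
  by (rule mem_cl_basis[OF assms(1) basis_of_indep[OF assms(2)]])

lemma cl_basis:
  assumes "is_matroid M" "basis_of M X B"
  shows "cl M X = cl M B"
  using mem_cl_basis[OF assms] mem_cl_indep[OF assms(1)] assms(2)
  by (auto simp: basis_of_def)

lemma is_free_placement_ex1:
  assumes M: "is_matroid M" and F: "F \<subseteq> ground M" and x: "x \<notin> ground M"
  shows "\<exists>!M'. is_free_placement M F x M'"
proof -
  note sub = matroidD(4)[OF M] and fin = matroidD(5)[OF M]
    and down = matroidD(6)[OF M] and aug = matroidD(7)[OF M]
  have xI: "x \<notin> I" if "I \<in> indeps M" for I using sub[OF that] x by auto
  define ns where "ns I \<longleftrightarrow> (\<exists>f \<in> F. f \<notin> I \<and> insert f I \<in> indeps M)" for I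
  have ns: "\<not> spans M I F \<longleftrightarrow> ns I" if "I \<in> indeps M" for I
    using mem_cl_indep[OF M that] F unfolding spans_def ns_def by blast
  have ns_down: "ns I" if "ns J" "I \<subseteq> J" for I J
    using that down unfolding ns_def by (meson insert_mono subsetD)
  define P where "P = \<lparr>ground = insert x (ground M),
     indeps = indeps M \<union> {insert x I | I. I \<in> indeps M \<and> ns I}\<rparr>"
  have P_in: "I \<in> indeps P \<longleftrightarrow> I \<in> indeps M" if "x \<notin> I" for I
    using that by (auto simp: P_def)
  have P_ins: "insert x I \<in> indeps P \<longleftrightarrow> I \<in> indeps M \<and> ns I" if "x \<notin> I" for I
  proof
    assume "insert x I \<in> indeps P"
    then consider "insert x I \<in> indeps M"
      | J where "insert x I = insert x J" "J \<in> indeps M" "ns J"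
      by (auto simp: P_def)
    then show "I \<in> indeps M \<and> ns I"
    proof cases
      case 1 then show ?thesis using xI by blast
    next
      case 2 then show ?thesis using that xI by (metis insert_ident)
    qed
  qed (auto simp: P_def)
  have augP: "\<exists>e \<in> J - I. insert e I \<in> indeps P"
    if I: "I \<in> indeps P" and J: "J \<in> indeps P" and IJ: "card I < card J" for I J
  proof -
    define I0 J0 where "I0 = I - {x}" and "J0 = J - {x}"
    have x0: "x \<notin> I0" "x \<notin> J0" by (auto simp: I0_def J0_def)
    have split: "K - {x} \<in> indeps M \<and> (x \<in> K \<longrightarrow> ns (K - {x}))" if "K \<in> indeps P" for K
    proof (cases "x \<in> K")
      case True
      then show ?thesis using P_ins[of "K - {x}"] that by (simp add: insert_absorb)
    next
      case False
      then show ?thesis using P_in[of K] that by simp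
    qed
    have I0: "I0 \<in> indeps M" "x \<in> I \<Longrightarrow> ns I0" and J0: "J0 \<in> indeps M" "x \<in> J \<Longrightarrow> ns J0"
      using split[OF I] split[OF J] by (simp_all add: I0_def J0_def)
    note f = fin[OF I0(1)] fin[OF J0(1)]
    have cI: "card I = (if x \<in> I then Suc (card I0) else card I0)"
      using f(1) card_Suc_Diff1[of I x] by (auto simp: I0_def)
    have cJ: "card J = (if x \<in> J then Suc (card J0) else card J0)"
      using f(2) card_Suc_Diff1[of J x] by (auto simp: J0_def)
    have suff: ?thesis if "e \<in> J0 - I0" "insert e I0 \<in> indeps M" "x \<in> I \<Longrightarrow> ns (insert e I0)" for e
    proof (rule bexI)
      show "e \<in> J - I" using that(1) x0 by (auto simp: I0_def J0_def)
      have "e \<noteq> x" using that(1) x0 by auto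
      show "insert e I \<in> indeps P"
      proof (cases "x \<in> I")
        case True
        then have "insert e I = insert x (insert e I0)" by (auto simp: I0_def)
        then show ?thesis using P_ins[of "insert e I0"] that x0 \<open>e \<noteq> x\<close> True by auto
      next
        case False
        then have "I = I0" by (auto simp: I0_def)
        then show ?thesis using that P_in[of "insert e I0"] x0 \<open>e \<noteq> x\<close> by auto
      qed
    qed
    show ?thesis
    proof (cases "x \<in> I")
      case xI': True
      then obtain g where g: "g \<in> F" "g \<notin> I0" "insert g I0 \<in> indeps M"
        using I0(2) unfolding ns_def by blast
      show ?thesis
      proof (cases "x \<in> J")
        case True
        then obtain h where h: "h \<in> F" "h \<notin> J0" "insert h J0 \<in> indeps M"
          using J0(2) unfolding ns_def by blast
        have lt: "card I0 < card J0" using IJ cI cJ xI' True by auto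
        then obtain e where e: "e \<in> J0 - I0" "insert e I0 \<in> indeps M"
          using aug I0(1) J0(1) by blast
        have "card (insert e I0) < card (insert h J0)" using lt f e h by auto
        then obtain d where d: "d \<in> insert h J0 - insert e I0" "insert d (insert e I0) \<in> indeps M"
          using aug e(2) h(3) by blast
        show ?thesis
        proof (cases "d = h")
          case True
          then have "ns (insert e I0)" using d h unfolding ns_def by blast
          then show ?thesis using suff e by blast
        next
          case False
          then have dJ: "d \<in> J0 - I0" "insert d I0 \<in> indeps M"
            using d down[OF d(2), of "insert d I0"] by auto
          have "card (insert g I0) < card (insert d (insert e I0))" using f g d e by auto
          then obtain k where k: "k \<in> insert d (insert e I0) - insert g I0"
            "insert k (insert g I0) \<in> indeps M" using aug g(3) d(2) by blast
          then have "k = d \<or> k = e" by auto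
          moreover have "ns (insert k I0)"
            using k g unfolding ns_def
            by (metis Diff_iff insert_commute insert_iff)
          ultimately show ?thesis using suff e dJ by blast
        qed
      next
        case False
        then have "card (insert g I0) < card J0" using IJ cI cJ xI' f g by auto
        then obtain e where e: "e \<in> J0 - insert g I0" "insert e (insert g I0) \<in> indeps M"
          using aug g(3) J0(1) by blast
        then have "ns (insert e I0)" using g unfolding ns_def
          by (metis Diff_iff insert_commute insert_iff)
        moreover have "insert e I0 \<in> indeps M" using down[OF e(2)] by blast
        ultimately show ?thesis using suff e by blast
      qed
    next
      case xnI: False
      then have II0: "I = I0" by (auto simp: I0_def)
      show ?thesis
      proof (cases "card I0 < card J0")
        case True
        then show ?thesis using aug[OF I0(1) J0(1)] suff xnI by blast
      next
        case False
        then have xJ: "x \<in> J" using IJ cI cJ xnI by (auto split: if_splits)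
        then obtain h where h: "h \<in> F" "h \<notin> J0" "insert h J0 \<in> indeps M"
          using J0(2) unfolding ns_def by blast
        show ?thesis
        proof (cases "ns I0")
          case True
          then show ?thesis using P_ins[of I0] x0 I0 xJ xnI II0 by blast
        next
          case nns: False
          have "card I0 < card (insert h J0)" using IJ cI cJ xnI xJ f h by auto
          then obtain e where e: "e \<in> insert h J0 - I0" "insert e I0 \<in> indeps M"
            using aug I0(1) h(3) by blast
          then have "e \<noteq> h" using nns h(1) unfolding ns_def by blast
          then show ?thesis using suff e xnI by blast
        qed
      qed
    qed
  qed
  have downP: "I \<in> indeps P" if "J \<in> indeps P" "I \<subseteq> J" for I J
  proof (cases "x \<in> J")
    case True
    then have J: "J - {x} \<in> indeps M" "ns (J - {x})"
      using that(1) P_ins[of "J - {x}"] by (auto simp: insert_absorb)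
    have "I - {x} \<in> indeps M" "ns (I - {x})"
      using down[OF J(1)] ns_down[OF J(2)] that(2) by (meson Diff_mono subset_refl)+
    then show ?thesis using P_ins[of "I - {x}"] P_in[of I]
      by (cases "x \<in> I") (auto simp: insert_absorb)
  next
    case False
    then show ?thesis using that P_in down by (meson subsetD)
  qed
  have PM: "is_matroid P"
    unfolding is_matroid_def
  proof (intro conjI allI impI)
    show "finite (ground P)" using M by (auto simp: P_def is_matroid_def)
    show "indeps P \<subseteq> Pow (ground P)" using sub by (auto simp: P_def)
    show "{} \<in> indeps P" using M by (auto simp: P_def is_matroid_def)
  qed (use augP downP in blast)+
  have "is_free_placement M F x P"
    unfolding is_free_placement_def
  proof (intro conjI allI impI PM)
    show "ground P = insert x (ground M)" by (simp add: P_def)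
    have "{I \<in> indeps P. I \<subseteq> ground M} = indeps M"
      using P_in sub x by blast
    moreover have "ground P - {x} = ground M" using x by (auto simp: P_def)
    ultimately show "deletion P {x} = M" by (simp add: deletion_def)
  next
    fix X assume X: "X \<subseteq> ground M"
    obtain B where B: "basis_of M X B"
      using basis_extend[OF M, of "{}" X] M by (auto simp: is_matroid_def)
    have "basis_of P X B"
      using B P_in X x unfolding basis_of_def by (meson subsetD)
    moreover have BI: "B \<in> indeps M" using B by (simp add: basis_of_def)
    ultimately have "x \<in> cl P X \<longleftrightarrow> \<not> ns B"
      using mem_cl_basis[OF PM] P_ins[OF xI[OF BI]] xI[OF BI] by (auto simp: P_def)
    then show "spans P X {x} \<longleftrightarrow> spans M X F"
      using ns[OF BI] cl_basis[OF M B] by (auto simp: spans_def)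
  qed
  moreover have "Q = P" if Q: "is_free_placement M F x Q" for Q
  proof -
    have QM: "is_matroid Q" and Qg: "ground Q = insert x (ground M)" and Qd: "deletion Q {x} = M"
      and Qs: "\<And>X. X \<subseteq> ground M \<Longrightarrow> spans Q X {x} \<longleftrightarrow> spans M X F"
      using Q by (auto simp: is_free_placement_def)
    have Qsub: "I \<subseteq> insert x (ground M)" if "I \<in> indeps Q" for I
      using QM that Qg by (auto simp: is_matroid_def)
    have Q_in: "I \<in> indeps Q \<longleftrightarrow> I \<in> indeps M" if "x \<notin> I" for I
    proof -
      have "indeps M = {I \<in> indeps Q. I \<subseteq> ground Q - {x}}"
        using Qd by (auto simp: deletion_def)
      then show ?thesis using Qsub that Qg by blast
    qed
    have Q_ins: "insert x I \<in> indeps Q \<longleftrightarrow> I \<in> indeps M \<and> ns I" if xn: "x \<notin> I" for I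
    proof (cases "I \<in> indeps M")
      case True
      then have "x \<in> cl Q I \<longleftrightarrow> insert x I \<notin> indeps Q"
        using mem_cl_indep[OF QM, of I x] Q_in[OF xn] Qg xn by auto
      then show ?thesis using Qs[OF sub[OF True]] ns[OF True] True by (auto simp: spans_def)
    next
      case False
      then show ?thesis using Q_in[OF xn] matroidD(6)[OF QM, of "insert x I" I] by blast
    qed
    have "I \<in> indeps Q \<longleftrightarrow> I \<in> indeps P" for I
    proof (cases "x \<in> I")
      case True
      then show ?thesis using Q_ins[of "I - {x}"] P_ins[of "I - {x}"] by (simp add: insert_absorb)
    qed (simp add: Q_in P_in)
    then show ?thesis using Qg by (intro matroid.equality) (auto simp: P_def)
  qed
  ultimately show ?thesis by blast
qed


section \<open>The constructions\<close>

definition incomparable_pair :: "'a matroid \<Rightarrow> 'a \<Rightarrow> 'a \<Rightarrow> bool" where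
  "incomparable_pair L p q \<longleftrightarrow>
     p \<in> ground L \<and> q \<in> ground L \<and> p \<noteq> q \<and>
     (\<exists>X \<subseteq> ground L - {p, q}. spans L X {p} \<and> \<not> spans L X {q}) \<and>
     (\<exists>X \<subseteq> ground L - {p, q}. spans L X {q} \<and> \<not> spans L X {p})"

text \<open>\<open>move K a b\<close> is $K_{a \rightarrow b}$; the new element is \<open>None\<close>.\<close>

definition move :: "'a matroid \<Rightarrow> 'a \<Rightarrow> 'a \<Rightarrow> 'a matroid" where
  "move K a b =
     (let K0 = relabel Some K;
          K1 = free_place K0 (cl K0 {Some a, Some b}) None
      in relabel (case_option a id) (deletion K1 {Some a}))"

text \<open>
  \<open>New_a\<close> and \<open>New_b\<close> are the new elements $a$ and $b$, and \<open>Copy x\<close> is $x_a$ for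
  \<open>x \<in> A\<close> and $x_b$ for \<open>x \<in> B\<close>. The sets $A$ and $B$ are given by
  enumerations \<open>xs\<close> and \<open>ys\<close>, which fix the order in which the elements are placed.
\<close>

datatype 'a elt = Elt 'a | New_a | New_b | Copy 'a

definition M1 :: "'a matroid \<Rightarrow> 'a \<Rightarrow> 'a \<Rightarrow> 'a matroid \<Rightarrow> 'a list \<Rightarrow> 'a list \<Rightarrow> 'a elt matroid" where
  "M1 L p q N xs ys =
     (let K0 = relabel Elt (direct_sum N L);
          K1 = free_place K0 (cl K0 (Elt ` (ground N \<union> {p}))) New_a;
          K2 = free_place K1 (cl K1 (Elt ` (ground N \<union> {q}))) New_b;
          K3 = fold (\<lambda>x K. free_place K (cl K {Elt x, New_a}) (Copy x)) xs K2
      in fold (\<lambda>y K. free_place K (cl K {Elt y, New_b}) (Copy y)) ys K3)"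

definition uncopy :: "'a elt \<Rightarrow> 'a elt" where
  "uncopy z = (case z of Copy x \<Rightarrow> Elt x | _ \<Rightarrow> z)"

definition M2 :: "'a matroid \<Rightarrow> 'a \<Rightarrow> 'a \<Rightarrow> 'a matroid \<Rightarrow> 'a list \<Rightarrow> 'a list \<Rightarrow> 'a elt matroid" where
  "M2 L p q N xs ys = relabel uncopy (deletion (M1 L p q N xs ys) (Elt ` (set xs \<union> set ys)))"

definition M_constr :: "'a matroid \<Rightarrow> 'a \<Rightarrow> 'a \<Rightarrow> 'a matroid \<Rightarrow> 'a list \<Rightarrow> 'a list \<Rightarrow> 'a elt matroid" where
  "M_constr L p q N xs ys = deletion (M2 L p q N xs ys) {Elt p, Elt q}"

end

theory Submission
  imports Defs "HOL.Vector_Spaces" "HOL-Library.Function_Algebras"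
begin

text \<open>
  Write \<open>M(L)\<close> for the matroid constructed from \<open>L\<close>.

  A representation of \<open>M(L)\<close> yields one of \<open>L\<close>: the span of \<open>A \<union> {a}\<close> meets the span of
  \<open>E(L) - {p, q}\<close> in a single point, which can serve as \<open>p\<close>, and the span of \<open>B \<union> {b}\<close> meets it in a
  point which can serve as \<open>q\<close>. Incomparability makes the two points distinct, so they span the
  intersection of the spans of \<open>E(L) - {p, q}\<close> and \<open>E(N) \<union> {a, b}\<close>. Hence \<open>M(L)\<close> is not representable.

  Over an infinite field, free placement preserves representability, so \<open>M(K)\<close> is representable
  whenever \<open>K\<close> is. Deleting or contracting an element of \<open>E(L) - {p, q}\<close> commutes with the
  construction. For the other elements, \<open>M(L)\<close> and $M(L_{p \rightarrow q})$ have the same independent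
  sets among those that do not contain \<open>A \<union> {a}\<close> or that meet \<open>B \<union> {b}\<close>; this settles the deletion
  of elements of \<open>A \<union> {a}\<close> and the contraction of elements of \<open>B \<union> {b}\<close>, and $L_{q \rightarrow p}$
  settles the remaining minors.
\<close>

section \<open>Matroid operations\<close>

text \<open>Everything turns on \<open>A\<close> and \<open>B\<close> being bases of
  \<open>N\<close>. Moving \<open>p\<close> onto the line through \<open>p\<close> and
  \<open>q\<close> can only create independent sets in which \<open>a\<close> acts as
  \<open>p\<close> where \<open>q\<close> would have done as well. If the set also has an element of
  \<open>B \<union> {b}\<close>, that element gives a route to \<open>q\<close>; if part of
  \<open>A \<union> {a}\<close> is missing, \<open>a\<close> can be absorbed by \<open>N\<close> or
  is not called upon at all. Only a set that contains \<open>A \<union> {a}\<close> and avoids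
  \<open>B \<union> {b}\<close> has neither way out. To make this precise, the placements are undone
  one at a time until independence is a condition that sees \<open>L\<close> only through the four
  sets obtained from some \<open>X\<close> in E(L) - {p, q} by adding \<open>p\<close>,
  \<open>q\<close>, both or neither. The recovery of \<open>L\<close> is a dimension count. Let
  \<open>P\<close> be a basis of E(L) - {p, q}. Then \<open>P \<union> A\<close> is independent,
  while adding \<open>a\<close> makes it dependent because E(L) - {p, q} spans \<open>p\<close>. So
  the spans of \<open>P\<close> and \<open>A \<union> {a}\<close> meet in dimension exactly one;
  adding \<open>b\<close> raises the dimension to two.\<close>

lemma is_matroid_deletion:
  assumes M: "is_matroid M"
  shows "is_matroid (deletion M X)"
  unfolding is_matroid_def
proof (intro conjI allI impI)
  fix I J
  {
    assume "J \<in> indeps (deletion M X) \<and> I \<subseteq> J"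
    then show "I \<in> indeps (deletion M X)" using matroidD(6)[OF M] by (auto simp: deletion_def)
  }
  assume "I \<in> indeps (deletion M X) \<and> J \<in> indeps (deletion M X) \<and> card I < card J"
  then show "\<exists>e\<in>J - I. insert e I \<in> indeps (deletion M X)"
    using matroidD(7)[OF M, of I J] by (auto simp: deletion_def)
qed (use matroidD(1,2,4)[OF M] in \<open>auto simp: deletion_def\<close>)

lemma is_matroid_relabel:
  assumes M: "is_matroid M" and f: "inj_on f (ground M)"
  shows "is_matroid (relabel f M)"
  unfolding is_matroid_def
proof (intro conjI allI impI)
  note sub = matroidD(4)[OF M]
  show "finite (ground (relabel f M))" "indeps (relabel f M) \<subseteq> Pow (ground (relabel f M))"
    "{} \<in> indeps (relabel f M)"
    using matroidD(1,2,4)[OF M] by (auto simp: relabel_def)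
  fix I J
  {
    assume "J \<in> indeps (relabel f M) \<and> I \<subseteq> J"
    then obtain J' where J': "J' \<in> indeps M" "J = f ` J'" "I \<subseteq> f ` J'"
      by (auto simp: relabel_def)
    then obtain I' where "I' \<subseteq> J'" "I = f ` I'" by (meson subset_image_iff)
    then show "I \<in> indeps (relabel f M)"
      using matroidD(6)[OF M J'(1)] by (auto simp: relabel_def)
  }
  assume asm: "I \<in> indeps (relabel f M) \<and> J \<in> indeps (relabel f M) \<and> card I < card J"
  then obtain I' J' where IJ: "I' \<in> indeps M" "J' \<in> indeps M" "I = f ` I'" "J = f ` J'"
    by (auto simp: relabel_def)
  have inj: "inj_on f I'" "inj_on f J'" using sub IJ f by (meson inj_on_subset)+
  then have "card I' < card J'" using asm IJ by (simp add: card_image)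
  then obtain e where e: "e \<in> J' - I'" "insert e I' \<in> indeps M"
    using matroidD(7)[OF M] IJ by blast
  have "f e \<notin> f ` I'" using e sub[OF IJ(1)] sub[OF IJ(2)] f by (auto simp: inj_on_def)
  then show "\<exists>e\<in>J - I. insert e I \<in> indeps (relabel f M)"
    using e IJ by (intro bexI[of _ "f e"]) (auto simp: relabel_def image_iff intro!: bexI[of _ "insert e I'"])
qed

lemma relabel_indeps:
  assumes M: "is_matroid M" and f: "inj_on f (ground M)" and I: "I \<subseteq> ground M"
  shows "f ` I \<in> indeps (relabel f M) \<longleftrightarrow> I \<in> indeps M"
proof
  assume "f ` I \<in> indeps (relabel f M)"
  then obtain J where J: "J \<in> indeps M" "f ` I = f ` J" by (auto simp: relabel_def)
  then have "I = J" using f I matroidD(4)[OF M J(1)] by (meson inj_on_image_eq_iff)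
  then show "I \<in> indeps M" using J by simp
qed (auto simp: relabel_def)

lemma direct_sum_indeps:
  assumes M: "is_matroid M" and N: "is_matroid N" and disj: "ground M \<inter> ground N = {}"
  shows "I \<in> indeps (direct_sum M N) \<longleftrightarrow>
    I \<subseteq> ground M \<union> ground N \<and> I \<inter> ground M \<in> indeps M \<and> I \<inter> ground N \<in> indeps N"
proof
  assume "I \<in> indeps (direct_sum M N)"
  then obtain J K where JK: "J \<in> indeps M" "K \<in> indeps N" "I = J \<union> K"
    by (auto simp: direct_sum_def)
  then have "J \<subseteq> ground M" "K \<subseteq> ground N" using matroidD(4) M N by blast+
  moreover from this have "I \<inter> ground M = J" "I \<inter> ground N = K" using JK disj by blast+
  ultimately show "I \<subseteq> ground M \<union> ground N \<and> I \<inter> ground M \<in> indeps M \<and> I \<inter> ground N \<in> indeps N"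
    using JK by auto
next
  assume *: "I \<subseteq> ground M \<union> ground N \<and> I \<inter> ground M \<in> indeps M \<and> I \<inter> ground N \<in> indeps N"
  then have "I = (I \<inter> ground M) \<union> (I \<inter> ground N)" by blast
  then show "I \<in> indeps (direct_sum M N)" using * unfolding direct_sum_def by auto
qed

lemma is_matroid_direct_sum:
  assumes M: "is_matroid M" and N: "is_matroid N" and disj: "ground M \<inter> ground N = {}"
  shows "is_matroid (direct_sum M N)"
  unfolding is_matroid_def
proof (intro conjI allI impI)
  note ds = direct_sum_indeps[OF M N disj]
  have g: "ground (direct_sum M N) = ground M \<union> ground N" by (simp add: direct_sum_def)
  show fin: "finite (ground (direct_sum M N))" using matroidD(1)[OF M] matroidD(1)[OF N] by (simp add: g)
  show "indeps (direct_sum M N) \<subseteq> Pow (ground (direct_sum M N))" using ds by (auto simp: g)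
  show "{} \<in> indeps (direct_sum M N)" using ds matroidD(2)[OF M] matroidD(2)[OF N] by simp
  fix I J
  {
    assume IJ: "J \<in> indeps (direct_sum M N) \<and> I \<subseteq> J"
    then have "I \<inter> ground M \<subseteq> J \<inter> ground M" "I \<inter> ground N \<subseteq> J \<inter> ground N" by auto
    then show "I \<in> indeps (direct_sum M N)"
      using IJ ds matroidD(6)[OF M] matroidD(6)[OF N] by (meson subset_trans)
  }
  assume asm: "I \<in> indeps (direct_sum M N) \<and> J \<in> indeps (direct_sum M N) \<and> card I < card J"
  note I = ds[THEN iffD1, OF conjunct1[OF asm]]
  note J = ds[THEN iffD1, OF conjunct1[OF conjunct2[OF asm]]]
  have card: "card K = card (K \<inter> ground M) + card (K \<inter> ground N)"
    if "K \<subseteq> ground M \<union> ground N" for K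
  proof -
    have "K = (K \<inter> ground M) \<union> (K \<inter> ground N)" using that by blast
    moreover have "finite K" using fin that g by (metis finite_subset)
    ultimately show ?thesis using disj
      by (metis (no_types, lifting) Int_Un_eq(2) card_Un_disjoint finite_Int inf_assoc inf_bot_right inf_commute)
  qed
  consider "card (I \<inter> ground M) < card (J \<inter> ground M)" | "card (I \<inter> ground N) < card (J \<inter> ground N)"
    using asm card I J by fastforce
  then show "\<exists>e\<in>J - I. insert e I \<in> indeps (direct_sum M N)"
  proof cases
    case 1
    then obtain e where e: "e \<in> (J \<inter> ground M) - (I \<inter> ground M)" "insert e (I \<inter> ground M) \<in> indeps M"
      using matroidD(7)[OF M] I J by blast
    moreover have "insert e I \<inter> ground M = insert e (I \<inter> ground M)"
      "insert e I \<inter> ground N = I \<inter> ground N" using e disj by auto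
    ultimately show ?thesis using I by (intro bexI[of _ e]) (auto simp: ds)
  next
    case 2
    then obtain e where e: "e \<in> (J \<inter> ground N) - (I \<inter> ground N)" "insert e (I \<inter> ground N) \<in> indeps N"
      using matroidD(7)[OF N] I J by blast
    moreover have "insert e I \<inter> ground N = insert e (I \<inter> ground N)"
      "insert e I \<inter> ground M = I \<inter> ground M" using e disj by auto
    ultimately show ?thesis using I by (intro bexI[of _ e]) (auto simp: ds)
  qed
qed

section \<open>Bases, contraction and closure\<close>

lemma basis_of_exists:
  assumes "is_matroid M"
  obtains B where "basis_of M X B"
  using basis_extend[OF assms matroidD(2)[OF assms], of X] by auto

lemma card_indep_le_basis:
  assumes M: "is_matroid M" and "basis_of M X B" "I \<in> indeps M" "I \<subseteq> X"
  shows "card I \<le> card B"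
proof -
  obtain C where C: "basis_of M X C" "I \<subseteq> C" using basis_extend[OF M assms(3,4)] .
  have "finite C" using C(1) matroidD(5)[OF M] by (auto simp: basis_of_def)
  then have "card I \<le> card C" using C(2) by (rule card_mono)
  then show ?thesis using rk_basis[OF M] C(1) assms(2) by metis
qed

text \<open>Extend \<open>C\<close> inside \<open>I \<union> B \<union> C\<close>: the result meets
  \<open>X\<close> in \<open>C\<close> alone, so it lies in \<open>I \<union> C\<close>, and it is
  at least as large as \<open>I \<union> B\<close>. As \<open>B\<close> and \<open>C\<close> have
  equal size, it is all of \<open>I \<union> C\<close>. Hence any basis of a contracted set may be
  chosen to describe the contraction.\<close>

lemma basis_exchange_union:
  assumes M: "is_matroid M" and B: "basis_of M X B" and C: "basis_of M X C"
    and I: "I \<inter> X = {}" "I \<union> B \<in> indeps M"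
  shows "I \<union> C \<in> indeps M"
proof -
  have CI: "C \<in> indeps M" "C \<subseteq> X" and BX: "B \<subseteq> X" using B C by (auto simp: basis_of_def)
  obtain D where D: "basis_of M (I \<union> B \<union> C) D" "C \<subseteq> D"
    using basis_extend[OF M CI(1), of "I \<union> B \<union> C"] by blast
  have DI: "D \<in> indeps M" "D \<subseteq> I \<union> B \<union> C" using D by (auto simp: basis_of_def)
  have "D \<inter> X \<in> indeps M" using matroidD(6)[OF M DI(1)] by blast
  then have "D \<inter> X = C" using C D(2) CI unfolding basis_of_def by blast
  then have sub: "D \<subseteq> I \<union> C" using DI BX by blast
  have fin: "finite (I \<union> B)" "finite C" using matroidD(5)[OF M] I CI by auto
  have "card (I \<union> B) \<le> card D" using card_indep_le_basis[OF M D(1) I(2)] by blast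
  moreover have "card (I \<union> B) = card I + card B" "card (I \<union> C) = card I + card C"
    using fin I(1) BX CI(2) by (auto intro!: card_Un_disjoint)
  moreover have "card B = card C" using rk_basis[OF M] B C by metis
  ultimately have "D = I \<union> C" using sub fin by (intro card_seteq) auto
  then show ?thesis using DI by simp
qed

lemma contraction_indeps:
  assumes M: "is_matroid M" and B: "basis_of M X B"
  shows "indeps (contraction M X) = {I. I \<subseteq> ground M - X \<and> I \<union> B \<in> indeps M}"
proof -
  have "I \<union> B \<in> indeps M" if "I \<subseteq> ground M - X" "basis_of M X C" "I \<union> C \<in> indeps M" for I C
    using basis_exchange_union[OF M that(2) B _ that(3)] that(1) by blast
  then show ?thesis using B by (auto simp: contraction_def)
qed

lemma is_matroid_contraction:
  assumes M: "is_matroid M"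
  shows "is_matroid (contraction M X)"
proof -
  obtain B where B: "basis_of M X B" using basis_of_exists[OF M] .
  note ci = contraction_indeps[OF M B]
  have BI: "B \<in> indeps M" "B \<subseteq> X" using B by (auto simp: basis_of_def)
  show ?thesis
    unfolding is_matroid_def
  proof (intro conjI allI impI)
    show "finite (ground (contraction M X))" using matroidD(1)[OF M] by (simp add: contraction_def)
    show "indeps (contraction M X) \<subseteq> Pow (ground (contraction M X))"
      by (auto simp: contraction_def)
    show "{} \<in> indeps (contraction M X)" using BI by (simp add: ci)
    fix I J
    {
      assume IJ: "J \<in> indeps (contraction M X) \<and> I \<subseteq> J"
      then have "I \<union> B \<subseteq> J \<union> B" by auto
      then show "I \<in> indeps (contraction M X)"
        using IJ matroidD(6)[OF M, of "J \<union> B" "I \<union> B"] by (auto simp: ci)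
    }
    assume asm: "I \<in> indeps (contraction M X) \<and> J \<in> indeps (contraction M X) \<and> card I < card J"
    then have K: "I \<subseteq> ground M - X" "I \<union> B \<in> indeps M" "J \<subseteq> ground M - X" "J \<union> B \<in> indeps M"
      by (auto simp: ci)
    have "card (K \<union> B) = card K + card B" if "K \<subseteq> ground M - X" "K \<union> B \<in> indeps M" for K
      using that BI matroidD(5)[OF M that(2)] by (intro card_Un_disjoint) auto
    then have "card (I \<union> B) < card (J \<union> B)" using K asm by simp
    then obtain e where "e \<in> (J \<union> B) - (I \<union> B)" "insert e (I \<union> B) \<in> indeps M"
      using matroidD(7)[OF M] K by blast
    then show "\<exists>e\<in>J - I. insert e I \<in> indeps (contraction M X)"
      using K by (intro bexI[of _ e]) (auto simp: ci)
  qed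
qed

lemma cl_mono:
  assumes M: "is_matroid M" and "Y \<subseteq> Z"
  shows "cl M Y \<subseteq> cl M Z"
proof
  fix f assume f: "f \<in> cl M Y"
  obtain B where B: "basis_of M Y B" using basis_of_exists[OF M] .
  then have "B \<in> indeps M" "B \<subseteq> Z" using assms(2) by (auto simp: basis_of_def)
  then obtain C where C: "basis_of M Z C" "B \<subseteq> C" using basis_extend[OF M] by metis
  have "insert f C \<notin> indeps M" if "insert f B \<notin> indeps M"
    using matroidD(6)[OF M, of "insert f C" "insert f B"] that C(2) by blast
  then show "f \<in> cl M Z" using f mem_cl_basis[OF M B] mem_cl_basis[OF M C(1)] C(2) by blast
qed

section \<open>Free placement\<close>

text \<open>An independent set that spans \<open>Y\<close> spans all of \<open>cl M Y\<close>, so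
  the generators alone decide whether \<open>x\<close> can be added. This is the rule by which every
  placement is undone later: the placed element is traded for one of the generators of its
  flat.\<close>

lemma free_place_cl:
  fixes M :: "'a matroid"
  assumes M: "is_matroid M" and Y: "Y \<subseteq> ground M" and x: "x \<notin> ground M"
  defines "K \<equiv> free_place M (cl M Y) x"
  shows "is_matroid K" "ground K = insert x (ground M)"
    and "x \<notin> J \<Longrightarrow> J \<in> indeps K \<longleftrightarrow> J \<in> indeps M"
    and "x \<notin> J \<Longrightarrow> insert x J \<in> indeps K \<longleftrightarrow> (\<exists>f\<in>Y. f \<notin> J \<and> insert f J \<in> indeps M)"
proof -
  have "cl M Y \<subseteq> ground M" by (auto simp: cl_def)
  from theI'[OF is_free_placement_ex1[OF M this x]]
  have K: "is_free_placement M (cl M Y) x K" by (simp add: K_def free_place_def)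
  then show KM: "is_matroid K" and Kg: "ground K = insert x (ground M)"
    by (auto simp: is_free_placement_def)
  have Kd: "deletion K {x} = M" and
    Ks: "\<And>X. X \<subseteq> ground M \<Longrightarrow> spans K X {x} \<longleftrightarrow> spans M X (cl M Y)"
    using K by (auto simp: is_free_placement_def)
  have Kin: "J \<in> indeps K \<longleftrightarrow> J \<in> indeps M" if "x \<notin> J" for J
  proof -
    have "indeps M = {I \<in> indeps K. I \<subseteq> ground K - {x}}"
      using Kd by (auto simp: deletion_def)
    then show ?thesis using matroidD(4)[OF KM] that Kg by blast
  qed
  show "J \<in> indeps K \<longleftrightarrow> J \<in> indeps M" if "x \<notin> J" using Kin[OF that] .
  have spans: "spans M J (cl M Y) \<longleftrightarrow> (\<forall>f\<in>Y. f \<in> J \<or> insert f J \<notin> indeps M)"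
    if J: "J \<in> indeps M" for J
  proof
    assume "spans M J (cl M Y)"
    moreover have "Y \<subseteq> cl M Y" using Y by (auto simp: cl_def insert_absorb)
    ultimately show "\<forall>f\<in>Y. f \<in> J \<or> insert f J \<notin> indeps M"
      using mem_cl_indep[OF M J] unfolding spans_def by blast
  next
    assume *: "\<forall>f\<in>Y. f \<in> J \<or> insert f J \<notin> indeps M"
    have "basis_of M (J \<union> Y) J"
      unfolding basis_of_def
    proof (intro conjI ballI impI J)
      fix I assume I: "I \<in> indeps M" "I \<subseteq> J \<union> Y" "J \<subseteq> I"
      have "f \<in> J" if "f \<in> I" for f
        using that I * matroidD(6)[OF M I(1), of "insert f J"] by blast
      then show "I = J" using I by blast
    qed simp
    then have JY: "cl M (J \<union> Y) = cl M J" by (rule cl_basis[OF M])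
    then show "spans M J (cl M Y)" using cl_mono[OF M, of Y "J \<union> Y"] by (auto simp: spans_def)
  qed
  show "insert x J \<in> indeps K \<longleftrightarrow> (\<exists>f\<in>Y. f \<notin> J \<and> insert f J \<in> indeps M)" if xJ: "x \<notin> J"
  proof (cases "J \<in> indeps M")
    case True
    have "x \<in> cl K J \<longleftrightarrow> insert x J \<notin> indeps K"
      using mem_cl_indep[OF KM, of J x] Kin[OF xJ] True Kg xJ by auto
    then show ?thesis using Ks[OF matroidD(4)[OF M True]] spans[OF True] by (auto simp: spans_def)
  next
    case False
    then show ?thesis
      using Kin[OF xJ] matroidD(6)[OF KM, of "insert x J" J] matroidD(6)[OF M, of "insert _ J" J]
      by blast
  qed
qed

text \<open>The placed element is traded for one of the generators \<open>a\<close> and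
  \<open>b\<close> of its line; the original \<open>a\<close> is deleted, so its name is free. A
  trade for \<open>b\<close> counts only if \<open>b\<close> is new, hence the condition
  \<open>b \<notin> I\<close>.\<close>

lemma move_indeps:
  assumes K: "is_matroid K" and a: "a \<in> ground K" and b: "b \<in> ground K" and ab: "a \<noteq> b"
  shows "ground (move K a b) = ground K"
    and "a \<notin> I \<Longrightarrow> I \<in> indeps (move K a b) \<longleftrightarrow> I \<in> indeps K"
    and "a \<notin> I \<Longrightarrow> insert a I \<in> indeps (move K a b) \<longleftrightarrow>
          insert a I \<in> indeps K \<or> b \<notin> I \<and> insert b I \<in> indeps K"
proof -
  define K0 where "K0 = relabel Some K"
  define K1 where "K1 = free_place K0 (cl K0 {Some a, Some b}) None"
  let ?f = "case_option a id"
  have mv: "move K a b = relabel ?f (deletion K1 {Some a})"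
    by (simp add: move_def K0_def K1_def Let_def)
  have K0: "is_matroid K0" unfolding K0_def by (rule is_matroid_relabel[OF K]) simp
  have g0: "ground K0 = Some ` ground K" by (simp add: K0_def relabel_def)
  have i0: "Some ` I \<in> indeps K0 \<longleftrightarrow> I \<in> indeps K" for I
    unfolding K0_def relabel_def by (auto simp: inj_image_eq_iff image_iff)
  have "{Some a, Some b} \<subseteq> ground K0" "None \<notin> ground K0" using a b by (auto simp: g0)
  note fp = free_place_cl[OF K0 this, folded K1_def]
  let ?D = "deletion K1 {Some a}"
  have D: "is_matroid ?D" by (rule is_matroid_deletion[OF fp(1)])
  have gD: "ground ?D = insert None (Some ` (ground K - {a}))"
    using fp(2) by (auto simp: deletion_def g0)
  have inj: "inj_on ?f (ground ?D)" by (auto simp: gD inj_on_def)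
  show g: "ground (move K a b) = ground K"
    using a by (auto simp: mv relabel_def gD image_image)
  have M: "is_matroid (move K a b)" unfolding mv by (rule is_matroid_relabel[OF D inj])
  have iD: "J \<in> indeps ?D \<longleftrightarrow> J \<in> indeps K1" if "J \<subseteq> ground ?D" for J
    using that by (auto simp: deletion_def)
  show "I \<in> indeps (move K a b) \<longleftrightarrow> I \<in> indeps K" if aI: "a \<notin> I"
  proof (cases "I \<subseteq> ground K")
    case True
    then have s: "Some ` I \<subseteq> ground ?D" using aI by (auto simp: gD)
    have "?f ` Some ` I = I" by (simp add: image_image)
    then have "I \<in> indeps (move K a b) \<longleftrightarrow> Some ` I \<in> indeps K1"
      using relabel_indeps[OF D inj s] iD[OF s] by (simp add: mv)
    also have "\<dots> \<longleftrightarrow> I \<in> indeps K" using fp(3)[of "Some ` I"] i0 by auto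
    finally show ?thesis .
  next
    case False
    then show ?thesis using matroidD(4)[OF M] matroidD(4)[OF K] g by blast
  qed
  show "insert a I \<in> indeps (move K a b) \<longleftrightarrow>
          insert a I \<in> indeps K \<or> b \<notin> I \<and> insert b I \<in> indeps K" if aI: "a \<notin> I"
  proof (cases "I \<subseteq> ground K")
    case True
    then have s: "insert None (Some ` I) \<subseteq> ground ?D" using aI by (auto simp: gD)
    have "?f ` insert None (Some ` I) = insert a I" by (simp add: image_image)
    then have "insert a I \<in> indeps (move K a b) \<longleftrightarrow> insert None (Some ` I) \<in> indeps K1"
      using relabel_indeps[OF D inj s] iD[OF s] by (simp add: mv)
    also have "\<dots> \<longleftrightarrow> Some ` (insert a I) \<in> indeps K0 \<or> b \<notin> I \<and> Some ` (insert b I) \<in> indeps K0"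
      using fp(4)[of "Some ` I"] aI by auto
    finally show ?thesis by (simp only: i0)
  next
    case False
    then show ?thesis using matroidD(4)[OF M] matroidD(4)[OF K] g by blast
  qed
qed

text \<open>The induction runs from the end of the list, since the placement made last is undone
  first. A copy is traded for its original or for \<open>c\<close>; once \<open>c\<close> has been
  used it is no longer new, hence at most one exceptional \<open>x\<close>. That \<open>J\<close>
  avoids the originals of \<open>S\<close> keeps each traded original new as well.\<close>

lemma fold_free_place:
  fixes c :: "'a elt"
  defines "step \<equiv> \<lambda>x K. free_place K (cl K {Elt x, c}) (Copy x)"
  assumes "is_matroid K" "distinct xs" "Elt ` set xs \<subseteq> ground K" "c \<in> ground K" "c \<notin> range Elt"
    "Copy ` set xs \<inter> ground K = {}"
  shows "is_matroid (fold step xs K) \<and> ground (fold step xs K) = ground K \<union> Copy ` set xs \<and>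
    (\<forall>J S. S \<subseteq> set xs \<longrightarrow> J \<inter> Copy ` set xs = {} \<longrightarrow> J \<inter> Elt ` S = {} \<longrightarrow>
      (J \<union> Copy ` S \<in> indeps (fold step xs K) \<longleftrightarrow>
        J \<union> Elt ` S \<in> indeps K \<or>
        c \<notin> J \<and> (\<exists>x\<in>S. insert c (J \<union> Elt ` (S - {x})) \<in> indeps K)))"
  using assms(3-)
proof (induction xs rule: rev_induct)
  case Nil
  then show ?case using assms(2) by auto
next
  case (snoc x xs)
  let ?K = "fold step xs K"
  have IH: "is_matroid ?K" "ground ?K = ground K \<union> Copy ` set xs"
    "\<And>J S. S \<subseteq> set xs \<Longrightarrow> J \<inter> Copy ` set xs = {} \<Longrightarrow> J \<inter> Elt ` S = {} \<Longrightarrow>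
      J \<union> Copy ` S \<in> indeps ?K \<longleftrightarrow> J \<union> Elt ` S \<in> indeps K \<or>
        c \<notin> J \<and> (\<exists>x\<in>S. insert c (J \<union> Elt ` (S - {x})) \<in> indeps K)"
    using snoc by auto
  have cC: "c \<noteq> Copy y" if "y \<in> set (xs @ [x])" for y using snoc.prems that by auto
  have cE: "c \<noteq> Elt y" for y using snoc.prems by auto
  have Y: "{Elt x, c} \<subseteq> ground ?K" and x: "Copy x \<notin> ground ?K"
    using snoc.prems IH(2) by auto
  have f: "fold step (xs @ [x]) K = free_place ?K (cl ?K {Elt x, c}) (Copy x)"
    by (simp add: step_def)
  note fp = free_place_cl[OF IH(1) Y x, folded f]
  have "J \<union> Copy ` S \<in> indeps (fold step (xs @ [x]) K) \<longleftrightarrow> J \<union> Elt ` S \<in> indeps K \<or>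
        c \<notin> J \<and> (\<exists>x\<in>S. insert c (J \<union> Elt ` (S - {x})) \<in> indeps K)"
    if S: "S \<subseteq> set (xs @ [x])" and J: "J \<inter> Copy ` set (xs @ [x]) = {}" "J \<inter> Elt ` S = {}" for J S
  proof (cases "x \<in> S")
    case False
    then have "Copy x \<notin> J \<union> Copy ` S" "S \<subseteq> set xs" using J S by auto
    then show ?thesis using fp(3) IH(3)[of S J] J by auto
  next
    case True
    define S0 where "S0 = S - {x}"
    have S0: "S = insert x S0" "x \<notin> S0" "S0 \<subseteq> set xs" using True S by (auto simp: S0_def)
    have n: "Copy x \<notin> J \<union> Copy ` S0" using J S0 by auto
    have "J \<union> Copy ` S \<in> indeps (fold step (xs @ [x]) K) \<longleftrightarrow>
      (\<exists>f\<in>{Elt x, c}. f \<notin> J \<union> Copy ` S0 \<and> insert f (J \<union> Copy ` S0) \<in> indeps ?K)"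
      using fp(4)[OF n] S0 by simp
    also have "\<dots> \<longleftrightarrow> insert (Elt x) J \<union> Copy ` S0 \<in> indeps ?K \<or>
       c \<notin> J \<and> insert c J \<union> Copy ` S0 \<in> indeps ?K"
    proof -
      have "Elt x \<notin> J \<union> Copy ` S0" using J S0 by auto
      moreover have "c \<notin> Copy ` S0" using cC S0(3) by auto
      ultimately show ?thesis by simp
    qed
    also have "insert (Elt x) J \<union> Copy ` S0 \<in> indeps ?K \<longleftrightarrow> J \<union> Elt ` S \<in> indeps K \<or>
        c \<notin> J \<and> (\<exists>y\<in>S0. insert c (J \<union> Elt ` (S - {y})) \<in> indeps K)"
    proof -
      have "insert (Elt x) J \<inter> Copy ` set xs = {}" "insert (Elt x) J \<inter> Elt ` S0 = {}"
        using J S0 by auto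
      moreover have "insert (Elt x) J \<union> Elt ` (S0 - {y}) = J \<union> Elt ` (S - {y})" if "y \<in> S0" for y
        using S0 that by auto
      ultimately show ?thesis
        using IH(3)[OF S0(3), of "insert (Elt x) J"] cE S0(1) by (simp cong: bex_cong)
    qed
    also have "insert c J \<union> Copy ` S0 \<in> indeps ?K \<longleftrightarrow> insert c (J \<union> Elt ` S0) \<in> indeps K"
    proof -
      have "insert c J \<inter> Copy ` set xs = {}" "insert c J \<inter> Elt ` S0 = {}"
        using J S0(1) cE cC by auto
      then show ?thesis using IH(3)[OF S0(3), of "insert c J"] by simp
    qed
    finally have "J \<union> Copy ` S \<in> indeps (fold step (xs @ [x]) K) \<longleftrightarrow> (J \<union> Elt ` S \<in> indeps K \<or>
        c \<notin> J \<and> (\<exists>y\<in>S0. insert c (J \<union> Elt ` (S - {y})) \<in> indeps K)) \<or>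
        c \<notin> J \<and> insert c (J \<union> Elt ` S0) \<in> indeps K" .
    moreover have "(\<exists>y\<in>S. insert c (J \<union> Elt ` (S - {y})) \<in> indeps K) \<longleftrightarrow>
        insert c (J \<union> Elt ` S0) \<in> indeps K \<or> (\<exists>y\<in>S0. insert c (J \<union> Elt ` (S - {y})) \<in> indeps K)"
      using True by (auto simp: S0_def)
    ultimately show ?thesis by blast
  qed
  then show ?case using fp(1,2) IH(2) by auto
qed

section \<open>Independence in the construction\<close>

text \<open>Makes the presence of one element a Boolean parameter, so that the four cases for
  \<open>a\<close> and \<open>b\<close>, or for \<open>p\<close> and \<open>q\<close>, fit in one
  formula.\<close>

definition flag_set :: "'b \<Rightarrow> bool \<Rightarrow> 'b set" where
  "flag_set c u = (if u then {c} else {})"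

lemma flag_set_simps [simp]: "flag_set c True = {c}" "flag_set c False = {}" "x \<in> flag_set c u \<longleftrightarrow> u \<and> x = c"
  by (auto simp: flag_set_def)

text \<open>
  Resolving the free placements backwards, each copy \<open>x\<^sub>a\<close> is replaced by \<open>x\<close> or by \<open>a\<close>, the
  latter at most once and only if \<open>a\<close> is not present already.
\<close>

definition resolve :: "'a set \<Rightarrow> bool \<Rightarrow> ('a set \<times> bool) set" where
  "resolve S u = (if u then {(S, True)} else insert (S, False) {(S - {x}, True) | x. x \<in> S})"

text \<open>
  Then \<open>a\<close> (present iff \<open>\<alpha>\<close>) is replaced by \<open>p\<close> (iff \<open>\<alpha>'\<close>) or by an element of \<open>N\<close>, and similarly
  \<open>b\<close>; there is a suitable element of \<open>N\<close> iff there is enough room in the rank of \<open>N\<close>.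
\<close>

definition placed_indep :: "'a set set \<Rightarrow> 'a \<Rightarrow> 'a \<Rightarrow> 'a matroid \<Rightarrow> 'a set \<Rightarrow> 'a set \<Rightarrow> bool \<Rightarrow> bool \<Rightarrow> bool" where
  "placed_indep \<L> p q N X W \<alpha> \<beta> \<longleftrightarrow> W \<in> indeps N \<and>
     (\<exists>\<alpha>' \<beta>'. (\<alpha>' \<longrightarrow> \<alpha>) \<and> (\<beta>' \<longrightarrow> \<beta>) \<and> X \<union> flag_set p \<alpha>' \<union> flag_set q \<beta>' \<in> \<L> \<and>
        card W + of_bool (\<alpha> \<and> \<not> \<alpha>') + of_bool (\<beta> \<and> \<not> \<beta>') \<le> rk N (ground N))"

text \<open>\<open>X\<close>, \<open>S\<close> and \<open>T\<close> are the parts of the tested set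
  in E(L) - {p, q}, in \<open>A\<close> and in \<open>B\<close>; \<open>u\<close> and
  \<open>v\<close> tell whether it contains \<open>a\<close> and \<open>b\<close>. A bare set system
  \<open>\<L>\<close> replaces \<open>L\<close>, so that constructions from different matroids over
  the same \<open>N\<close> can be compared.\<close>

definition constr_indep :: "'a set set \<Rightarrow> 'a \<Rightarrow> 'a \<Rightarrow> 'a matroid \<Rightarrow> 'a set \<Rightarrow> 'a set \<Rightarrow> 'a set \<Rightarrow> bool \<Rightarrow> bool \<Rightarrow> bool" where
  "constr_indep \<L> p q N X S T u v \<longleftrightarrow>
     (\<exists>(S', \<alpha>)\<in>resolve S u. \<exists>(T', \<beta>)\<in>resolve T v. placed_indep \<L> p q N X (S' \<union> T') \<alpha> \<beta>)"

lemma placed_indep_commute: "placed_indep \<L> p q N X W \<alpha> \<beta> \<longleftrightarrow> placed_indep \<L> q p N X W \<beta> \<alpha>"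
  unfolding placed_indep_def by (auto simp: ex_bool_eq insert_commute[of p q] add.commute)

text \<open>A basis of \<open>N\<close> leaves no room, so \<open>a\<close> and \<open>b\<close> are
  forced to become \<open>p\<close> and \<open>q\<close>. Applied to the bases \<open>A\<close> and
  \<open>B\<close>, this is how \<open>L\<close> can be read off the construction.\<close>

lemma placed_indep_full:
  assumes "card W = rk N (ground N)" "W \<in> indeps N"
  shows "placed_indep \<L> p q N X W \<alpha> \<beta> \<longleftrightarrow> X \<union> flag_set p \<alpha> \<union> flag_set q \<beta> \<in> \<L>"
  using assms by (cases \<alpha>; cases \<beta>) (simp_all add: placed_indep_def ex_bool_eq)

lemma resolve_simps:
  "resolve S True = {(S, True)}" "resolve {} False = {({}, False)}" "(S, False) \<in> resolve S False"
  by (auto simp: resolve_def)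

lemma constr_indepI:
  assumes "(S', \<alpha>) \<in> resolve S u" "(T', \<beta>) \<in> resolve T v" "placed_indep \<L> p q N X (S' \<union> T') \<alpha> \<beta>"
  shows "constr_indep \<L> p q N X S T u v"
  using assms unfolding constr_indep_def by fast

lemma constr_indepE:
  assumes "constr_indep \<L> p q N X S T u v"
  obtains S' \<alpha> T' \<beta> where "(S', \<alpha>) \<in> resolve S u" "(T', \<beta>) \<in> resolve T v"
    "placed_indep \<L> p q N X (S' \<union> T') \<alpha> \<beta>"
  using assms unfolding constr_indep_def by fast

lemma constr_indep_commute: "constr_indep \<L> p q N X S T u v \<longleftrightarrow> constr_indep \<L> q p N X T S v u"
proof -
  have "constr_indep \<L> q p N X T S v u" if "constr_indep \<L> p q N X S T u v" for p q S T u v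
    using that
  proof (rule constr_indepE)
    fix S' \<alpha> T' \<beta>
    assume o: "(S', \<alpha>) \<in> resolve S u" "(T', \<beta>) \<in> resolve T v" and c: "placed_indep \<L> p q N X (S' \<union> T') \<alpha> \<beta>"
    have "placed_indep \<L> q p N X (T' \<union> S') \<beta> \<alpha>" using c by (simp add: placed_indep_commute[of \<L> q p] Un_commute)
    then show ?thesis by (rule constr_indepI[OF o(2,1)])
  qed
  then show ?thesis by blast
qed

lemma bex_resolve:
  "(\<exists>(S', \<alpha>)\<in>resolve S u. P S' \<alpha>) \<longleftrightarrow> P S u \<or> \<not> u \<and> (\<exists>x\<in>S. P (S - {x}) True)"
  by (auto simp: resolve_def)

text \<open>Only four memberships in \<open>\<L>\<close> enter, one for each choice of which of
  \<open>p\<close> and \<open>q\<close> are used. Commuting with a deletion or contraction inside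
  E(L) - {p, q} is thereby reduced to checking these four.\<close>

lemma constr_indep_cong:
  assumes "X \<in> \<L> \<longleftrightarrow> X' \<in> \<L>'" "insert p X \<in> \<L> \<longleftrightarrow> insert p X' \<in> \<L>'"
    "insert q X \<in> \<L> \<longleftrightarrow> insert q X' \<in> \<L>'" "insert p (insert q X) \<in> \<L> \<longleftrightarrow> insert p (insert q X') \<in> \<L>'"
  shows "constr_indep \<L> p q N X S T u v \<longleftrightarrow> constr_indep \<L>' p q N X' S T u v"
proof -
  have c: "placed_indep \<L> p q N X W \<alpha> \<beta> \<longleftrightarrow> placed_indep \<L>' p q N X' W \<alpha> \<beta>" for W \<alpha> \<beta>
    unfolding placed_indep_def using assms by (simp add: ex_bool_eq insert_commute)
  show ?thesis unfolding constr_indep_def c ..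
qed

text \<open>Allows the missing element to be moved from \<open>S\<close> to \<open>T\<close>, that
  is, a copy resolved to \<open>a\<close> to be exchanged for one resolved to \<open>b\<close>. A
  basis \<open>C\<close> of \<open>S \<union> T\<close> containing \<open>S\<close> has at least
  card S - 1 + card T elements. If it misses some \<open>y\<close> of \<open>T\<close>, it fits into
  \<open>S \<union> (T - {y})\<close>, which has just that size; if it misses none, every
  \<open>y\<close> will do.\<close>

lemma indep_shift:
  assumes N: "is_matroid N" and S: "S \<in> indeps N" "x \<in> S" and W: "S - {x} \<union> T \<in> indeps N"
    and T: "T \<noteq> {}" and ST: "S \<inter> T = {}"
  shows "\<exists>y\<in>T. S \<union> (T - {y}) \<in> indeps N"
proof -
  obtain C where C: "basis_of N (S \<union> T) C" "S \<subseteq> C" using basis_extend[OF N S(1)] by blast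
  have CI: "C \<in> indeps N" "C \<subseteq> S \<union> T" using C by (auto simp: basis_of_def)
  have fin: "finite S" "finite T" using matroidD(5)[OF N] S(1) W by auto
  show ?thesis
  proof (cases "T \<subseteq> C")
    case True
    obtain y where "y \<in> T" using T by blast
    moreover have "S \<union> (T - {y}) \<subseteq> C" using True C(2) by blast
    ultimately show ?thesis using matroidD(6)[OF N CI(1)] by blast
  next
    case False
    then obtain y where y: "y \<in> T" "y \<notin> C" by blast
    have "card (S - {x} \<union> T) \<le> card C" using card_indep_le_basis[OF N C(1) W] by blast
    moreover have "card (S - {x} \<union> T) = card S - 1 + card T"
      using fin ST S(2) by (subst card_Un_disjoint) auto
    moreover have "card (S \<union> (T - {y})) = card S + (card T - 1)"
      using fin ST y(1) by (subst card_Un_disjoint) auto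
    moreover have "card S > 0" "card T > 0" using S(2) y(1) fin by (auto simp: card_gt_0_iff)
    ultimately have "card (S \<union> (T - {y})) \<le> card C" by simp
    moreover have "C \<subseteq> S \<union> (T - {y})" using CI y by blast
    ultimately have "C = S \<union> (T - {y})" using fin by (intro card_seteq) auto
    then show ?thesis using CI y by blast
  qed
qed

lemma card_indep_le_rk:
  assumes "is_matroid N" "I \<in> indeps N"
  shows "card I \<le> rk N (ground N)"
  using basis_of_exists[OF assms(1)] card_indep_le_basis[OF assms(1) _ assms(2)]
    rk_basis[OF assms(1)] matroidD(4)[OF assms] by metis

text \<open>
  Here \<open>\<L>'\<close> plays the role of $L_{p \rightarrow q}$. A set which is independent in the construction
  for $L_{p \rightarrow q}$ only has \<open>a\<close> replaced by \<open>p\<close>, moved to \<open>q\<close>; then \<open>b\<close> can be replaced by \<open>q\<close>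
  instead, unless \<open>A \<union> {a}\<close> is present and \<open>B \<union> {b}\<close> is avoided.
\<close>

lemma constr_indep_move:
  assumes N: "is_matroid N" and A: "is_basis N A" and S: "S \<subseteq> A" and T: "T \<in> indeps N"
    and ST: "S \<inter> T = {}"
    and rel: "X \<in> \<L>' \<longleftrightarrow> X \<in> \<L>" "insert q X \<in> \<L>' \<longleftrightarrow> insert q X \<in> \<L>"
      "insert p X \<in> \<L>' \<longleftrightarrow> insert p X \<in> \<L> \<or> insert q X \<in> \<L>"
      "insert p (insert q X) \<in> \<L>' \<longleftrightarrow> insert p (insert q X) \<in> \<L>"
    and down: "insert q X \<in> \<L> \<Longrightarrow> X \<in> \<L>"
    and ne: "T \<noteq> {} \<or> v \<or> \<not> (S = A \<and> u)"
  shows "constr_indep \<L>' p q N X S T u v \<longleftrightarrow> constr_indep \<L> p q N X S T u v"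
proof
  assume "constr_indep \<L> p q N X S T u v"
  moreover have "placed_indep \<L>' p q N X W \<alpha> \<beta>" if "placed_indep \<L> p q N X W \<alpha> \<beta>" for W \<alpha> \<beta>
    using that rel unfolding placed_indep_def by (auto simp: ex_bool_eq insert_commute)
  ultimately show "constr_indep \<L>' p q N X S T u v" by (metis constr_indepE constr_indepI)
next
  assume "constr_indep \<L>' p q N X S T u v"
  then obtain S' \<alpha> T' \<beta> where o: "(S', \<alpha>) \<in> resolve S u" "(T', \<beta>) \<in> resolve T v"
    and c: "placed_indep \<L>' p q N X (S' \<union> T') \<alpha> \<beta>" by (rule constr_indepE)
  have AI: "A \<in> indeps N" using A by (simp add: basis_of_def)
  have SI: "S \<in> indeps N" using matroidD(6)[OF N AI S] .
  have fin: "finite S" "finite T" "finite A" using matroidD(5)[OF N] SI T AI by auto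
  have r: "rk N (ground N) = card A" by (rule rk_basis[OF N A])
  show "constr_indep \<L> p q N X S T u v"
  proof (cases "placed_indep \<L> p q N X (S' \<union> T') \<alpha> \<beta>")
    case True
    then show ?thesis by (rule constr_indepI[OF o])
  next
    case False
    \<comment> \<open>A witness for \<open>\<L>'\<close> is lost in \<open>\<L>\<close> only if it
      uses \<open>p\<close> but not \<open>q\<close>, with \<open>insert p X\<close> in
      \<open>\<L>'\<close> merely because \<open>insert q X\<close> is in \<open>\<L>\<close>. A
      present \<open>b\<close> then sits in \<open>N\<close>, which gives the extra unit of
      room.\<close>
    then have W: "S' \<union> T' \<in> indeps N" "\<alpha>" "insert q X \<in> \<L>"
      and \<beta>: "\<beta> \<Longrightarrow> card (S' \<union> T') + 1 \<le> rk N (ground N)"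
      using c rel unfolding placed_indep_def by (auto simp: ex_bool_eq insert_commute)
    note XL = down[OF W(3)]
    \<comment> \<open>Otherwise \<open>a\<close> and \<open>b\<close> could swap: \<open>b\<close>
      becomes \<open>q\<close> and \<open>a\<close> takes the room in \<open>N\<close> that
      \<open>b\<close> occupied.\<close>
    have "\<not> \<beta>"
    proof
      assume "\<beta>"
      then have "placed_indep \<L> p q N X (S' \<union> T') \<alpha> \<beta>" using W \<beta> unfolding placed_indep_def
        by (intro conjI exI[of _ False] exI[of _ True]) auto
      then show False using False by simp
    qed
    then have v: "\<not> v" "T' = T" using o(2) by (auto simp: resolve_def split: if_splits)
    have le: "card (S' \<union> T') \<le> rk N (ground N)" by (rule card_indep_le_rk[OF N W(1)])
    show ?thesis
    proof (cases "T = {}")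
      case True
      show ?thesis
      proof (cases u)
        case u: True
        \<comment> \<open>There is no route to \<open>q\<close> here, so \<open>a\<close> has to go
          into \<open>N\<close>; by \<open>ne\<close> the basis \<open>A\<close> is not filled and
          leaves room.\<close>
        then have "S \<noteq> A" using ne v True by blast
        then have "card S < card A" using S fin by (intro psubset_card_mono) auto
        then have "placed_indep \<L> p q N X (S \<union> T) True False"
          using XL SI r True unfolding placed_indep_def
          by (intro conjI exI[of _ False]) auto
        then show ?thesis by (rule constr_indepI[rotated 2]) (use u v in \<open>auto simp: resolve_def\<close>)
      next
        case False
        have "placed_indep \<L> p q N X (S \<union> T) False False"
          using XL SI True card_indep_le_rk[OF N SI] unfolding placed_indep_def
          by (intro conjI exI[of _ False]) auto
        then show ?thesis by (rule constr_indepI[rotated 2]) (use False v in \<open>auto simp: resolve_def\<close>)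
      qed
    next
      case Tne: False
      show ?thesis
      proof (cases u)
        case u: True
        then have S': "S' = S" using o(1) by (auto simp: resolve_def)
        \<comment> \<open>The copy of \<open>y\<close> is resolved to \<open>b\<close> and
          \<open>b\<close> to \<open>q\<close>; this vacates a place in \<open>N\<close>, which
          \<open>a\<close> takes.\<close>
        obtain y where y: "y \<in> T" using Tne by blast
        have "S \<union> (T - {y}) \<subset> S' \<union> T'" using y S' v ST by auto
        then have "card (S \<union> (T - {y})) < card (S' \<union> T')" using fin S' v
          by (intro psubset_card_mono) auto
        moreover have "S \<union> (T - {y}) \<in> indeps N"
          by (rule matroidD(6)[OF N W(1)]) (use S' v in auto)
        ultimately have "placed_indep \<L> p q N X (S \<union> (T - {y})) True True"
          using W(3) le unfolding placed_indep_def by (intro conjI exI[of _ False] exI[of _ True]) auto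
        then show ?thesis by (rule constr_indepI[rotated 2]) (use u v y in \<open>auto simp: resolve_def\<close>)
      next
        case u: False
        then obtain x where x: "x \<in> S" "S' = S - {x}" using o(1) W(2) by (auto simp: resolve_def)
        \<comment> \<open>Here \<open>a\<close> arose from the copy of \<open>x\<close>. Restoring
          \<open>x\<close> and resolving the copy of some \<open>y\<close> to \<open>b\<close>
          instead leads to \<open>q\<close> without using \<open>a\<close>.\<close>
        obtain y where y: "y \<in> T" "S \<union> (T - {y}) \<in> indeps N"
          using indep_shift[OF N SI x(1) _ Tne ST] W(1) x v by auto
        then have "placed_indep \<L> p q N X (S \<union> (T - {y})) False True"
          using W(3) card_indep_le_rk[OF N y(2)] unfolding placed_indep_def
          by (intro conjI exI[of _ False] exI[of _ True]) auto
        then show ?thesis by (rule constr_indepI[rotated 2]) (use u v y in \<open>auto simp: resolve_def\<close>)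
      qed
    qed
  qed
qed

section \<open>The construction unwound, one placement at a time\<close>

locale construction =
  fixes L N :: "'a matroid" and p q :: 'a and xs ys :: "'a list"
  assumes L: "is_matroid L" and N: "is_matroid N" and disj: "ground L \<inter> ground N = {}"
    and p: "p \<in> ground L" and q: "q \<in> ground L" and pq: "p \<noteq> q"
    and AB: "set xs \<union> set ys = ground N" and AB_disj: "set xs \<inter> set ys = {}"
    and A: "is_basis N (set xs)" and B: "is_basis N (set ys)"
    and dist: "distinct xs" "distinct ys"
begin

abbreviation "E0 \<equiv> ground L - {p, q}"
abbreviation "r \<equiv> rk N (ground N)"
abbreviation "M \<equiv> M_constr L p q N xs ys"

definition "K0 = relabel Elt (direct_sum N L)"
definition "K1 = free_place K0 (cl K0 (Elt ` (ground N \<union> {p}))) New_a"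
definition "K2 = free_place K1 (cl K1 (Elt ` (ground N \<union> {q}))) New_b"
definition "K3 = fold (\<lambda>x K. free_place K (cl K {Elt x, New_a}) (Copy x)) xs K2"
definition "K4 = fold (\<lambda>y K. free_place K (cl K {Elt y, New_b}) (Copy y)) ys K3"

lemma M1_eq: "M1 L p q N xs ys = K4"
  by (simp add: M1_def K0_def K1_def K2_def K3_def K4_def Let_def)

lemma disj': "ground N \<inter> ground L = {}" using disj by blast

lemma K0: "is_matroid K0" "ground K0 = Elt ` (ground N \<union> ground L)"
  "X \<subseteq> ground L \<Longrightarrow> W \<subseteq> ground N \<Longrightarrow>
    Elt ` (X \<union> W) \<in> indeps K0 \<longleftrightarrow> X \<in> indeps L \<and> W \<in> indeps N"
proof -
  have inj: "inj_on Elt Z" for Z :: "'a set" by (auto simp: inj_on_def)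
  note ds = is_matroid_direct_sum[OF N L disj']
  show "is_matroid K0" unfolding K0_def by (rule is_matroid_relabel[OF ds inj])
  show "ground K0 = Elt ` (ground N \<union> ground L)" by (simp add: K0_def relabel_def direct_sum_def)
  show "Elt ` (X \<union> W) \<in> indeps K0 \<longleftrightarrow> X \<in> indeps L \<and> W \<in> indeps N"
    if XW: "X \<subseteq> ground L" "W \<subseteq> ground N"
  proof -
    have "(X \<union> W) \<inter> ground L = X" "(X \<union> W) \<inter> ground N = W" using XW disj by auto
    moreover have "X \<union> W \<subseteq> ground (direct_sum N L)" using XW by (auto simp: direct_sum_def)
    ultimately show ?thesis unfolding K0_def
      using relabel_indeps[OF ds inj] direct_sum_indeps[OF N L disj', of "X \<union> W"]
      by (auto simp: direct_sum_def)
  qed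
qed

lemma K1_place: "Elt ` (ground N \<union> {p}) \<subseteq> ground K0" "New_a \<notin> ground K0"
  using p by (auto simp: K0)

lemmas K1 = free_place_cl[OF K0(1) K1_place, folded K1_def]

lemma K2_place: "Elt ` (ground N \<union> {q}) \<subseteq> ground K1" "New_b \<notin> ground K1"
  using q by (auto simp: K0 K1)

lemmas K2 = free_place_cl[OF K1(1) K2_place, folded K2_def]

text \<open>Turns replacement by an unspecified element of \<open>N\<close> into the counting
  condition of \<open>placed_indep\<close>: an independent set below full rank can always be
  augmented from the basis \<open>A\<close>.\<close>

lemma room:
  assumes "W \<subseteq> ground N"
  shows "(\<exists>f\<in>ground N. f \<notin> W \<and> insert f W \<in> indeps N) \<longleftrightarrow> W \<in> indeps N \<and> Suc (card W) \<le> r"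
proof
  assume "\<exists>f\<in>ground N. f \<notin> W \<and> insert f W \<in> indeps N"
  then obtain f where f: "f \<notin> W" "insert f W \<in> indeps N" by blast
  then have "W \<in> indeps N" "finite W" using matroidD(5)[OF N f(2)] matroidD(6)[OF N f(2)] by auto
  then show "W \<in> indeps N \<and> Suc (card W) \<le> r" using card_indep_le_rk[OF N f(2)] f(1) by simp
next
  assume W: "W \<in> indeps N \<and> Suc (card W) \<le> r"
  have AI: "set xs \<in> indeps N" using A by (simp add: basis_of_def)
  have "card W < card (set xs)" using W rk_basis[OF N A] by simp
  then obtain e where "e \<in> set xs - W" "insert e W \<in> indeps N" using matroidD(7)[OF N _ AI] W by blast
  then show "\<exists>f\<in>ground N. f \<notin> W \<and> insert f W \<in> indeps N" using AB by auto
qed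

text \<open>\<open>X\<close> must avoid \<open>p\<close>, so that \<open>p\<close> is new when
  \<open>a\<close> is traded for it, but it may contain \<open>q\<close>, which \<open>b\<close> may
  already have been traded for.\<close>

lemma K1_indep:
  assumes X: "X \<subseteq> ground L" "p \<notin> X" and W: "W \<subseteq> ground N"
  shows "Elt ` (X \<union> W) \<in> indeps K1 \<longleftrightarrow> X \<in> indeps L \<and> W \<in> indeps N"
    and "insert New_a (Elt ` (X \<union> W)) \<in> indeps K1 \<longleftrightarrow> insert p X \<in> indeps L \<and> W \<in> indeps N \<or>
      X \<in> indeps L \<and> W \<in> indeps N \<and> Suc (card W) \<le> r"
proof -
  have n: "New_a \<notin> Elt ` (X \<union> W)" by auto
  show "Elt ` (X \<union> W) \<in> indeps K1 \<longleftrightarrow> X \<in> indeps L \<and> W \<in> indeps N"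
    using K1(3)[OF n] K0(3) X W by simp
  have pN: "p \<notin> ground N" using p disj by auto
  have 1: "f \<notin> X" "insert (Elt f) (Elt ` (X \<union> W)) = Elt ` (X \<union> insert f W)" if "f \<in> ground N" for f
    using X disj that by auto
  have 2: "insert (Elt p) (Elt ` (X \<union> W)) = Elt ` (insert p X \<union> W)" by auto
  have "insert New_a (Elt ` (X \<union> W)) \<in> indeps K1 \<longleftrightarrow>
     (\<exists>f\<in>ground N \<union> {p}. f \<notin> X \<union> W \<and> insert (Elt f) (Elt ` (X \<union> W)) \<in> indeps K0)"
    using K1(4)[OF n] by auto
  also have "\<dots> \<longleftrightarrow> (\<exists>f\<in>ground N. f \<notin> W \<and> Elt ` (X \<union> insert f W) \<in> indeps K0) \<or>
      Elt ` (insert p X \<union> W) \<in> indeps K0"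
    using 1 2 X(2) pN W by auto
  also have "\<dots> \<longleftrightarrow> (\<exists>f\<in>ground N. f \<notin> W \<and> insert f W \<in> indeps N) \<and> X \<in> indeps L \<or>
      insert p X \<in> indeps L \<and> W \<in> indeps N"
  proof -
    have "Elt ` (X \<union> insert f W) \<in> indeps K0 \<longleftrightarrow> X \<in> indeps L \<and> insert f W \<in> indeps N"
      if "f \<in> ground N" for f
      using that X W by (intro K0(3)) auto
    moreover have "Elt ` (insert p X \<union> W) \<in> indeps K0 \<longleftrightarrow> insert p X \<in> indeps L \<and> W \<in> indeps N"
      using p X W by (intro K0(3)) auto
    ultimately show ?thesis by blast
  qed
  finally show "insert New_a (Elt ` (X \<union> W)) \<in> indeps K1 \<longleftrightarrow> insert p X \<in> indeps L \<and> W \<in> indeps N \<or>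
      X \<in> indeps L \<and> W \<in> indeps N \<and> Suc (card W) \<le> r"
    using room[OF W] by blast
qed

lemma K2_indep:
  assumes X: "X \<subseteq> E0" and W: "W \<subseteq> ground N"
  shows "Elt ` (X \<union> W) \<union> flag_set New_a \<alpha> \<union> flag_set New_b \<beta> \<in> indeps K2 \<longleftrightarrow> placed_indep (indeps L) p q N X W \<alpha> \<beta>"
proof -
  have X': "X \<subseteq> ground L" "p \<notin> X" "q \<notin> X" "insert q X \<subseteq> ground L" "p \<notin> insert q X"
    using X q pq by auto
  have le: "card W \<le> r" if "W \<in> indeps N" using card_indep_le_rk[OF N that] .
  have fW: "finite W" using W matroidD(1)[OF N] by (rule finite_subset)
  have qN: "q \<notin> ground N" using q disj by auto
  show ?thesis
  proof (cases \<beta>)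
    case False
    then have "Elt ` (X \<union> W) \<union> flag_set New_a \<alpha> \<union> flag_set New_b \<beta> \<in> indeps K2 \<longleftrightarrow>
        Elt ` (X \<union> W) \<union> flag_set New_a \<alpha> \<in> indeps K1"
      using K2(3)[of "Elt ` (X \<union> W) \<union> flag_set New_a \<alpha>"] by auto
    then show ?thesis
      using K1_indep[OF X'(1,2) W] False le by (cases \<alpha>) (auto simp: placed_indep_def ex_bool_eq)
  next
    case True
    have n: "New_b \<notin> Elt ` (X \<union> W) \<union> flag_set New_a \<alpha>" by auto
    have 1: "f \<notin> X" "insert (Elt f) (Elt ` (X \<union> W) \<union> flag_set New_a \<alpha>) = Elt ` (X \<union> insert f W) \<union> flag_set New_a \<alpha>"
      if "f \<in> ground N" for f
      using X disj that by auto
    have 2: "insert (Elt q) (Elt ` (X \<union> W) \<union> flag_set New_a \<alpha>) = Elt ` (insert q X \<union> W) \<union> flag_set New_a \<alpha>" by auto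
    have "Elt ` (X \<union> W) \<union> flag_set New_a \<alpha> \<union> flag_set New_b \<beta> \<in> indeps K2 \<longleftrightarrow>
      (\<exists>f\<in>ground N \<union> {q}. f \<notin> X \<union> W \<and> insert (Elt f) (Elt ` (X \<union> W) \<union> flag_set New_a \<alpha>) \<in> indeps K1)"
      using K2(4)[OF n] True by auto
    also have "\<dots> \<longleftrightarrow> (\<exists>f\<in>ground N. f \<notin> W \<and> Elt ` (X \<union> insert f W) \<union> flag_set New_a \<alpha> \<in> indeps K1) \<or>
      Elt ` (insert q X \<union> W) \<union> flag_set New_a \<alpha> \<in> indeps K1"
      using 1 2 X' qN W by auto
    also have "\<dots> \<longleftrightarrow> placed_indep (indeps L) p q N X W \<alpha> \<beta>"
    proof (cases \<alpha>)
      case False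
      have "(\<exists>f\<in>ground N. f \<notin> W \<and> Elt ` (X \<union> insert f W) \<in> indeps K1) \<longleftrightarrow>
         X \<in> indeps L \<and> (\<exists>f\<in>ground N. f \<notin> W \<and> insert f W \<in> indeps N)"
      proof -
        have "Elt ` (X \<union> insert f W) \<in> indeps K1 \<longleftrightarrow> X \<in> indeps L \<and> insert f W \<in> indeps N"
          if "f \<in> ground N" for f
          using that W by (intro K1_indep(1)[OF X'(1,2)]) auto
        then show ?thesis by blast
      qed
      then show ?thesis using False True K1_indep(1)[OF X'(4,5) W] le room[OF W]
        by (auto simp: placed_indep_def ex_bool_eq)
    next
      case \<alpha>: True
      \<comment> \<open>Here \<open>b\<close> takes a place \<open>f\<close> in \<open>N\<close>.
        Whether \<open>a\<close> then finds another depends on the rank used so far and not on which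
        \<open>f\<close> was chosen, so the choice of \<open>f\<close> separates from the condition
        on \<open>a\<close>.\<close>
      have "(\<exists>f\<in>ground N. f \<notin> W \<and> insert New_a (Elt ` (X \<union> insert f W)) \<in> indeps K1) \<longleftrightarrow>
         (\<exists>f\<in>ground N. f \<notin> W \<and> insert f W \<in> indeps N \<and>
           (insert p X \<in> indeps L \<or> X \<in> indeps L \<and> Suc (Suc (card W)) \<le> r))"
      proof -
        have "insert New_a (Elt ` (X \<union> insert f W)) \<in> indeps K1 \<longleftrightarrow> insert f W \<in> indeps N \<and>
            (insert p X \<in> indeps L \<or> X \<in> indeps L \<and> Suc (Suc (card W)) \<le> r)"
          if "f \<in> ground N" "f \<notin> W" for f
          using that W fW K1_indep(2)[OF X'(1,2), of "insert f W"] by auto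
        then show ?thesis by blast
      qed
      also have "\<dots> \<longleftrightarrow> W \<in> indeps N \<and> Suc (card W) \<le> r \<and>
          (insert p X \<in> indeps L \<or> X \<in> indeps L \<and> Suc (Suc (card W)) \<le> r)"
        using room[OF W] by blast
      finally show ?thesis using \<alpha> True K1_indep(2)[OF X'(4,5) W] le
        by (auto simp: placed_indep_def ex_bool_eq insert_commute[of p q])
    qed
    finally show ?thesis .
  qed
qed

lemma K2_ground: "ground K2 = Elt ` (ground N \<union> ground L) \<union> {New_a, New_b}"
  by (auto simp: K2(2) K1(2) K0(2))

lemma K3_prems: "Elt ` set xs \<subseteq> ground K2" "New_a \<in> ground K2" "New_a \<notin> range Elt"
    "Copy ` set xs \<inter> ground K2 = {}"
  using AB by (auto simp: K2_ground)

lemmas K3 = fold_free_place[OF K2(1) dist(1) K3_prems, folded K3_def]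

lemma K3_matroid: "is_matroid K3" and K3_ground: "ground K3 = ground K2 \<union> Copy ` set xs"
  using K3 by auto

lemma K4_prems: "Elt ` set ys \<subseteq> ground K3" "New_b \<in> ground K3" "New_b \<notin> range Elt"
    "Copy ` set ys \<inter> ground K3 = {}"
  using AB AB_disj by (auto simp: K2_ground K3_ground)

lemmas K4 = fold_free_place[OF K3_matroid dist(2) K4_prems, folded K4_def]

lemma K4_matroid: "is_matroid K4"
  and K4_ground: "ground K4 = Elt ` (ground N \<union> ground L) \<union> {New_a, New_b} \<union> Copy ` ground N"
  using K4 AB by (auto simp: K3_ground K2_ground)

lemma K3_indep:
  assumes "S \<subseteq> set xs" "Z \<inter> S = {}"
  shows "Elt ` Z \<union> flag_set New_a u \<union> flag_set New_b v \<union> Copy ` S \<in> indeps K3 \<longleftrightarrow>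
    (\<exists>(S', \<alpha>)\<in>resolve S u. Elt ` (Z \<union> S') \<union> flag_set New_a \<alpha> \<union> flag_set New_b v \<in> indeps K2)"
proof -
  let ?J = "Elt ` Z \<union> flag_set New_a u \<union> flag_set New_b v"
  have "?J \<inter> Copy ` set xs = {}" "?J \<inter> Elt ` S = {}" using assms by auto
  then have "?J \<union> Copy ` S \<in> indeps K3 \<longleftrightarrow> ?J \<union> Elt ` S \<in> indeps K2 \<or>
        New_a \<notin> ?J \<and> (\<exists>x\<in>S. insert New_a (?J \<union> Elt ` (S - {x})) \<in> indeps K2)"
    using K3 assms(1) by blast
  moreover have "?J \<union> Elt ` S = Elt ` (Z \<union> S) \<union> flag_set New_a u \<union> flag_set New_b v" by auto
  moreover have "insert New_a (?J \<union> Elt ` (S - {x})) = Elt ` (Z \<union> (S - {x})) \<union> flag_set New_a True \<union> flag_set New_b v"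
    for x by auto
  moreover have "New_a \<notin> ?J \<longleftrightarrow> \<not> u" by auto
  ultimately show ?thesis unfolding bex_resolve by presburger
qed

lemma K4_indep:
  assumes X: "X \<subseteq> E0" and S: "S \<subseteq> set xs" and T: "T \<subseteq> set ys"
  shows "Elt ` X \<union> flag_set New_a u \<union> flag_set New_b v \<union> Copy ` (S \<union> T) \<in> indeps K4 \<longleftrightarrow>
    constr_indep (indeps L) p q N X S T u v"
proof -
  let ?J = "Elt ` X \<union> flag_set New_a u \<union> flag_set New_b v \<union> Copy ` S"
  have XN: "X \<inter> ground N = {}" using X disj by auto
  have "?J \<inter> Copy ` set ys = {}" "?J \<inter> Elt ` T = {}" using S T AB AB_disj XN by auto
  then have F: "?J \<union> Copy ` T \<in> indeps K4 \<longleftrightarrow> ?J \<union> Elt ` T \<in> indeps K3 \<or>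
        New_b \<notin> ?J \<and> (\<exists>x\<in>T. insert New_b (?J \<union> Elt ` (T - {x})) \<in> indeps K3)"
    using K4 T by blast
  have e: "?J \<union> Copy ` T = Elt ` X \<union> flag_set New_a u \<union> flag_set New_b v \<union> Copy ` (S \<union> T)"
    "?J \<union> Elt ` T = Elt ` (X \<union> T) \<union> flag_set New_a u \<union> flag_set New_b v \<union> Copy ` S"
    "\<And>x. insert New_b (?J \<union> Elt ` (T - {x})) =
      Elt ` (X \<union> (T - {x})) \<union> flag_set New_a u \<union> flag_set New_b True \<union> Copy ` S"
    "New_b \<notin> ?J \<longleftrightarrow> \<not> v" by auto
  have "Elt ` X \<union> flag_set New_a u \<union> flag_set New_b v \<union> Copy ` (S \<union> T) \<in> indeps K4 \<longleftrightarrow>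
    (\<exists>(T', \<beta>)\<in>resolve T v. Elt ` (X \<union> T') \<union> flag_set New_a u \<union> flag_set New_b \<beta> \<union> Copy ` S \<in> indeps K3)"
    using F unfolding bex_resolve e .
  also have "\<dots> \<longleftrightarrow> (\<exists>(T', \<beta>)\<in>resolve T v. \<exists>(S', \<alpha>)\<in>resolve S u. placed_indep (indeps L) p q N X (S' \<union> T') \<alpha> \<beta>)"
  proof (rule bex_cong[OF refl], clarify)
    fix T' \<beta> assume "(T', \<beta>) \<in> resolve T v"
    then have T': "T' \<subseteq> T" by (auto simp: resolve_def split: if_splits)
    have "(X \<union> T') \<inter> S = {}" using T' S T XN AB AB_disj by blast
    note K3_indep[OF S this, of u \<beta>]
    also have "(\<exists>(S', \<alpha>)\<in>resolve S u. Elt ` ((X \<union> T') \<union> S') \<union> flag_set New_a \<alpha> \<union> flag_set New_b \<beta> \<in> indeps K2) \<longleftrightarrow>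
      (\<exists>(S', \<alpha>)\<in>resolve S u. placed_indep (indeps L) p q N X (S' \<union> T') \<alpha> \<beta>)"
    proof (rule bex_cong[OF refl], clarify)
      fix S' \<alpha> assume "(S', \<alpha>) \<in> resolve S u"
      then have "S' \<subseteq> S" by (auto simp: resolve_def split: if_splits)
      then have "S' \<union> T' \<subseteq> ground N" using S T T' AB by auto
      moreover have "X \<union> T' \<union> S' = X \<union> (S' \<union> T')" by auto
      ultimately show "Elt ` ((X \<union> T') \<union> S') \<union> flag_set New_a \<alpha> \<union> flag_set New_b \<beta> \<in> indeps K2 \<longleftrightarrow>
         placed_indep (indeps L) p q N X (S' \<union> T') \<alpha> \<beta>"
        using K2_indep[OF X] by metis
    qed
    finally show "Elt ` (X \<union> T') \<union> flag_set New_a u \<union> flag_set New_b \<beta> \<union> Copy ` S \<in> indeps K3 \<longleftrightarrow>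
      (\<exists>(S', \<alpha>)\<in>resolve S u. placed_indep (indeps L) p q N X (S' \<union> T') \<alpha> \<beta>)" .
  qed
  also have "\<dots> \<longleftrightarrow> constr_indep (indeps L) p q N X S T u v"
    unfolding constr_indep_def by fast
  finally show ?thesis .
qed

text \<open>With the originals gone, the elements of \<open>N\<close> survive only as copies, which
  is what makes \<open>uncopy\<close> injective.\<close>

definition "K5 = deletion K4 (Elt ` ground N)"

lemma K5_matroid: "is_matroid K5"
  unfolding K5_def by (rule is_matroid_deletion[OF K4_matroid])

lemma K5_ground: "ground K5 = Elt ` ground L \<union> {New_a, New_b} \<union> Copy ` ground N"
  unfolding K5_def deletion_def using disj K4_ground by auto

lemma inj_uncopy: "inj_on uncopy (ground K5)"
  using disj by (auto simp: K5_ground inj_on_def uncopy_def)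

lemma M_eq: "M = deletion (relabel uncopy K5) {Elt p, Elt q}"
  by (simp add: M_constr_def M2_def M1_eq K5_def AB)

lemma M_matroid: "is_matroid M"
  unfolding M_eq by (intro is_matroid_deletion is_matroid_relabel K5_matroid inj_uncopy)

lemma M_ground: "ground M = Elt ` (E0 \<union> ground N) \<union> {New_a, New_b}"
proof -
  have "ground (relabel uncopy K5) = Elt ` (ground L \<union> ground N) \<union> {New_a, New_b}"
    unfolding relabel_def by (simp add: K5_ground image_Un image_image uncopy_def Un_ac)
  then show ?thesis using p q disj unfolding M_eq by (auto simp: deletion_def)
qed

text \<open>Every later comparison of independent sets goes through this criterion; the elements of
  \<open>N\<close> on the left are the relabelled copies.\<close>

lemma M_indep:
  assumes X: "X \<subseteq> E0" and S: "S \<subseteq> set xs" and T: "T \<subseteq> set ys"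
  shows "Elt ` (X \<union> S \<union> T) \<union> flag_set New_a u \<union> flag_set New_b v \<in> indeps M \<longleftrightarrow>
    constr_indep (indeps L) p q N X S T u v"
proof -
  let ?I = "Elt ` X \<union> flag_set New_a u \<union> flag_set New_b v \<union> Copy ` (S \<union> T)"
  let ?J = "Elt ` (X \<union> S \<union> T) \<union> flag_set New_a u \<union> flag_set New_b v"
  have I: "?I \<subseteq> ground K5" using X S T AB by (auto simp: K5_ground)
  have "uncopy ` flag_set New_a u = flag_set New_a u" "uncopy ` flag_set New_b v = flag_set New_b v"
    by (auto simp: flag_set_def uncopy_def)
  then have u: "uncopy ` ?I = ?J"
    by (simp add: image_Un image_image Un_ac) (auto simp: uncopy_def)
  have "?J \<subseteq> ground M" using X S T AB by (auto simp: M_ground)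
  then have "?J \<in> indeps M \<longleftrightarrow> ?J \<in> indeps (relabel uncopy K5)"
    unfolding M_eq by (auto simp: deletion_def)
  also have "\<dots> \<longleftrightarrow> ?I \<in> indeps K5" using relabel_indeps[OF K5_matroid inj_uncopy I] u by simp
  also have "\<dots> \<longleftrightarrow> ?I \<in> indeps K4" using I unfolding K5_def by (auto simp: deletion_def)
  finally show ?thesis using K4_indep[OF X S T] by simp
qed

lemma M_set_cases:
  assumes "J \<subseteq> ground M"
  obtains X S T u v where "X \<subseteq> E0" "S \<subseteq> set xs" "T \<subseteq> set ys"
    "J = Elt ` (X \<union> S \<union> T) \<union> flag_set New_a u \<union> flag_set New_b v"
proof -
  have "J = Elt ` ({x \<in> E0. Elt x \<in> J} \<union> {x \<in> set xs. Elt x \<in> J} \<union> {x \<in> set ys. Elt x \<in> J}) \<union>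
    flag_set New_a (New_a \<in> J) \<union> flag_set New_b (New_b \<in> J)"
    (is "J = ?R")
  proof
    show "J \<subseteq> ?R"
    proof
      fix z assume z: "z \<in> J"
      then have "z \<in> Elt ` (E0 \<union> (set xs \<union> set ys)) \<union> {New_a, New_b}"
        using assms AB by (auto simp: M_ground)
      then show "z \<in> ?R" using z by (auto simp del: image_Un)
    qed
  qed (auto split: if_splits)
  then show thesis by (rule that[rotated 3]) auto
qed

end

section \<open>Independent families of vectors\<close>

context vector_space
begin

text \<open>Independence of a family rather than of a set of vectors: injectivity makes two elements
  with the same vector dependent, as the definition of \<open>representable\<close> demands.\<close>

definition lin_indep :: "('x \<Rightarrow> 'b) \<Rightarrow> 'x set \<Rightarrow> bool" where
  "lin_indep v I \<longleftrightarrow> inj_on v I \<and> independent (v ` I)"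

lemma lin_indep_coeff:
  assumes I: "finite I"
  shows "lin_indep v I \<longleftrightarrow> (\<forall>c. (\<Sum>x\<in>I. c x *s v x) = 0 \<longrightarrow> (\<forall>x\<in>I. c x = 0))"
proof
  assume f: "lin_indep v I"
  show "\<forall>c. (\<Sum>x\<in>I. c x *s v x) = 0 \<longrightarrow> (\<forall>x\<in>I. c x = 0)"
  proof (intro allI impI ballI)
    fix c x assume c: "(\<Sum>x\<in>I. c x *s v x) = 0" and x: "x \<in> I"
    have inj: "inj_on v I" using f by (simp add: lin_indep_def)
    have "(\<Sum>w\<in>v ` I. c (inv_into I v w) *s w) = (\<Sum>x\<in>I. c x *s v x)"
      using inj by (simp add: sum.reindex)
    then have "c (inv_into I v (v x)) = 0"
      using independentD[of "v ` I" "v ` I" "\<lambda>w. c (inv_into I v w)" "v x"] f I x c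
      by (simp add: lin_indep_def)
    then show "c x = 0" using inj x by simp
  qed
next
  assume c: "\<forall>c. (\<Sum>x\<in>I. c x *s v x) = 0 \<longrightarrow> (\<forall>x\<in>I. c x = 0)"
  have inj: "inj_on v I"
  proof (rule inj_onI, rule ccontr)
    fix x y assume xy: "x \<in> I" "y \<in> I" "v x = v y" "x \<noteq> y"
    let ?c = "\<lambda>z. if z = x then 1 else if z = y then - 1 else 0 :: 'a"
    have "(\<Sum>z\<in>I. ?c z *s v z) = (\<Sum>z\<in>{x, y}. ?c z *s v z)"
      using xy I by (intro sum.mono_neutral_right) auto
    also have "\<dots> = 0" using xy by simp
    finally have "(\<Sum>z\<in>I. ?c z *s v z) = 0" .
    then have "?c x = 0" by (rule c[rule_format, of ?c, OF _ xy(1)])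
    then show False by simp
  qed
  moreover have "independent (v ` I)"
  proof
    assume "dependent (v ` I)"
    then obtain u where u: "\<exists>w\<in>v ` I. u w \<noteq> 0" "(\<Sum>w\<in>v ` I. u w *s w) = 0"
      using dependent_finite I by auto
    have "(\<Sum>x\<in>I. u (v x) *s v x) = 0" using u(2) inj by (simp add: sum.reindex)
    then have "\<forall>x\<in>I. u (v x) = 0" using c by auto
    then show False using u(1) by auto
  qed
  ultimately show "lin_indep v I" by (simp add: lin_indep_def)
qed

lemma lin_indep_cong: "(\<And>x. x \<in> I \<Longrightarrow> v x = w x) \<Longrightarrow> lin_indep v I \<longleftrightarrow> lin_indep w I"
  unfolding lin_indep_def by (simp cong: inj_on_cong image_cong)

lemma lin_indep_insert: "x \<notin> I \<Longrightarrow> lin_indep v (insert x I) \<longleftrightarrow> lin_indep v I \<and> v x \<notin> span (v ` I)"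
  unfolding lin_indep_def by (auto simp: independent_insert span_base)

lemma lin_indep_subset: "lin_indep v J \<Longrightarrow> I \<subseteq> J \<Longrightarrow> lin_indep v I"
  unfolding lin_indep_def by (meson image_mono independent_mono inj_on_subset)

lemma lin_indep_image: "inj_on f I \<Longrightarrow> lin_indep v (f ` I) \<longleftrightarrow> lin_indep (\<lambda>x. v (f x)) I"
  unfolding lin_indep_def using comp_inj_on_iff[of f I v] by (simp add: image_image comp_def)

lemma independent_Un_disjoint:
  assumes P: "independent P" and Q: "independent Q" and PQ: "span P \<inter> span Q \<subseteq> {0}"
  shows "independent (P \<union> Q)"
proof -
  have *: False if h: "a \<in> P" "a \<in> span (P \<union> Q - {a})" "independent P" "span P \<inter> span Q \<subseteq> {0}" for P Q a
  proof -
    have "span (P \<union> Q - {a}) \<subseteq> span ((P - {a}) \<union> Q)" by (rule span_mono) auto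
    then obtain x y where xy: "a = x + y" "x \<in> span (P - {a})" "y \<in> span Q"
      using h(2) span_Un by blast
    have "x \<in> span P" using xy(2) span_mono[of "P - {a}" P] by auto
    then have "a - x \<in> span P" using span_base[OF h(1)] by (rule span_diff[rotated])
    then have "y = 0" using h(4) xy by auto
    then show False using xy h(1,3) unfolding dependent_def by auto
  qed
  show ?thesis
  proof
    assume "dependent (P \<union> Q)"
    then obtain a where a: "a \<in> P \<union> Q" "a \<in> span (P \<union> Q - {a})" unfolding dependent_def by blast
    then consider "a \<in> P" | "a \<in> Q" by auto
    then show False
    proof cases
      case 1 then show False using *[OF 1 a(2) P PQ] by simp
    next
      case 2 then show False using *[OF 2 _ Q, of P] a(2) PQ by (simp add: Un_commute Int_commute)
    qed
  qed
qed

lemma span_Int_independent_Un: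
  assumes fin: "finite P" "finite Q" and PQ: "independent (P \<union> Q)" "P \<inter> Q = {}"
  shows "span P \<inter> span Q \<subseteq> {0}"
proof
  fix w assume "w \<in> span P \<inter> span Q"
  then have "w \<in> span P" "w \<in> span Q" by auto
  then obtain f g where f: "w = (\<Sum>x\<in>P. f x *s x)" and g: "w = (\<Sum>x\<in>Q. g x *s x)"
    unfolding span_finite[OF fin(1)] span_finite[OF fin(2)] by blast
  let ?c = "\<lambda>x. if x \<in> P then f x else - g x"
  have "(\<Sum>x\<in>P \<union> Q. ?c x *s x) = (\<Sum>x\<in>P. ?c x *s x) + (\<Sum>x\<in>Q. ?c x *s x)"
    using fin PQ(2) by (rule sum.union_disjoint)
  also have "(\<Sum>x\<in>P. ?c x *s x) = w" unfolding f by (rule sum.cong) auto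
  also have "(\<Sum>x\<in>Q. ?c x *s x) = - w"
    unfolding g sum_negf[symmetric] using PQ(2) by (intro sum.cong) auto
  finally have z: "(\<Sum>x\<in>P \<union> Q. ?c x *s x) = 0" by simp
  have "?c x = 0" if "x \<in> P" for x
    using independentD[OF PQ(1) _ subset_refl z, of x] fin that by blast
  then show "w \<in> {0}" unfolding f by (auto intro!: sum.neutral)
qed

text \<open>Lets a dependence between two independent families be read as a nonzero vector common to
  their spans; such vectors will later serve as \<open>p\<close> and \<open>q\<close>.\<close>

lemma lin_indep_Un:
  assumes fin: "finite P" "finite Q" and disj: "P \<inter> Q = {}"
  shows "lin_indep v (P \<union> Q) \<longleftrightarrow> lin_indep v P \<and> lin_indep v Q \<and> span (v ` P) \<inter> span (v ` Q) \<subseteq> {0}"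
proof
  assume f: "lin_indep v (P \<union> Q)"
  then have "v ` P \<inter> v ` Q = {}" using disj unfolding lin_indep_def inj_on_def by blast
  then show "lin_indep v P \<and> lin_indep v Q \<and> span (v ` P) \<inter> span (v ` Q) \<subseteq> {0}"
    using f lin_indep_subset[OF f] span_Int_independent_Un[of "v ` P" "v ` Q"] fin
    by (auto simp: lin_indep_def image_Un)
next
  assume f: "lin_indep v P \<and> lin_indep v Q \<and> span (v ` P) \<inter> span (v ` Q) \<subseteq> {0}"
  have "v ` P \<inter> v ` Q \<subseteq> {0}" using f span_superset by blast
  moreover have "0 \<notin> v ` P" using f dependent_zero[of "v ` P"] by (auto simp: lin_indep_def)
  ultimately have dis: "v ` P \<inter> v ` Q = {}"
    by (metis Int_iff insert_not_empty insertI1 subset_singletonD)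
  have "inj_on v (P \<union> Q)"
    unfolding inj_on_Un using f dis by (auto simp: lin_indep_def)
  moreover have "independent (v ` (P \<union> Q))"
    unfolding image_Un using f by (intro independent_Un_disjoint) (auto simp: lin_indep_def)
  ultimately show "lin_indep v (P \<union> Q)" by (simp add: lin_indep_def)
qed

text \<open>Supplies generic vectors; this is where the field has to be infinite. Suppose
  \<open>w\<close> avoids the subspaces treated so far but lies in the new one \<open>U\<close>, and
  take \<open>f\<close> in \<open>F\<close> outside \<open>U\<close>. The line of all
  \<open>f + t *s w\<close> misses \<open>U\<close> entirely and meets each earlier subspace for at
  most one \<open>t\<close>, so almost every point of it will do.\<close>

lemma span_avoid_subspaces:
  assumes inf: "infinite (UNIV :: 'a set)"
    and "finite \<U>" and "\<And>U. U \<in> \<U> \<Longrightarrow> subspace U \<and> \<not> F \<subseteq> U"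
  shows "\<exists>w\<in>span F. \<forall>U\<in>\<U>. w \<notin> U"
  using assms(2,3)
proof (induction \<U>)
  case empty
  then show ?case using span_zero by blast
next
  case (insert U \<U>)
  then obtain w where w: "w \<in> span F" "\<forall>U\<in>\<U>. w \<notin> U" by auto
  have U: "subspace U" using insert.prems by auto
  show ?case
  proof (cases "w \<in> U")
    case False
    then show ?thesis using w by blast
  next
    case True
    obtain f where f: "f \<in> F" "f \<notin> U" using insert.prems by blast
    have fin: "finite {t. f + t *s w \<in> V}" if V: "V \<in> \<U>" for V
    proof -
      have "t = s" if ts: "f + t *s w \<in> V" "f + s *s w \<in> V" for t s
      proof (rule ccontr)
        assume "t \<noteq> s"
        have sV: "subspace V" using V insert.prems by auto
        have "(f + t *s w) - (f + s *s w) \<in> V" using subspace_diff[OF sV ts] .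
        moreover have "(f + t *s w) - (f + s *s w) = (t - s) *s w"
          by (simp add: scale_left_diff_distrib)
        ultimately have "(t - s) *s w \<in> V" by simp
        then have "inverse (t - s) *s ((t - s) *s w) \<in> V" by (rule subspace_scale[OF sV])
        then show False using w V \<open>t \<noteq> s\<close> by simp
      qed
      then have "{t. f + t *s w \<in> V} \<subseteq> {SOME t. f + t *s w \<in> V}"
        by (auto intro: someI2)
      then show ?thesis by (rule finite_subset) simp
    qed
    then have "finite (\<Union>V\<in>\<U>. {t. f + t *s w \<in> V})" using insert.hyps by auto
    then obtain t where t: "t \<notin> (\<Union>V\<in>\<U>. {t. f + t *s w \<in> V})"
      using ex_new_if_finite[OF inf] by blast
    have "f + t *s w \<in> span F" using f w by (intro span_add span_scale) (auto intro: span_base)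
    moreover have "f + t *s w \<notin> U"
    proof
      assume "f + t *s w \<in> U"
      then have "(f + t *s w) - t *s w \<in> U" using subspace_diff subspace_scale U True by blast
      then show False using f by simp
    qed
    ultimately show ?thesis using t by (intro bexI[of _ "f + t *s w"]) auto
  qed
qed

end

section \<open>Representations\<close>

definition vscale :: "'f::field \<Rightarrow> (nat \<Rightarrow> 'f) \<Rightarrow> nat \<Rightarrow> 'f" where
  "vscale c w = (\<lambda>i. c * w i)"

interpretation vf: vector_space vscale
  by unfold_locales (auto simp: vscale_def fun_eq_iff algebra_simps)

lemma vscale_apply [simp]: "vscale c w i = c * w i"
  by (simp add: vscale_def)

lemma sum_fun_apply [simp]: "(\<Sum>x\<in>I. f x) i = (\<Sum>x\<in>I. f x i)" for f :: "'x \<Rightarrow> nat \<Rightarrow> 'f::field"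
  by (induction I rule: infinite_finite_induct) auto

text \<open>
  Vectors of all dimensions share the type \<open>nat \<Rightarrow> 'f\<close>; the dimension \<open>n\<close> appears as a bound on the
  support.
\<close>

definition supp :: "nat \<Rightarrow> ('x \<Rightarrow> nat \<Rightarrow> 'f::field) \<Rightarrow> bool" where
  "supp n v \<longleftrightarrow> (\<forall>x. \<forall>i\<ge>n. v x i = 0)"

definition represents :: "nat \<Rightarrow> ('x \<Rightarrow> nat \<Rightarrow> 'f::field) \<Rightarrow> 'x matroid \<Rightarrow> bool" where
  "represents n v M \<longleftrightarrow> supp n v \<and> (\<forall>I\<subseteq>ground M. I \<in> indeps M \<longleftrightarrow> vf.lin_indep v I)"

lemma lin_indep_coords:
  assumes "supp n v" "finite I"
  shows "vf.lin_indep v I \<longleftrightarrow> (\<forall>c. (\<forall>i<n. (\<Sum>x\<in>I. c x * v x i) = 0) \<longrightarrow> (\<forall>x\<in>I. c x = 0))"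
proof -
  have "(\<Sum>x\<in>I. vscale (c x) (v x)) = 0 \<longleftrightarrow> (\<forall>i<n. (\<Sum>x\<in>I. c x * v x i) = 0)" for c
  proof
    assume "\<forall>i<n. (\<Sum>x\<in>I. c x * v x i) = 0"
    moreover have "(\<Sum>x\<in>I. c x * v x i) = 0" if "i \<ge> n" for i
      using assms(1) that by (simp add: supp_def)
    ultimately show "(\<Sum>x\<in>I. vscale (c x) (v x)) = 0"
      by (auto simp: fun_eq_iff) (meson not_le)
  qed (auto simp: fun_eq_iff)
  then show ?thesis unfolding vf.lin_indep_coeff[OF assms(2)] by presburger
qed

lemma representable_iff:
  shows "representable TYPE('f::field) M \<longleftrightarrow> is_matroid M \<and> (\<exists>n (v :: 'x \<Rightarrow> nat \<Rightarrow> 'f). represents n v M)"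
proof (cases "is_matroid M")
  case M: True
  have fin: "finite I" if "I \<subseteq> ground M" for I using that matroidD(1)[OF M] by (rule finite_subset)
  show ?thesis
  proof
    assume "representable TYPE('f) M"
    then obtain n and D :: "nat \<Rightarrow> 'x \<Rightarrow> 'f" where D: "\<forall>I\<subseteq>ground M. I \<in> indeps M \<longleftrightarrow>
        (\<forall>c. (\<forall>i<n. (\<Sum>x\<in>I. c x * D i x) = 0) \<longrightarrow> (\<forall>x\<in>I. c x = 0))"
      unfolding representable_def by blast
    define v where "v x i = (if i < n then D i x else 0)" for x i
    have s: "supp n v" by (simp add: supp_def v_def)
    have "represents n v M" unfolding represents_def
    proof (intro conjI allI impI s)
      fix I assume I: "I \<subseteq> ground M"
      show "I \<in> indeps M \<longleftrightarrow> vf.lin_indep v I"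
        unfolding lin_indep_coords[OF s fin[OF I]] using D I by (simp add: v_def)
    qed
    then show "is_matroid M \<and> (\<exists>n (v :: 'x \<Rightarrow> nat \<Rightarrow> 'f). represents n v M)" using M by blast
  next
    assume "is_matroid M \<and> (\<exists>n (v :: 'x \<Rightarrow> nat \<Rightarrow> 'f). represents n v M)"
    then obtain n and v :: "'x \<Rightarrow> nat \<Rightarrow> 'f" where v: "supp n v"
      "\<And>I. I \<subseteq> ground M \<Longrightarrow> I \<in> indeps M \<longleftrightarrow> vf.lin_indep v I" by (auto simp: represents_def)
    show "representable TYPE('f) M"
      unfolding representable_def
    proof (intro conjI M exI[of _ n] exI[of _ "\<lambda>i x. v x i"] allI impI)
      fix I assume I: "I \<subseteq> ground M"
      show "I \<in> indeps M \<longleftrightarrow> (\<forall>c. (\<forall>i<n. (\<Sum>x\<in>I. c x * v x i) = 0) \<longrightarrow> (\<forall>x\<in>I. c x = 0))"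
        unfolding v(2)[OF I] by (rule lin_indep_coords[OF v(1) fin[OF I]])
    qed
  qed
qed (simp add: representable_def)

lemma representableI:
  fixes v :: "'x \<Rightarrow> nat \<Rightarrow> 'f::field"
  shows "is_matroid M \<Longrightarrow> represents n v M \<Longrightarrow> representable TYPE('f) M"
  using representable_iff by blast

lemma representableE:
  assumes "representable TYPE('f::field) M"
  obtains n and v :: "'x \<Rightarrow> nat \<Rightarrow> 'f::field" where "is_matroid M" "supp n v"
    "\<And>I. I \<subseteq> ground M \<Longrightarrow> I \<in> indeps M \<longleftrightarrow> vf.lin_indep v I"
  using assms unfolding representable_iff represents_def by blast

lemma representable_matroid: "representable F M \<Longrightarrow> is_matroid M"
  by (simp add: representable_def)

section \<open>Representability under the matroid operations\<close>

lemma supp_span: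
  fixes v :: "'x \<Rightarrow> nat \<Rightarrow> 'f::field"
  assumes "supp n v" "w \<in> vf.span (v ` I)" "i \<ge> n"
  shows "w i = 0"
proof -
  have "vf.subspace {w :: nat \<Rightarrow> 'f. \<forall>i\<ge>n. w i = 0}" by (auto simp: vf.subspace_def)
  then have "vf.span (v ` I) \<subseteq> {w. \<forall>i\<ge>n. w i = 0}"
    using assms(1) by (intro vf.span_minimal) (auto simp: supp_def)
  then show ?thesis using assms by auto
qed

lemma representable_deletion:
  assumes "representable TYPE('f::field) M"
  shows "representable TYPE('f) (deletion M X)"
  using assms
proof (rule representableE)
  fix n and v :: "'a \<Rightarrow> nat \<Rightarrow> 'f"
  assume M: "is_matroid M" and v: "supp n v" "\<And>I. I \<subseteq> ground M \<Longrightarrow> I \<in> indeps M \<longleftrightarrow> vf.lin_indep v I"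
  have "represents n v (deletion M X)" unfolding represents_def
  proof (intro conjI allI impI v(1))
    fix I assume "I \<subseteq> ground (deletion M X)"
    then show "I \<in> indeps (deletion M X) \<longleftrightarrow> vf.lin_indep v I" using v(2)[of I] by (auto simp: deletion_def)
  qed
  then show ?thesis by (rule representableI[OF is_matroid_deletion[OF M]])
qed

lemma representable_relabel:
  assumes M: "representable TYPE('f::field) M" and f: "inj_on f (ground M)"
  shows "representable TYPE('f) (relabel f M)"
  using M
proof (rule representableE)
  fix n and v :: "'a \<Rightarrow> nat \<Rightarrow> 'f"
  assume m: "is_matroid M" and v: "supp n v" "\<And>I. I \<subseteq> ground M \<Longrightarrow> I \<in> indeps M \<longleftrightarrow> vf.lin_indep v I"
  have "represents n (\<lambda>y. v (inv_into (ground M) f y)) (relabel f M)"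
    unfolding represents_def
  proof (intro conjI allI impI)
    fix J assume "J \<subseteq> ground (relabel f M)"
    then obtain I where I: "I \<subseteq> ground M" "J = f ` I" by (auto simp: relabel_def subset_image_iff)
    have "vf.lin_indep (\<lambda>y. v (inv_into (ground M) f y)) (f ` I) \<longleftrightarrow> vf.lin_indep (\<lambda>x. v (inv_into (ground M) f (f x))) I"
      using f I(1) by (intro vf.lin_indep_image) (rule inj_on_subset)
    also have "\<dots> \<longleftrightarrow> vf.lin_indep v I" using f I by (intro vf.lin_indep_cong) auto
    finally show "J \<in> indeps (relabel f M) \<longleftrightarrow> vf.lin_indep (\<lambda>y. v (inv_into (ground M) f y)) J"
      using relabel_indeps[OF m f I(1)] v(2)[OF I(1)] I(2) by simp
  qed (use v(1) in \<open>simp add: supp_def\<close>)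
  then show ?thesis by (rule representableI[OF is_matroid_relabel[OF m f]])
qed

lemma representable_direct_sum:
  assumes M: "representable TYPE('f::field) M" and N: "representable TYPE('f) N"
    and disj: "ground M \<inter> ground N = {}"
  shows "representable TYPE('f) (direct_sum M N)"
  using M
proof (rule representableE)
  fix m and v :: "'a \<Rightarrow> nat \<Rightarrow> 'f"
  assume M: "is_matroid M" and v: "supp m v" "\<And>I. I \<subseteq> ground M \<Longrightarrow> I \<in> indeps M \<longleftrightarrow> vf.lin_indep v I"
  show ?thesis using N
  proof (rule representableE)
    fix n and w :: "'a \<Rightarrow> nat \<Rightarrow> 'f"
    assume N: "is_matroid N" and w: "supp n w" "\<And>I. I \<subseteq> ground N \<Longrightarrow> I \<in> indeps N \<longleftrightarrow> vf.lin_indep w I"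
    \<comment> \<open>Block form: the vectors for \<open>N\<close> are shifted past the first
      \<open>m\<close> coordinates, which belong to \<open>M\<close>.\<close>
    define u where "u x = (if x \<in> ground M then v x else (\<lambda>i. if i < m then 0 else w x (i - m)))" for x
    have s: "supp (m + n) u" using v(1) w(1) by (auto simp: supp_def u_def)
    have "I \<in> indeps (direct_sum M N) \<longleftrightarrow> vf.lin_indep u I" if I: "I \<subseteq> ground (direct_sum M N)" for I
    proof -
      let ?P = "I \<inter> ground M" and ?Q = "I \<inter> ground N"
      have fin: "finite ?P" "finite ?Q" using matroidD(1)[OF M] matroidD(1)[OF N] by auto
      have fI: "finite I" by (rule finite_subset[OF I]) (use matroidD(1)[OF M] matroidD(1)[OF N] in \<open>simp add: direct_sum_def\<close>)
      have dPQ: "?P \<inter> ?Q = {}" using disj by auto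
      have IPQ: "I = ?P \<union> ?Q" using I by (auto simp: direct_sum_def)
      have uQ: "u x = (\<lambda>i. if i < m then 0 else w x (i - m))" if "x \<in> ?Q" for x
        using that disj by (auto simp: u_def)
      have sum: "(\<Sum>x\<in>I. c x * u x i) = (if i < m then \<Sum>x\<in>?P. c x * v x i else \<Sum>x\<in>?Q. c x * w x (i - m))"
        for c i
      proof -
        have "(\<Sum>x\<in>I. c x * u x i) = (\<Sum>x\<in>?P. c x * u x i) + (\<Sum>x\<in>?Q. c x * u x i)"
          using sum.union_disjoint[OF fin dPQ, of "\<lambda>x. c x * u x i"] IPQ[symmetric] by simp
        moreover have "(\<Sum>x\<in>?P. c x * u x i) = (if i < m then \<Sum>x\<in>?P. c x * v x i else 0)"
          using v(1) by (auto simp: u_def supp_def)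
        moreover have "(\<Sum>x\<in>?Q. c x * u x i) = (if i < m then 0 else \<Sum>x\<in>?Q. c x * w x (i - m))"
          using uQ by auto
        ultimately show ?thesis by simp
      qed
      have zero: "(\<forall>i<m + n. (\<Sum>x\<in>I. c x * u x i) = 0) \<longleftrightarrow>
        (\<forall>i<m. (\<Sum>x\<in>?P. c x * v x i) = 0) \<and> (\<forall>i<n. (\<Sum>x\<in>?Q. c x * w x i) = 0)" for c
      proof (intro iffI conjI allI impI)
        fix i
        assume *: "\<forall>i<m + n. (\<Sum>x\<in>I. c x * u x i) = 0"
        { assume "i < m"
          then show "(\<Sum>x\<in>?P. c x * v x i) = 0" using *[rule_format, of i] by (simp add: sum) }
        { assume "i < n"
          then show "(\<Sum>x\<in>?Q. c x * w x i) = 0" using *[rule_format, of "m + i"] by (simp add: sum) }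
      next
        fix i
        assume *: "(\<forall>i<m. (\<Sum>x\<in>?P. c x * v x i) = 0) \<and> (\<forall>i<n. (\<Sum>x\<in>?Q. c x * w x i) = 0)" "i < m + n"
        then have "i < m \<or> i - m < n" by auto
        then show "(\<Sum>x\<in>I. c x * u x i) = 0" using * by (auto simp: sum)
      qed
      have "vf.lin_indep u I \<longleftrightarrow> vf.lin_indep v ?P \<and> vf.lin_indep w ?Q"
      proof
        assume f: "vf.lin_indep u I"
        have c: "\<forall>x\<in>I. c x = 0" if "(\<forall>i<m. (\<Sum>x\<in>?P. c x * v x i) = 0)" "(\<forall>i<n. (\<Sum>x\<in>?Q. c x * w x i) = 0)" for c
          using f that zero[of c] unfolding lin_indep_coords[OF s fI] by blast
        have "vf.lin_indep v ?P" unfolding lin_indep_coords[OF v(1) fin(1)]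
        proof (intro allI impI)
          fix c assume *: "\<forall>i<m. (\<Sum>x\<in>?P. c x * v x i) = 0"
          let ?c = "\<lambda>x. if x \<in> ground M then c x else 0"
          have "(\<Sum>x\<in>?P. ?c x * v x i) = (\<Sum>x\<in>?P. c x * v x i)" for i by (rule sum.cong) auto
          moreover have "(\<Sum>x\<in>?Q. ?c x * w x i) = 0" for i using disj by (intro sum.neutral) auto
          ultimately have "\<forall>x\<in>I. ?c x = 0" using * by (intro c) auto
          then show "\<forall>x\<in>?P. c x = 0" by auto
        qed
        moreover have "vf.lin_indep w ?Q" unfolding lin_indep_coords[OF w(1) fin(2)]
        proof (intro allI impI)
          fix c assume *: "\<forall>i<n. (\<Sum>x\<in>?Q. c x * w x i) = 0"
          let ?c = "\<lambda>x. if x \<in> ground N then c x else 0"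
          have "(\<Sum>x\<in>?Q. ?c x * w x i) = (\<Sum>x\<in>?Q. c x * w x i)" for i by (rule sum.cong) auto
          moreover have "(\<Sum>x\<in>?P. ?c x * v x i) = 0" for i using disj by (intro sum.neutral) auto
          ultimately have "\<forall>x\<in>I. ?c x = 0" using * by (intro c) auto
          then show "\<forall>x\<in>?Q. c x = 0" by auto
        qed
        ultimately show "vf.lin_indep v ?P \<and> vf.lin_indep w ?Q" ..
      next
        assume f: "vf.lin_indep v ?P \<and> vf.lin_indep w ?Q"
        show "vf.lin_indep u I" unfolding lin_indep_coords[OF s fI]
        proof (intro allI impI)
          fix c assume "\<forall>i<m + n. (\<Sum>x\<in>I. c x * u x i) = 0"
          then have "\<forall>x\<in>?P. c x = 0" "\<forall>x\<in>?Q. c x = 0"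
            using zero[of c] f lin_indep_coords[OF v(1) fin(1)] lin_indep_coords[OF w(1) fin(2)] by blast+
          then show "\<forall>x\<in>I. c x = 0" using IPQ by blast
        qed
      qed
      then show ?thesis
        using direct_sum_indeps[OF M N disj, of I] v(2)[of ?P] w(2)[of ?Q] I
        by (auto simp: direct_sum_def)
    qed
    then have "represents (m + n) u (direct_sum M N)" using s by (simp add: represents_def)
    then show ?thesis by (rule representableI[OF is_matroid_direct_sum[OF M N disj]])
  qed
qed

text \<open>The new element receives a vector of the span of \<open>Y\<close> that avoids the
  finitely many spans of independent sets not containing all of \<open>Y\<close>. It then lies in
  the span of an independent set exactly when that set spans \<open>Y\<close>, which is
  freeness.\<close>

lemma representable_free_place:
  assumes inf: "infinite (UNIV :: 'f::field set)" and K: "representable TYPE('f) K"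
    and Y: "Y \<subseteq> ground K" and x: "x \<notin> ground K"
  shows "representable TYPE('f) (free_place K (cl K Y) x)"
  using K
proof (rule representableE)
  fix n and v :: "'a \<Rightarrow> nat \<Rightarrow> 'f"
  assume K: "is_matroid K" and v: "supp n v" "\<And>I. I \<subseteq> ground K \<Longrightarrow> I \<in> indeps K \<longleftrightarrow> vf.lin_indep v I"
  note fp = free_place_cl[OF K Y x]
  define \<U> where "\<U> = {vf.span (v ` I) | I. I \<in> indeps K \<and> \<not> v ` Y \<subseteq> vf.span (v ` I)}"
  have "\<U> \<subseteq> (\<lambda>I. vf.span (v ` I)) ` indeps K" by (auto simp: \<U>_def)
  then have "finite \<U>" by (rule finite_subset) (rule finite_imageI[OF matroidD(3)[OF K]])
  moreover have "vf.subspace U \<and> \<not> v ` Y \<subseteq> U" if "U \<in> \<U>" for U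
    using that vf.subspace_span by (auto simp: \<U>_def)
  ultimately have "\<exists>w\<in>vf.span (v ` Y). \<forall>U\<in>\<U>. w \<notin> U"
    by (rule vf.span_avoid_subspaces[OF inf])
  then obtain w where w: "w \<in> vf.span (v ` Y)" "\<forall>U\<in>\<U>. w \<notin> U" by (elim bexE)
  have wI: "w \<notin> vf.span (v ` I) \<longleftrightarrow> \<not> v ` Y \<subseteq> vf.span (v ` I)" if "I \<in> indeps K" for I
  proof
    assume "w \<notin> vf.span (v ` I)"
    then show "\<not> v ` Y \<subseteq> vf.span (v ` I)" using w(1) vf.span_minimal[of "v ` Y" "vf.span (v ` I)"] by auto
  qed (use w(2) that in \<open>auto simp: \<U>_def\<close>)
  let ?v = "v(x := w)"
  have s: "supp n ?v" using v(1) supp_span[OF v(1) w(1)] by (auto simp: supp_def)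
  have "J \<in> indeps (free_place K (cl K Y) x) \<longleftrightarrow> vf.lin_indep ?v J" if J: "J \<subseteq> insert x (ground K)" for J
  proof (cases "x \<in> J")
    case False
    then have "J \<subseteq> ground K" using J by auto
    moreover have "vf.lin_indep ?v J \<longleftrightarrow> vf.lin_indep v J" using False by (intro vf.lin_indep_cong) auto
    ultimately show ?thesis using fp(3)[OF False] v(2) by simp
  next
    case True
    define I where "I = J - {x}"
    have I: "J = insert x I" "x \<notin> I" "I \<subseteq> ground K" using True J by (auto simp: I_def)
    have fI: "vf.lin_indep ?v I \<longleftrightarrow> vf.lin_indep v I" and im: "?v ` I = v ` I"
      using I(2) by (auto intro!: vf.lin_indep_cong)
    have "J \<in> indeps (free_place K (cl K Y) x) \<longleftrightarrow> (\<exists>f\<in>Y. f \<notin> I \<and> insert f I \<in> indeps K)"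
      using fp(4)[OF I(2)] I(1) by simp
    also have "\<dots> \<longleftrightarrow> (\<exists>f\<in>Y. f \<notin> I \<and> vf.lin_indep v I \<and> v f \<notin> vf.span (v ` I))"
    proof -
      have "insert f I \<in> indeps K \<longleftrightarrow> vf.lin_indep v I \<and> v f \<notin> vf.span (v ` I)" if "f \<in> Y" "f \<notin> I" for f
        using that v(2)[of "insert f I"] I(3) Y vf.lin_indep_insert[OF that(2)] by auto
      then show ?thesis by blast
    qed
    also have "\<dots> \<longleftrightarrow> vf.lin_indep v I \<and> \<not> v ` Y \<subseteq> vf.span (v ` I)"
      using vf.span_base[of _ "v ` I"] by auto
    also have "\<dots> \<longleftrightarrow> vf.lin_indep v I \<and> w \<notin> vf.span (v ` I)" using wI v(2)[OF I(3)] by auto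
    also have "\<dots> \<longleftrightarrow> vf.lin_indep ?v J" unfolding I(1) vf.lin_indep_insert[OF I(2)] fI im by simp
    finally show ?thesis .
  qed
  then have "represents n ?v (free_place K (cl K Y) x)" using s fp(2) by (simp add: represents_def)
  then show ?thesis by (rule representableI[OF fp(1)])
qed

lemma representable_fold_free_place:
  fixes c :: "'a elt"
  assumes inf: "infinite (UNIV :: 'f::field set)" and K: "representable TYPE('f) K"
    and "distinct xs" "Elt ` set xs \<subseteq> ground K" "c \<in> ground K" "c \<notin> range Elt"
      "Copy ` set xs \<inter> ground K = {}"
  shows "representable TYPE('f) (fold (\<lambda>x K. free_place K (cl K {Elt x, c}) (Copy x)) xs K)"
  using assms(3-)
proof (induction xs rule: rev_induct)
  case Nil
  then show ?case using K by simp
next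
  case (snoc x xs)
  let ?K = "fold (\<lambda>x K. free_place K (cl K {Elt x, c}) (Copy x)) xs K"
  have "ground ?K = ground K \<union> Copy ` set xs"
    using fold_free_place[OF representable_matroid[OF K], of xs c] snoc.prems by auto
  then have "representable TYPE('f) (free_place ?K (cl ?K {Elt x, c}) (Copy x))"
    using snoc by (intro representable_free_place[OF inf]) auto
  then show ?case by simp
qed

text \<open>One step of Gaussian elimination: pick a coordinate \<open>k\<close> where
  \<open>v e\<close> is nonzero and subtract from every vector the multiple of \<open>v e\<close>
  that clears it. This is projection along \<open>v e\<close>.\<close>

lemma lin_indep_contract_one:
  fixes v :: "'x \<Rightarrow> nat \<Rightarrow> 'f::field"
  assumes v: "supp n v" "vf.lin_indep v {e}"
  shows "\<exists>w :: 'x \<Rightarrow> nat \<Rightarrow> 'f. supp n w \<and>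
    (\<forall>I. finite I \<and> e \<notin> I \<longrightarrow> (vf.lin_indep v (insert e I) \<longleftrightarrow> vf.lin_indep w I))"
proof -
  have "v e \<noteq> 0" using v(2) by (simp add: vf.lin_indep_def)
  then obtain k where k: "v e k \<noteq> 0" by (auto simp: fun_eq_iff)
  define t where "t x = v x k / v e k" for x
  define w where "w x = v x - vscale (t x) (v e)" for x
  have s: "supp n w" using v(1) by (simp add: supp_def w_def)
  have "vf.lin_indep v (insert e I) \<longleftrightarrow> vf.lin_indep w I" if I: "finite I" "e \<notin> I" for I
  proof -
    have w: "(\<Sum>x\<in>I. vscale (c x) (w x)) = (\<Sum>x\<in>I. vscale (c x) (v x)) - vscale (\<Sum>x\<in>I. c x * t x) (v e)" for c
      by (simp add: w_def vf.scale_right_diff_distrib sum_subtractf vf.scale_sum_left)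
    show ?thesis unfolding vf.lin_indep_coeff[OF I(1)] vf.lin_indep_coeff[OF finite.insertI[OF I(1)]]
    proof (intro iffI allI impI)
      fix c assume *: "\<forall>c. (\<Sum>x\<in>insert e I. vscale (c x) (v x)) = 0 \<longrightarrow> (\<forall>x\<in>insert e I. c x = 0)"
        and 0: "(\<Sum>x\<in>I. vscale (c x) (w x)) = 0"
      \<comment> \<open>The coefficient of \<open>e\<close> makes up for the multiples of
        \<open>v e\<close> subtracted in \<open>w\<close>.\<close>
      let ?c = "c(e := - (\<Sum>x\<in>I. c x * t x))"
      have "(\<Sum>x\<in>I. vscale (?c x) (v x)) = (\<Sum>x\<in>I. vscale (c x) (v x))"
        using I by (intro sum.cong) auto
      then have "(\<Sum>x\<in>insert e I. vscale (?c x) (v x)) = 0" using 0 I unfolding w by simp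
      then have "\<forall>x\<in>insert e I. ?c x = 0" using * by blast
      then show "\<forall>x\<in>I. c x = 0" using I by (auto split: if_splits)
    next
      fix c assume *: "\<forall>c. (\<Sum>x\<in>I. vscale (c x) (w x)) = 0 \<longrightarrow> (\<forall>x\<in>I. c x = 0)"
        and "(\<Sum>x\<in>insert e I. vscale (c x) (v x)) = 0"
      then have 0: "vscale (c e) (v e) + (\<Sum>x\<in>I. vscale (c x) (v x)) = 0" using I by simp
      from fun_cong[OF this, of k] have "c e * v e k + (\<Sum>x\<in>I. c x * v x k) = 0" by simp
      moreover have "(\<Sum>x\<in>I. c x * v x k) = (\<Sum>x\<in>I. c x * t x) * v e k"
        using k by (simp add: sum_distrib_right t_def)
      ultimately have "(c e + (\<Sum>x\<in>I. c x * t x)) * v e k = 0" by (simp add: algebra_simps)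
      then have ce: "c e = - (\<Sum>x\<in>I. c x * t x)" using k by (simp add: eq_neg_iff_add_eq_0)
      have "(\<Sum>x\<in>I. vscale (c x) (w x)) = 0" using 0 unfolding w ce by (simp add: algebra_simps)
      then have "\<forall>x\<in>I. c x = 0" using * by blast
      then show "\<forall>x\<in>insert e I. c x = 0" using ce by simp
    qed
  qed
  then show ?thesis using s by blast
qed

lemma lin_indep_contract:
  fixes v :: "'x \<Rightarrow> nat \<Rightarrow> 'f::field"
  assumes "finite B" "supp n v" "vf.lin_indep v B"
  shows "\<exists>w :: 'x \<Rightarrow> nat \<Rightarrow> 'f. supp n w \<and>
    (\<forall>I. finite I \<and> I \<inter> B = {} \<longrightarrow> (vf.lin_indep v (I \<union> B) \<longleftrightarrow> vf.lin_indep w I))"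
  using assms
proof (induction B)
  case empty
  then show ?case by auto
next
  case (insert e B)
  have "vf.lin_indep v B" by (rule vf.lin_indep_subset[OF insert.prems(2)]) auto
  from insert.IH[OF insert.prems(1) this] obtain w :: "'x \<Rightarrow> nat \<Rightarrow> 'f" where w: "supp n w" "\<And>I. finite I \<Longrightarrow> I \<inter> B = {} \<Longrightarrow> vf.lin_indep v (I \<union> B) \<longleftrightarrow> vf.lin_indep w I"
    by blast
  have "vf.lin_indep w {e}" using w(2)[of "{e}"] insert.hyps insert.prems(2) by simp
  from lin_indep_contract_one[OF w(1) this] obtain u :: "'x \<Rightarrow> nat \<Rightarrow> 'f" where u: "supp n u" "\<And>I. finite I \<Longrightarrow> e \<notin> I \<Longrightarrow> vf.lin_indep w (insert e I) \<longleftrightarrow> vf.lin_indep u I"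
    by blast
  have "vf.lin_indep v (I \<union> insert e B) \<longleftrightarrow> vf.lin_indep u I" if "finite I" "I \<inter> insert e B = {}" for I
    using that w(2)[of "insert e I"] u(2)[of I] insert.hyps by auto
  then show ?case using u(1) by blast
qed

text \<open>Here \<open>M\<close> may be non-representable; \<open>v\<close> only has to describe
  the contraction of \<open>B0\<close> away from \<open>Y\<close>. Since \<open>B0\<close> extends
  to a basis of \<open>X\<close>, the rest of that basis is contracted inside the representation.
  The uses below take \<open>B0\<close> empty or a single element.\<close>

lemma representable_minor:
  fixes v :: "'x \<Rightarrow> nat \<Rightarrow> 'f::field"
  assumes M: "is_matroid M" and B0: "B0 \<in> indeps M" "B0 \<subseteq> X" and XY: "X \<subseteq> ground M" "X \<inter> Y = {}"
    and v: "supp n v" "\<And>J. J \<subseteq> ground M - Y - B0 \<Longrightarrow> J \<union> B0 \<in> indeps M \<longleftrightarrow> vf.lin_indep v J"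
  shows "representable TYPE('f) (deletion (contraction M X) Y)"
proof -
  obtain B where B: "basis_of M X B" "B0 \<subseteq> B" using basis_extend[OF M B0] .
  have BI: "B \<in> indeps M" "B \<subseteq> X" using B by (auto simp: basis_of_def)
  define C where "C = B - B0"
  have C: "C \<union> B0 = B" "C \<subseteq> ground M - Y - B0" "finite C"
    using B BI XY matroidD(5)[OF M BI(1)] by (auto simp: C_def)
  have "vf.lin_indep v C" using v(2)[OF C(2)] C(1) BI by simp
  then obtain w :: "'x \<Rightarrow> nat \<Rightarrow> 'f" where w: "supp n w"
    "\<And>I. finite I \<Longrightarrow> I \<inter> C = {} \<Longrightarrow> vf.lin_indep v (I \<union> C) \<longleftrightarrow> vf.lin_indep w I"
    using lin_indep_contract[OF C(3) v(1)] by blast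
  have "I \<in> indeps (deletion (contraction M X) Y) \<longleftrightarrow> vf.lin_indep w I"
    if I: "I \<subseteq> ground (deletion (contraction M X) Y)" for I
  proof -
    have g: "I \<subseteq> ground M - X - Y" using I by (simp add: deletion_def contraction_def)
    then have fI: "finite I" using matroidD(1)[OF M] by (meson Diff_subset finite_subset subset_trans)
    have "I \<in> indeps (deletion (contraction M X) Y) \<longleftrightarrow> I \<union> B \<in> indeps M"
    proof -
      have "ground (contraction M X) = ground M - X" by (simp add: contraction_def)
      then show ?thesis using g by (auto simp: deletion_def contraction_indeps[OF M B(1)])
    qed
    also have "\<dots> \<longleftrightarrow> (I \<union> C) \<union> B0 \<in> indeps M" using C(1) by (simp add: Un_assoc)
    also have "\<dots> \<longleftrightarrow> vf.lin_indep v (I \<union> C)" using g C(2) B0 by (intro v(2)) auto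
    also have "\<dots> \<longleftrightarrow> vf.lin_indep w I" using g BI fI by (intro w(2)) (auto simp: C_def)
    finally show ?thesis .
  qed
  then have "represents n w (deletion (contraction M X) Y)" using w(1) by (simp add: represents_def)
  then show ?thesis by (intro representableI is_matroid_deletion is_matroid_contraction M)
qed

context construction
begin

lemma M_representable:
  assumes inf: "infinite (UNIV :: 'f::field set)"
    and L': "representable TYPE('f) L" and N': "representable TYPE('f) N"
  shows "representable TYPE('f) M"
proof -
  have "representable TYPE('f) K0" unfolding K0_def
    by (intro representable_relabel representable_direct_sum N' L' disj') (simp add: inj_on_def)
  then have "representable TYPE('f) K1" unfolding K1_def
    by (intro representable_free_place[OF inf] K1_place)
  then have "representable TYPE('f) K2" unfolding K2_def
    by (intro representable_free_place[OF inf] K2_place)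
  then have "representable TYPE('f) K3" unfolding K3_def
    by (intro representable_fold_free_place[OF inf] dist K3_prems)
  then have "representable TYPE('f) K4" unfolding K4_def
    by (intro representable_fold_free_place[OF inf] dist K4_prems)
  then show ?thesis unfolding M_eq
    by (intro representable_deletion representable_relabel inj_uncopy) (simp add: K5_def representable_deletion)
qed

end

section \<open>Recovering \<open>L\<close> from a representation of the construction\<close>

context vector_space
begin

text \<open>\<open>Q0\<close> and \<open>R\<close> span subspaces with trivial intersection, so
  \<open>Q0 \<union> R\<close> is an independent subset of the span of \<open>Q\<close> and has at
  most card Q elements.\<close>

lemma card_independent_Int_le:
  assumes Q: "finite Q" "independent Q0" "Q0 \<subseteq> Q" and U: "subspace U" "span Q0 \<inter> U \<subseteq> {0}"
    and R: "independent R" "R \<subseteq> span Q \<inter> U"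
  shows "card R \<le> card (Q - Q0)"
proof -
  have "span R \<subseteq> U" using R(2) U(1) by (intro span_minimal) auto
  then have I: "independent (Q0 \<union> R)" using U(2) by (intro independent_Un_disjoint Q R) auto
  have "Q0 \<union> R \<subseteq> span Q" using Q(3) R(2) span_superset by blast
  then have fin: "finite (Q0 \<union> R)" "card (Q0 \<union> R) \<le> card Q"
    using independent_span_bound[OF Q(1) I] by auto
  have "Q0 \<inter> R \<subseteq> {0}" using U(2) R(2) span_superset by blast
  moreover have "0 \<notin> R" using dependent_zero R(1) by blast
  ultimately have "Q0 \<inter> R = {}" by auto
  then have "card (Q0 \<union> R) = card Q0 + card R" using fin by (intro card_Un_disjoint) auto
  moreover have "card (Q - Q0) = card Q - card Q0" using Q fin by (intro card_Diff_subset) auto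
  moreover have "card Q0 \<le> card Q" using Q by (intro card_mono)
  ultimately show ?thesis using fin by simp
qed

text \<open>Discarding \<open>D\<close> from \<open>C\<close> destroys the intersection of the
  spans, so its dimension was at most card D. With \<open>D\<close> consisting of \<open>a\<close>,
  of \<open>b\<close> or of both, the common part is a point or a line in projective terms.\<close>

lemma lin_indep_Int_card_le:
  assumes fin: "finite P" "finite C" and disj: "P \<inter> C = {}" and D: "D \<subseteq> C"
    and f: "lin_indep v (P \<union> (C - D))"
    and R: "independent R" "R \<subseteq> span (v ` P) \<inter> span (v ` C)"
  shows "card R \<le> card D"
proof -
  have "P \<inter> (C - D) = {}" using disj by blast
  then have *: "lin_indep v (C - D)" "span (v ` P) \<inter> span (v ` (C - D)) \<subseteq> {0}"
    using lin_indep_Un[OF fin(1), of "C - D" v] fin f by auto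
  have "card R \<le> card (v ` C - v ` (C - D))"
    using fin R * by (intro card_independent_Int_le[where U = "span (v ` P)"]) (auto simp: lin_indep_def)
  also have "\<dots> \<le> card (v ` D)" using fin D by (intro card_mono finite_imageI) (auto intro: finite_subset)
  also have "\<dots> \<le> card D" using fin D by (intro card_image_le) (auto intro: finite_subset)
  finally show ?thesis .
qed

text \<open>The common part of the two spans has dimension at most one because
  \<open>P \<union> (C - {c})\<close> is independent, and at least one because
  \<open>P \<union> C\<close> is not. If \<open>X\<close> in the span of \<open>P\<close> is
  dependent with \<open>C\<close>, it shares with \<open>C\<close> a nonzero vector, necessarily a
  multiple of \<open>w\<close>. To such \<open>X\<close> the whole set \<open>C\<close> therefore
  looks like the single vector \<open>w\<close>.\<close>

lemma exists_common_point:
  assumes fin: "finite P" "finite C" and disj: "P \<inter> C = {}" and c: "c \<in> C"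
    and f: "lin_indep v P" "lin_indep v C" "lin_indep v (P \<union> (C - {c}))" "\<not> lin_indep v (P \<union> C)"
  obtains w where "w \<in> span (v ` P)" "w \<in> span (v ` C)"
    "\<And>X. finite X \<Longrightarrow> X \<inter> C = {} \<Longrightarrow> lin_indep v X \<Longrightarrow> v ` X \<subseteq> span (v ` P) \<Longrightarrow>
       w \<in> span (v ` X) \<longleftrightarrow> \<not> lin_indep v (X \<union> C)"
proof -
  have "\<not> span (v ` P) \<inter> span (v ` C) \<subseteq> {0}" using lin_indep_Un[OF fin disj] f by blast
  then obtain w where w: "w \<in> span (v ` P)" "w \<in> span (v ` C)" "w \<noteq> 0" by blast
  have "w \<in> span (v ` X) \<longleftrightarrow> \<not> lin_indep v (X \<union> C)"
    if X: "finite X" "X \<inter> C = {}" "lin_indep v X" "v ` X \<subseteq> span (v ` P)" for X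
  proof
    assume "w \<in> span (v ` X)"
    then show "\<not> lin_indep v (X \<union> C)" using lin_indep_Un[OF X(1) fin(2) X(2)] w by blast
  next
    assume "\<not> lin_indep v (X \<union> C)"
    then have "\<not> span (v ` X) \<inter> span (v ` C) \<subseteq> {0}"
      using lin_indep_Un[OF X(1) fin(2) X(2), of v] X(3) f(2) by blast
    then obtain z where z: "z \<in> span (v ` X)" "z \<in> span (v ` C)" "z \<noteq> 0" by blast
    have XP: "span (v ` X) \<subseteq> span (v ` P)" using X(4) by (intro span_minimal) auto
    have "w \<in> span {z}"
    proof (rule ccontr)
      assume n: "w \<notin> span {z}"
      then have "independent {w, z}" using z(3) by (simp add: independent_insertI)
      moreover have "{w, z} \<subseteq> span (v ` P) \<inter> span (v ` C)" using w z XP by auto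
      ultimately have "card {w, z} \<le> card {c}" using lin_indep_Int_card_le[OF fin disj _ f(3)] c by blast
      moreover have "w \<noteq> z" using n span_base[of z "{z}"] by auto
      ultimately show False by simp
    qed
    moreover have "span {z} \<subseteq> span (v ` X)" using z by (intro span_minimal) auto
    ultimately show "w \<in> span (v ` X)" by blast
  qed
  then show thesis using that w by blast
qed

text \<open>The two-dimensional analogue: the common part of the spans has dimension at most two, so
  the independent vectors \<open>y\<close> and \<open>z\<close> span all of it, and can replace
  \<open>C\<close> when testing \<open>X\<close>.\<close>

lemma common_line:
  assumes fin: "finite P" "finite C" and disj: "P \<inter> C = {}" and cd: "c \<in> C" "d \<in> C"
    and f: "lin_indep v C" "lin_indep v (P \<union> (C - {c, d}))"
    and y: "independent {y, z}" "y \<noteq> z" "{y, z} \<subseteq> span (v ` P) \<inter> span (v ` C)"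
    and X: "finite X" "X \<inter> C = {}" "lin_indep v X" "v ` X \<subseteq> span (v ` P)"
  shows "span (v ` X) \<inter> span {y, z} \<subseteq> {0} \<longleftrightarrow> lin_indep v (X \<union> C)"
proof -
  have XP: "span (v ` X) \<subseteq> span (v ` P)" using X(4) by (intro span_minimal) auto
  have "span {y, z} = span (v ` P) \<inter> span (v ` C)"
  proof
    show "span {y, z} \<subseteq> span (v ` P) \<inter> span (v ` C)"
      using y(3) by (intro span_minimal subspace_inter) auto
    show "span (v ` P) \<inter> span (v ` C) \<subseteq> span {y, z}"
    proof (rule ccontr)
      assume "\<not> span (v ` P) \<inter> span (v ` C) \<subseteq> span {y, z}"
      then obtain w where w: "w \<in> span (v ` P) \<inter> span (v ` C)" "w \<notin> span {y, z}" by blast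
      then have "independent {w, y, z}" by (intro independent_insertI[OF _ y(1)])
      moreover have "{w, y, z} \<subseteq> span (v ` P) \<inter> span (v ` C)" using w y(3) by auto
      ultimately have "card {w, y, z} \<le> card {c, d}"
        using lin_indep_Int_card_le[OF fin disj _ f(2)] cd by blast
      moreover have "w \<noteq> y" "w \<noteq> z" using w(2) span_base[of _ "{y, z}"] by auto
      then have "card {w, y, z} = 3" using y(2) by simp
      moreover have "card {c, d} \<le> 2" by (cases "c = d") auto
      ultimately show False by simp
    qed
  qed
  then have "span (v ` X) \<inter> span {y, z} = span (v ` X) \<inter> span (v ` C)" using XP by blast
  then show ?thesis using lin_indep_Un[OF X(1) fin(2) X(2), of v] X(3) f(1) by simp
qed

end

section \<open>The points for \<open>p\<close> and \<open>q\<close> in a representation of the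
  construction\<close>

context construction
begin

lemma indep_down: "I \<in> indeps L \<Longrightarrow> J \<subseteq> I \<Longrightarrow> J \<in> indeps L"
  by (rule matroidD(6)[OF L])

lemma A_indep: "set xs \<in> indeps N" and B_indep: "set ys \<in> indeps N"
  using A B by (auto simp: basis_of_def)

lemma r_A: "r = card (set xs)" and r_B: "r = card (set ys)"
  using rk_basis[OF N A] rk_basis[OF N B] .

lemma M_indep_L:
  assumes "X \<subseteq> E0"
  shows "Elt ` X \<in> indeps M \<longleftrightarrow> X \<in> indeps L"
  using M_indep[OF assms, of "{}" "{}" False False] matroidD(2)[OF N]
  by (simp add: constr_indep_def resolve_simps placed_indep_def ex_bool_eq)

text \<open>\<open>A\<close> uses up the rank of \<open>N\<close>, so beside it \<open>a\<close> can
  only act as \<open>p\<close> and, once \<open>a\<close> is present too, \<open>b\<close> only as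
  \<open>q\<close>.\<close>

lemma M_indep_A:
  assumes "X \<subseteq> E0"
  shows "X \<in> indeps L \<Longrightarrow> Elt ` (X \<union> set xs) \<in> indeps M"
    and "Elt ` (X \<union> set xs) \<union> {New_a} \<in> indeps M \<longleftrightarrow> insert p X \<in> indeps L"
    and "Elt ` (X \<union> set xs) \<union> {New_a, New_b} \<in> indeps M \<longleftrightarrow> insert p (insert q X) \<in> indeps L"
proof -
  have m: "Elt ` (X \<union> set xs) \<union> flag_set New_a u \<union> flag_set New_b v \<in> indeps M \<longleftrightarrow>
      constr_indep (indeps L) p q N X (set xs) {} u v" for u v
    using M_indep[OF assms, of "set xs" "{}" u v] by simp
  note c = placed_indep_full[OF r_A[symmetric] A_indep]
  show "Elt ` (X \<union> set xs) \<in> indeps M" if "X \<in> indeps L"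
    using m[of False False] constr_indepI[of "set xs" False "set xs" False "{}" False "{}" False "indeps L" p q N X] that
    by (simp add: c resolve_simps)
  show "Elt ` (X \<union> set xs) \<union> {New_a} \<in> indeps M \<longleftrightarrow> insert p X \<in> indeps L"
    using m[of True False] by (simp add: constr_indep_def resolve_simps c)
  have "Elt ` (X \<union> set xs) \<union> {New_a, New_b} = Elt ` (X \<union> set xs) \<union> flag_set New_a True \<union> flag_set New_b True"
    by auto
  then show "Elt ` (X \<union> set xs) \<union> {New_a, New_b} \<in> indeps M \<longleftrightarrow> insert p (insert q X) \<in> indeps L"
    using m[of True True] by (simp add: constr_indep_def resolve_simps c insert_commute[of p q])
qed

lemma M_indep_B:
  assumes "X \<subseteq> E0"
  shows "X \<in> indeps L \<Longrightarrow> Elt ` (X \<union> set ys) \<in> indeps M"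
    and "Elt ` (X \<union> set ys) \<union> {New_b} \<in> indeps M \<longleftrightarrow> insert q X \<in> indeps L"
proof -
  have m: "Elt ` (X \<union> set ys) \<union> flag_set New_a u \<union> flag_set New_b v \<in> indeps M \<longleftrightarrow>
      constr_indep (indeps L) p q N X {} (set ys) u v" for u v
    using M_indep[OF assms, of "{}" "set ys" u v] by simp
  note c = placed_indep_full[OF r_B[symmetric] B_indep]
  show "Elt ` (X \<union> set ys) \<in> indeps M" if "X \<in> indeps L"
    using m[of False False] constr_indepI[of "{}" False "{}" False "set ys" False "set ys" False "indeps L" p q N X] that
    by (simp add: c resolve_simps)
  show "Elt ` (X \<union> set ys) \<union> {New_b} \<in> indeps M \<longleftrightarrow> insert q X \<in> indeps L"
    using m[of False True] by (simp add: constr_indep_def resolve_simps c)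
qed

text \<open>With \<open>a\<close> and \<open>b\<close> both present no copy can be resolved to them,
  so independence would require \<open>insert y A\<close> to be independent in \<open>N\<close>.
  This later puts \<open>B\<close> into the span of \<open>A \<union> {a, b}\<close>.\<close>

lemma M_dep_AB:
  assumes "y \<in> set ys"
  shows "insert (Elt y) (Elt ` set xs \<union> {New_a, New_b}) \<notin> indeps M"
proof -
  have y: "y \<notin> set xs" using assms AB_disj by auto
  have "insert y (set xs) \<notin> indeps N"
  proof
    assume i: "insert y (set xs) \<in> indeps N"
    then have "insert y (set xs) = set xs"
      using A matroidD(4)[OF N i] unfolding basis_of_def by blast
    then show False using y by blast
  qed
  moreover have "insert (Elt y) (Elt ` set xs \<union> {New_a, New_b}) =
      Elt ` ({} \<union> set xs \<union> {y}) \<union> flag_set New_a True \<union> flag_set New_b True" by auto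
  ultimately show ?thesis
    using M_indep[of "{}" "set xs" "{y}" True True] assms by (simp add: constr_indep_def resolve_def placed_indep_def)
qed

text \<open>Some set fails to span \<open>p\<close>, so \<open>p\<close> is not a loop. Let
  \<open>B\<close> be a basis of a set that spans \<open>p\<close> but not \<open>q\<close>. A basis
  of \<open>B \<union> {p, q}\<close> containing \<open>p\<close> is as large as \<open>B\<close>
  with \<open>q\<close>; without \<open>q\<close> it would have to be \<open>B\<close> with
  \<open>p\<close>, which is dependent.\<close>

lemma incomparable_indep:
  assumes "incomparable_pair L p q"
  shows "{p, q} \<in> indeps L"
proof -
  obtain X where X: "X \<subseteq> E0" "p \<in> cl L X" "q \<notin> cl L X"
    using assms by (auto simp: incomparable_pair_def spans_def)
  obtain Y where Y: "Y \<subseteq> E0" "p \<notin> cl L Y"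
    using assms by (auto simp: incomparable_pair_def spans_def)
  obtain C where C: "basis_of L Y C" using basis_of_exists[OF L] .
  have "insert p C \<in> indeps L" using mem_cl_basis[OF L C] Y(2) p by blast
  then have pL: "{p} \<in> indeps L" by (rule indep_down) auto
  obtain B where B: "basis_of L X B" using basis_of_exists[OF L] .
  have BX: "B \<subseteq> E0" "B \<in> indeps L" using B X(1) by (auto simp: basis_of_def)
  have Bq: "insert q B \<in> indeps L" and Bp: "insert p B \<notin> indeps L"
    using mem_cl_basis[OF L B] X BX q by auto
  obtain D where D: "basis_of L (insert p (insert q B)) D" "{p} \<subseteq> D"
    using basis_extend[OF L pL, of "insert p (insert q B)"] by auto
  have DL: "D \<in> indeps L" "D \<subseteq> insert p (insert q B)" using D by (auto simp: basis_of_def)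
  have fB: "finite B" using matroidD(5)[OF L BX(2)] .
  have "q \<in> D"
  proof (rule ccontr)
    assume "q \<notin> D"
    then have sub: "D \<subseteq> insert p B" using DL by auto
    have "card (insert q B) \<le> card D" using card_indep_le_basis[OF L D(1) Bq] by blast
    moreover have "card (insert q B) = card (insert p B)" using BX fB by (simp add: card_insert_if subset_Diff_insert)
    ultimately have "D = insert p B" using sub fB by (intro card_seteq) auto
    then show False using DL Bp by simp
  qed
  then show ?thesis using indep_down[OF DL(1), of "{p, q}"] D(2) by blast
qed

lemma L_representable_of_M:
  assumes inc: "incomparable_pair L p q" and "representable TYPE('f::field) M"
  shows "representable TYPE('f) L"
  using assms(2)
proof (rule representableE)
  fix n and v :: "'a elt \<Rightarrow> nat \<Rightarrow> 'f"
  assume v: "supp n v" "\<And>I. I \<subseteq> ground M \<Longrightarrow> I \<in> indeps M \<longleftrightarrow> vf.lin_indep v I"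
  have fM: "finite I" if "I \<subseteq> ground M" for I using that matroidD(1)[OF M_matroid] by (rule finite_subset)
  obtain X0 where X0: "X0 \<subseteq> E0" "p \<in> cl L X0" "q \<notin> cl L X0"
    using inc by (auto simp: incomparable_pair_def spans_def)
  obtain X1 where X1: "X1 \<subseteq> E0" "q \<in> cl L X1"
    using inc by (auto simp: incomparable_pair_def spans_def)
  have pqL: "{p, q} \<in> indeps L" by (rule incomparable_indep[OF inc])
  have pL: "{p} \<in> indeps L" and qL: "{q} \<in> indeps L" using indep_down[OF pqL] by auto
  obtain P where P: "basis_of L E0 P" using basis_of_exists[OF L] .
  have PE: "P \<subseteq> E0" and PL: "P \<in> indeps L" using P by (auto simp: basis_of_def)
  \<comment> \<open>By incomparability both \<open>p\<close> and \<open>q\<close> are spanned by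
    subsets of \<open>E0\<close>; this is what makes the spans of \<open>A \<union> {a}\<close> and
    \<open>B \<union> {b}\<close> meet that of \<open>P\<close>.\<close>
  have Pp: "insert p P \<notin> indeps L" and Pq: "insert q P \<notin> indeps L"
    using mem_cl_basis[OF L P] cl_mono[OF L X0(1)] cl_mono[OF L X1(1)] X0(2) X1(2) PE by blast+
  have gE: "Elt ` X \<subseteq> ground M" if "X \<subseteq> E0" for X using that by (auto simp: M_ground)
  let ?CA = "Elt ` set xs \<union> {New_a}" and ?CB = "Elt ` set ys \<union> {New_b}"
  let ?C = "Elt ` set xs \<union> {New_a, New_b}"
  have gC: "?CA \<subseteq> ground M" "?CB \<subseteq> ground M" "?C \<subseteq> ground M" using AB by (auto simp: M_ground)
  have dj: "Elt ` X \<inter> ?CA = {}" "Elt ` X \<inter> ?CB = {}" "Elt ` X \<inter> ?C = {}" if "X \<subseteq> E0" for X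
    using that disj AB by auto
  have U: "Elt ` X \<union> ?CA = Elt ` (X \<union> set xs) \<union> {New_a}" "Elt ` X \<union> ?CB = Elt ` (X \<union> set ys) \<union> {New_b}"
    "Elt ` X \<union> ?C = Elt ` (X \<union> set xs) \<union> {New_a, New_b}" for X by auto
  have fA: "vf.lin_indep v (Elt ` X \<union> ?CA) \<longleftrightarrow> insert p X \<in> indeps L" if X: "X \<subseteq> E0" for X
    using v(2)[of "Elt ` X \<union> ?CA"] M_indep_A(2)[OF X] gE[OF X] gC U by simp
  have fB: "vf.lin_indep v (Elt ` X \<union> ?CB) \<longleftrightarrow> insert q X \<in> indeps L" if X: "X \<subseteq> E0" for X
    using v(2)[of "Elt ` X \<union> ?CB"] M_indep_B(2)[OF X] gE[OF X] gC U by simp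
  have fC: "vf.lin_indep v (Elt ` X \<union> ?C) \<longleftrightarrow> insert p (insert q X) \<in> indeps L" if X: "X \<subseteq> E0" for X
    using v(2)[of "Elt ` X \<union> ?C"] M_indep_A(3)[OF X] gE[OF X] gC U by simp
  have fX: "vf.lin_indep v (Elt ` X) \<longleftrightarrow> X \<in> indeps L" if X: "X \<subseteq> E0" for X
    using v(2)[OF gE[OF X]] M_indep_L[OF X] by simp
  have d0: "?CA - {New_a} = Elt ` set xs" "?CB - {New_b} = Elt ` set ys" "?C - {New_a, New_b} = Elt ` set xs"
    by auto
  have PA: "vf.lin_indep v (Elt ` P \<union> Elt ` set xs)" and PB: "vf.lin_indep v (Elt ` P \<union> Elt ` set ys)"
    using M_indep_A(1)[OF PE PL] M_indep_B(1)[OF PE PL]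
      v(2)[of "Elt ` (P \<union> set xs)"] v(2)[of "Elt ` (P \<union> set ys)"] gE[OF PE] gC
    by (simp_all add: image_Un)
  have XP: "v ` Elt ` X \<subseteq> vf.span (v ` Elt ` P)" if X: "X \<subseteq> E0" for X
  proof safe
    fix x assume x: "x \<in> X"
    show "v (Elt x) \<in> vf.span (v ` Elt ` P)"
    proof (cases "x \<in> P")
      case True
      then show ?thesis by (intro vf.span_base) auto
    next
      case False
      have "insert x P \<notin> indeps L"
      proof
        assume i: "insert x P \<in> indeps L"
        have "insert x P \<subseteq> E0" using x X PE by auto
        then have "insert x P = P" using P i by (simp add: basis_of_def subset_insertI)
        then show False using False by blast
      qed
      then have "\<not> vf.lin_indep v (insert (Elt x) (Elt ` P))" using fX[of "insert x P"] x X PE by auto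
      moreover have "Elt x \<notin> Elt ` P" using False by auto
      ultimately show ?thesis using vf.lin_indep_insert[of "Elt x" "Elt ` P" v] fX[OF PE] PL by simp
    qed
  qed
  note finE = fM[OF gE]
  have lin_indep_CA: "vf.lin_indep v ?CA" and lin_indep_CB: "vf.lin_indep v ?CB" and lin_indep_C: "vf.lin_indep v ?C"
    using fA[of "{}"] fB[of "{}"] fC[of "{}"] pL qL pqL by auto
  obtain y where y: "y \<in> vf.span (v ` Elt ` P)" "y \<in> vf.span (v ` ?CA)"
    "\<And>X. finite X \<Longrightarrow> X \<inter> ?CA = {} \<Longrightarrow> vf.lin_indep v X \<Longrightarrow> v ` X \<subseteq> vf.span (v ` Elt ` P) \<Longrightarrow>
       y \<in> vf.span (v ` X) \<longleftrightarrow> \<not> vf.lin_indep v (X \<union> ?CA)"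
  proof (rule vf.exists_common_point[of "Elt ` P" ?CA New_a v])
    show "\<not> vf.lin_indep v (Elt ` P \<union> ?CA)" using fA[OF PE] Pp by simp
    show "vf.lin_indep v (Elt ` P)" using fX[OF PE] PL by simp
    show "vf.lin_indep v (Elt ` P \<union> (?CA - {New_a}))" using PA d0 by simp
  qed (use finE[OF PE] fM[OF gC(1)] dj(1)[OF PE] lin_indep_CA in auto)
  obtain z where z: "z \<in> vf.span (v ` Elt ` P)" "z \<in> vf.span (v ` ?CB)"
    "\<And>X. finite X \<Longrightarrow> X \<inter> ?CB = {} \<Longrightarrow> vf.lin_indep v X \<Longrightarrow> v ` X \<subseteq> vf.span (v ` Elt ` P) \<Longrightarrow>
       z \<in> vf.span (v ` X) \<longleftrightarrow> \<not> vf.lin_indep v (X \<union> ?CB)"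
  proof (rule vf.exists_common_point[of "Elt ` P" ?CB New_b v])
    show "\<not> vf.lin_indep v (Elt ` P \<union> ?CB)" using fB[OF PE] Pq by simp
    show "vf.lin_indep v (Elt ` P)" using fX[OF PE] PL by simp
    show "vf.lin_indep v (Elt ` P \<union> (?CB - {New_b}))" using PB d0 by simp
  qed (use finE[OF PE] fM[OF gC(2)] dj(2)[OF PE] lin_indep_CB in auto)
  have yX: "y \<notin> vf.span (v ` Elt ` X) \<longleftrightarrow> insert p X \<in> indeps L"
    and zX: "z \<notin> vf.span (v ` Elt ` X) \<longleftrightarrow> insert q X \<in> indeps L"
    if X: "X \<subseteq> E0" "X \<in> indeps L" for X
  proof -
    have "vf.lin_indep v (Elt ` X)" using fX X by simp
    then show "y \<notin> vf.span (v ` Elt ` X) \<longleftrightarrow> insert p X \<in> indeps L"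
      "z \<notin> vf.span (v ` Elt ` X) \<longleftrightarrow> insert q X \<in> indeps L"
      using y(3)[OF finE dj(1) _ XP] z(3)[OF finE dj(2) _ XP] X(1) fA[OF X(1)] fB[OF X(1)] by blast+
  qed
  \<comment> \<open>\<open>X0\<close> spans \<open>p\<close> but not \<open>q\<close>, so the span
    of its basis contains \<open>y\<close> and not \<open>z\<close>.\<close>
  have yz: "vf.independent {y, z}" "y \<noteq> z"
  proof -
    obtain B0 where B0: "basis_of L X0 B0" using basis_of_exists[OF L] .
    have B0E: "B0 \<subseteq> E0" "B0 \<in> indeps L" using B0 X0(1) by (auto simp: basis_of_def)
    have "insert p B0 \<notin> indeps L" "insert q B0 \<in> indeps L"
      using mem_cl_basis[OF L B0] X0 B0E q by auto
    then have *: "y \<in> vf.span (v ` Elt ` B0)" "z \<notin> vf.span (v ` Elt ` B0)"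
      using yX[OF B0E] zX[OF B0E] by auto
    then show "y \<noteq> z" by auto
    have "y \<noteq> 0" using yX[of "{}"] pL matroidD(2)[OF L] by auto
    moreover have "vf.span {y} \<subseteq> vf.span (v ` Elt ` B0)" using *(1) by (intro vf.span_minimal) auto
    then have "z \<notin> vf.span {y}" using *(2) by auto
    ultimately have "vf.independent {z, y}" by (simp add: vf.independent_insertI)
    then show "vf.independent {y, z}" by (simp add: insert_commute)
  qed
  \<comment> \<open>\<open>z\<close> was found through \<open>B \<union> {b}\<close>; to place
    \<open>y\<close> and \<open>z\<close> on one line, it must be seen to lie in the span of
    \<open>A \<union> {a, b}\<close>.\<close>
  have "v ` ?CB \<subseteq> vf.span (v ` ?C)"
  proof
    fix w assume "w \<in> v ` ?CB"
    then consider "w = v New_b" | y where "y \<in> set ys" "w = v (Elt y)" by auto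
    then show "w \<in> vf.span (v ` ?C)"
    proof cases
      case 1 then show ?thesis by (intro vf.span_base) auto
    next
      case (2 y)
      have "insert (Elt y) ?C \<subseteq> ground M" using 2 gC AB by (auto simp: M_ground)
      then have "\<not> vf.lin_indep v (insert (Elt y) ?C)" using M_dep_AB[OF 2(1)] v(2) by blast
      moreover have "Elt y \<notin> ?C" using 2 AB_disj by auto
      ultimately show ?thesis using vf.lin_indep_insert[of "Elt y" ?C v] lin_indep_C 2(2) by simp
    qed
  qed
  then have "vf.span (v ` ?CB) \<subseteq> vf.span (v ` ?C)" by (intro vf.span_minimal) auto
  moreover have "vf.span (v ` ?CA) \<subseteq> vf.span (v ` ?C)" by (intro vf.span_mono) auto
  ultimately have yzC: "{y, z} \<subseteq> vf.span (v ` Elt ` P) \<inter> vf.span (v ` ?C)" using y z by blast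
  \<comment> \<open>\<open>y\<close> and \<open>z\<close> separately settle the sets with just one
    of \<open>p\<close> and \<open>q\<close>; sets with both need the whole line through
    them.\<close>
  have yzX: "vf.span (v ` Elt ` X) \<inter> vf.span {y, z} \<subseteq> {0} \<longleftrightarrow> insert p (insert q X) \<in> indeps L"
    if X: "X \<subseteq> E0" "X \<in> indeps L" for X
    unfolding fC[OF X(1), symmetric]
  proof (rule vf.common_line[of "Elt ` P" ?C New_a New_b v])
    show "vf.lin_indep v (Elt ` P \<union> (?C - {New_a, New_b}))" using PA unfolding d0 .
    show "vf.lin_indep v (Elt ` X)" using fX X by simp
  qed (use finE[OF PE] finE[OF X(1)] fM[OF gC(3)] dj(3)[OF PE] dj(3)[OF X(1)] XP[OF X(1)] lin_indep_C yz yzC in auto)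
  define u where "u x = (if x = p then y else if x = q then z else v (Elt x))" for x
  have su: "supp n u"
    using v(1) supp_span[OF v(1) y(2)] supp_span[OF v(1) z(2)] by (auto simp: supp_def u_def)
  have "I \<in> indeps L \<longleftrightarrow> vf.lin_indep u I" if I: "I \<subseteq> ground L" for I
  proof -
    define X where "X = I - {p, q}"
    have X: "X \<subseteq> E0" "p \<notin> X" "q \<notin> X" using I by (auto simp: X_def)
    have uX: "u ` X = v ` Elt ` X" using X by (auto simp: u_def image_iff)
    have u_p: "u p = y" and u_q: "u q = z" and u_pq: "u ` {p, q} = {y, z}"
      using pq by (auto simp: u_def)
    have "vf.lin_indep u X \<longleftrightarrow> vf.lin_indep (\<lambda>x. v (Elt x)) X" using X by (intro vf.lin_indep_cong) (auto simp: u_def)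
    also have "\<dots> \<longleftrightarrow> vf.lin_indep v (Elt ` X)" by (rule vf.lin_indep_image[symmetric]) (simp add: inj_on_def)
    also have "\<dots> \<longleftrightarrow> X \<in> indeps L" by (rule fX[OF X(1)])
    finally have fuX: "vf.lin_indep u X \<longleftrightarrow> X \<in> indeps L" .
    show ?thesis
    proof (cases "X \<in> indeps L")
      case False
      have "X \<subseteq> I" by (auto simp: X_def)
      then show ?thesis using False fuX vf.lin_indep_subset[of u I X] indep_down[of I X] by blast
    next
      case XL: True
      consider "I = X" | "I = insert p X" | "I = insert q X" | "I = X \<union> {p, q}"
        by (cases "p \<in> I"; cases "q \<in> I") (auto simp: X_def)
      then show ?thesis
      proof cases
        case 1
        then show ?thesis using fuX by simp
      next
        case 2
        then show ?thesis
          using vf.lin_indep_insert[OF X(2), of u] fuX XL yX[OF X(1) XL] by (simp add: uX u_p)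
      next
        case 3
        then show ?thesis
          using vf.lin_indep_insert[OF X(3), of u] fuX XL zX[OF X(1) XL] by (simp add: uX u_q)
      next
        case 4
        have "inj_on u {p, q}" using yz(2) pq by (auto simp: u_def)
        then have "vf.lin_indep u {p, q}" using yz(1) u_pq by (simp add: vf.lin_indep_def)
        moreover have "finite X" using matroidD(5)[OF L XL] .
        moreover have "X \<inter> {p, q} = {}" using X by auto
        ultimately have "vf.lin_indep u I \<longleftrightarrow> vf.span (v ` Elt ` X) \<inter> vf.span {y, z} \<subseteq> {0}"
          using vf.lin_indep_Un[of X "{p, q}" u] fuX XL unfolding 4 uX u_pq by simp
        moreover have "I = insert p (insert q X)" using 4 by auto
        ultimately show ?thesis using yzX[OF X(1) XL] by simp
      qed
    qed
  qed
  then have "represents n u L" using su by (simp add: represents_def)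
  then show ?thesis by (rule representableI[OF L])
qed

end

section \<open>Proper minors\<close>

lemma contraction_empty:
  assumes M: "is_matroid M"
  shows "contraction M {} = M"
proof -
  have b: "basis_of M {} {}" using matroidD(2)[OF M] by (auto simp: basis_of_def)
  have "indeps (contraction M {}) = indeps M"
    using contraction_indeps[OF M b] matroidD(4)[OF M] by auto
  moreover have "ground (contraction M {}) = ground M" by (simp add: contraction_def)
  ultimately show ?thesis by (intro matroid.equality) auto
qed

lemma deletion_empty:
  assumes M: "is_matroid M"
  shows "deletion M {} = M"
  using matroidD(4)[OF M] by (intro matroid.equality) (auto simp: deletion_def)

text \<open>The minor never sees a set that contains \<open>e\<close>, so a representable
  \<open>K\<close> may replace \<open>M\<close> although the two differ on such sets. The rest of
  \<open>X\<close> and \<open>Y\<close> is handled inside the representation.\<close>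

lemma representable_minor_via_deletion:
  assumes M: "is_matroid M" and K: "representable TYPE('f::field) K"
    and XY: "X \<subseteq> ground M" "X \<inter> Y = {}" and e: "e \<in> Y" and g: "ground M - {e} \<subseteq> ground K"
    and agree: "\<And>J. J \<subseteq> ground M - {e} \<Longrightarrow> J \<in> indeps M \<longleftrightarrow> J \<in> indeps K"
  shows "representable TYPE('f) (deletion (contraction M X) Y)"
  using K
proof (rule representableE)
  fix n and v :: "'a \<Rightarrow> nat \<Rightarrow> 'f"
  assume v: "supp n v" "\<And>I. I \<subseteq> ground K \<Longrightarrow> I \<in> indeps K \<longleftrightarrow> vf.lin_indep v I"
  show ?thesis
  proof (rule representable_minor[OF M matroidD(2)[OF M] _ XY v(1)])
    fix J assume "J \<subseteq> ground M - Y - {}"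
    then have J: "J \<subseteq> ground M - {e}" using e by auto
    then show "J \<union> {} \<in> indeps M \<longleftrightarrow> vf.lin_indep v J" using agree[OF J] v(2)[of J] g by simp
  qed simp
qed

text \<open>Here \<open>K\<close> stands in for the contraction of \<open>M\<close> by
  \<open>e\<close> alone, so only the sets of \<open>M\<close> that contain \<open>e\<close> have to
  match.\<close>

lemma representable_minor_via_contraction:
  assumes M: "is_matroid M" and K: "representable TYPE('f::field) K"
    and XY: "X \<subseteq> ground M" "X \<inter> Y = {}" and e: "e \<in> X" "{e} \<in> indeps M"
    and g: "ground M - {e} \<subseteq> ground K"
    and agree: "\<And>J. J \<subseteq> ground M - {e} \<Longrightarrow> insert e J \<in> indeps M \<longleftrightarrow> J \<in> indeps K"
  shows "representable TYPE('f) (deletion (contraction M X) Y)"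
  using K
proof (rule representableE)
  fix n and v :: "'a \<Rightarrow> nat \<Rightarrow> 'f"
  assume v: "supp n v" "\<And>I. I \<subseteq> ground K \<Longrightarrow> I \<in> indeps K \<longleftrightarrow> vf.lin_indep v I"
  show ?thesis
  proof (rule representable_minor[OF M e(2) _ XY v(1)])
    fix J assume "J \<subseteq> ground M - Y - {e}"
    then have J: "J \<subseteq> ground M - {e}" by auto
    then show "J \<union> {e} \<in> indeps M \<longleftrightarrow> vf.lin_indep v J" using agree[OF J] v(2)[of J] g by simp
  qed (use e in auto)
qed

lemma representable_contraction:
  assumes "representable TYPE('f::field) K" "X \<subseteq> ground K"
  shows "representable TYPE('f) (contraction K X)"
  using assms(1)
proof (rule representableE)
  fix n and v :: "'a \<Rightarrow> nat \<Rightarrow> 'f"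
  assume K: "is_matroid K"
    and v: "supp n v" "\<And>I. I \<subseteq> ground K \<Longrightarrow> I \<in> indeps K \<longleftrightarrow> vf.lin_indep v I"
  have "representable TYPE('f) (deletion (contraction K X) {})"
    by (rule representable_minor[OF K matroidD(2)[OF K] _ assms(2) _ v(1)]) (use v(2) in auto)
  then show ?thesis by (simp add: deletion_empty[OF is_matroid_contraction[OF K]])
qed

lemma contraction_single_indeps:
  assumes "is_matroid K" "{e} \<in> indeps K"
  shows "J \<in> indeps (contraction K {e}) \<longleftrightarrow> J \<subseteq> ground K - {e} \<and> insert e J \<in> indeps K"
  using contraction_indeps[OF assms(1) basis_of_indep[OF assms(2)]] by auto

text \<open>For the last claim: if \<open>x\<close> were a loop, a representation of
  \<open>deletion L {x}\<close> together with the zero vector for \<open>x\<close> would represent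
  \<open>L\<close>. Absence of loops allows \<open>{x}\<close> to be used as a basis when
  contracting \<open>x\<close>.\<close>

lemma excluded_minor_representable:
  assumes L: "excluded_minor (representable TYPE('f::field)) L" and x: "x \<in> ground L"
  shows "representable TYPE('f) (deletion L {x})" "representable TYPE('f) (contraction L {x})"
    and "{x} \<in> indeps L"
proof -
  have m: "is_matroid L" and nr: "\<not> representable TYPE('f) L"
    and min: "\<And>K. proper_minor K L \<Longrightarrow> representable TYPE('f) K"
    using L by (auto simp: excluded_minor_def)
  have "proper_minor (deletion (contraction L {}) {x}) L" unfolding proper_minor_def
    by (intro exI[of _ "{}"] exI[of _ "{x}"]) (use x in auto)
  from min[OF this] show del: "representable TYPE('f) (deletion L {x})"
    by (simp add: contraction_empty[OF m])
  have "proper_minor (deletion (contraction L {x}) {}) L" unfolding proper_minor_def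
    by (intro exI[of _ "{x}"] exI[of _ "{}"]) (use x in auto)
  from min[OF this] show "representable TYPE('f) (contraction L {x})"
    by (simp add: deletion_empty[OF is_matroid_contraction[OF m]])
  show "{x} \<in> indeps L"
  proof (rule ccontr)
    assume loop: "{x} \<notin> indeps L"
    from del show False
    proof (rule representableE)
      fix n and v :: "'a \<Rightarrow> nat \<Rightarrow> 'f"
      assume v: "supp n v" "\<And>I. I \<subseteq> ground (deletion L {x}) \<Longrightarrow> I \<in> indeps (deletion L {x}) \<longleftrightarrow> vf.lin_indep v I"
      let ?v = "v(x := 0)"
      have "I \<in> indeps L \<longleftrightarrow> vf.lin_indep ?v I" if I: "I \<subseteq> ground L" for I
      proof (cases "x \<in> I")
        case True
        then have "I \<notin> indeps L" using loop matroidD(6)[OF m, of I "{x}"] by auto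
        moreover have "0 \<in> ?v ` I" using True by (intro image_eqI[of _ _ x]) auto
        then have "\<not> vf.lin_indep ?v I" using vf.dependent_zero unfolding vf.lin_indep_def by blast
        ultimately show ?thesis by simp
      next
        case False
        then have "vf.lin_indep ?v I \<longleftrightarrow> vf.lin_indep v I" by (intro vf.lin_indep_cong) auto
        then show ?thesis using v(2)[of I] I False by (auto simp: deletion_def)
      qed
      then have "represents n ?v L" using v(1) by (simp add: represents_def supp_def)
      then show False using nr representableI[OF m] by blast
    qed
  qed
qed

section \<open>Comparison with the constructions from modified versions of \<open>L\<close>\<close>

context construction
begin

lemma construction_change:
  assumes "is_matroid L'" "ground L' \<subseteq> ground L" "p \<in> ground L'" "q \<in> ground L'"
  shows "construction L' N p q xs ys"
  using assms N disj pq AB AB_disj A B dist by unfold_locales auto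

lemma construction_move_p:
  assumes "is_matroid (move L p q)"
  shows "construction (move L p q) N p q xs ys"
  by (rule construction_change) (use assms move_indeps(1)[OF L p q pq] p q in auto)

lemma construction_move_q:
  assumes "is_matroid (move L q p)"
  shows "construction (move L q p) N p q xs ys"
  by (rule construction_change) (use assms move_indeps(1)[OF L q p pq[symmetric]] p q in auto)

text \<open>The sets excluded by \<open>ne\<close> contain \<open>A \<union> {a}\<close> and avoid
  \<open>B \<union> {b}\<close>. On them \<open>a\<close> is forced to act as \<open>p\<close> and
  nothing can act as \<open>q\<close>, so the original position of \<open>p\<close> becomes
  visible.\<close>

lemma M_move_p:
  assumes m: "is_matroid (move L p q)" and J: "J \<subseteq> ground M"
    and ne: "J \<inter> (Elt ` set ys \<union> {New_b}) \<noteq> {} \<or> \<not> Elt ` set xs \<union> {New_a} \<subseteq> J"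
  shows "J \<in> indeps M \<longleftrightarrow> J \<in> indeps (M_constr (move L p q) p q N xs ys)"
proof -
  interpret P: construction "move L p q" N p q xs ys by (rule construction_move_p[OF m])
  have g: "ground (move L p q) = ground L" by (rule move_indeps(1)[OF L p q pq])
  obtain X S T u v where c: "X \<subseteq> E0" "S \<subseteq> set xs" "T \<subseteq> set ys"
    and J': "J = Elt ` (X \<union> S \<union> T) \<union> flag_set New_a u \<union> flag_set New_b v" using M_set_cases[OF J] .
  note mv = move_indeps(2,3)[OF L p q pq]
  have XN: "X \<inter> ground N = {}" using c(1) disj by auto
  have "T \<noteq> {} \<or> v \<or> \<not> (S = set xs \<and> u)" using ne XN AB AB_disj unfolding J' by auto
  then have "constr_indep (indeps (move L p q)) p q N X S T u v \<longleftrightarrow> constr_indep (indeps L) p q N X S T u v"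
  proof (rule constr_indep_move[OF N A c(2), rotated -1])
    show "T \<in> indeps N" by (rule matroidD(6)[OF N B_indep c(3)])
    show "S \<inter> T = {}" using c AB_disj by blast
    show "insert q X \<in> indeps L \<Longrightarrow> X \<in> indeps L" by (rule indep_down) auto
    show "insert p (insert q X) \<in> indeps (move L p q) \<longleftrightarrow> insert p (insert q X) \<in> indeps L"
      using mv(2)[of "insert q X"] c(1) pq by auto
  qed (use mv[of X] mv(1)[of "insert q X"] c(1) pq in auto)
  then show ?thesis using M_indep[OF c] P.M_indep[of X S T u v] c g unfolding J' by simp
qed

text \<open>The mirror image: \<open>constr_indep_commute\<close> exchanges \<open>p\<close>,
  \<open>A\<close>, \<open>a\<close> with \<open>q\<close>, \<open>B\<close>,
  \<open>b\<close>.\<close>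

lemma M_move_q:
  assumes m: "is_matroid (move L q p)" and J: "J \<subseteq> ground M"
    and ne: "J \<inter> (Elt ` set xs \<union> {New_a}) \<noteq> {} \<or> \<not> Elt ` set ys \<union> {New_b} \<subseteq> J"
  shows "J \<in> indeps M \<longleftrightarrow> J \<in> indeps (M_constr (move L q p) p q N xs ys)"
proof -
  interpret P: construction "move L q p" N p q xs ys by (rule construction_move_q[OF m])
  have g: "ground (move L q p) = ground L" by (rule move_indeps(1)[OF L q p pq[symmetric]])
  obtain X S T u v where c: "X \<subseteq> E0" "S \<subseteq> set xs" "T \<subseteq> set ys"
    and J': "J = Elt ` (X \<union> S \<union> T) \<union> flag_set New_a u \<union> flag_set New_b v" using M_set_cases[OF J] .
  note mv = move_indeps(2,3)[OF L q p pq[symmetric]]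
  have XN: "X \<inter> ground N = {}" using c(1) disj by auto
  have "S \<noteq> {} \<or> u \<or> \<not> (T = set ys \<and> v)" using ne XN AB AB_disj unfolding J' by auto
  then have "constr_indep (indeps (move L q p)) q p N X T S v u \<longleftrightarrow> constr_indep (indeps L) q p N X T S v u"
  proof (rule constr_indep_move[OF N B c(3), rotated -1])
    show "S \<in> indeps N" by (rule matroidD(6)[OF N A_indep c(2)])
    show "T \<inter> S = {}" using c AB_disj by blast
    show "insert p X \<in> indeps L \<Longrightarrow> X \<in> indeps L" by (rule indep_down) auto
    show "insert q (insert p X) \<in> indeps (move L q p) \<longleftrightarrow> insert q (insert p X) \<in> indeps L"
      using mv(2)[of "insert p X"] c(1) pq by auto
  qed (use mv[of X] mv(1)[of "insert p X"] c(1) pq in auto)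
  then show ?thesis
    using M_indep[OF c] P.M_indep[of X S T u v] c g unfolding J' constr_indep_commute[of _ p q] by simp
qed

lemma M_deletion_L:
  assumes x: "x \<in> E0" and J: "J \<subseteq> ground M - {Elt x}"
  shows "J \<in> indeps M \<longleftrightarrow> J \<in> indeps (M_constr (deletion L {x}) p q N xs ys)"
proof -
  let ?L = "deletion L {x}"
  have g: "ground ?L = ground L - {x}" by (simp add: deletion_def)
  interpret P: construction ?L N p q xs ys
    by (rule construction_change) (use is_matroid_deletion[OF L] x p q g in auto)
  obtain X S T u v where c: "X \<subseteq> E0" "S \<subseteq> set xs" "T \<subseteq> set ys"
    and J': "J = Elt ` (X \<union> S \<union> T) \<union> flag_set New_a u \<union> flag_set New_b v" using M_set_cases[of J] J by blast
  have xX: "x \<notin> X" using J unfolding J' by auto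
  have "constr_indep (indeps L) p q N X S T u v \<longleftrightarrow> constr_indep (indeps ?L) p q N X S T u v"
    by (rule constr_indep_cong) (use c(1) xX x p q in \<open>auto simp: deletion_def\<close>)
  then show ?thesis using M_indep[OF c] P.M_indep[of X S T u v] c xX g unfolding J' by auto
qed

lemma M_contraction_L:
  assumes x: "x \<in> E0" "{x} \<in> indeps L" and J: "J \<subseteq> ground M - {Elt x}"
  shows "insert (Elt x) J \<in> indeps M \<longleftrightarrow> J \<in> indeps (M_constr (contraction L {x}) p q N xs ys)"
proof -
  let ?L = "contraction L {x}"
  have g: "ground ?L = ground L - {x}" by (simp add: contraction_def)
  interpret P: construction ?L N p q xs ys
    by (rule construction_change) (use is_matroid_contraction[OF L] x p q g in auto)
  obtain X S T u v where c: "X \<subseteq> E0" "S \<subseteq> set xs" "T \<subseteq> set ys"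
    and J': "J = Elt ` (X \<union> S \<union> T) \<union> flag_set New_a u \<union> flag_set New_b v" using M_set_cases[of J] J by blast
  have xX: "x \<notin> X" using J unfolding J' by auto
  have xc: "insert x X \<subseteq> E0" using x c by auto
  note ci = contraction_single_indeps[OF L x(2)]
  have "constr_indep (indeps L) p q N (insert x X) S T u v \<longleftrightarrow> constr_indep (indeps ?L) p q N X S T u v"
    by (rule constr_indep_cong) (use c(1) xX x p q in \<open>auto simp: ci insert_commute[of x]\<close>)
  moreover have "insert (Elt x) J = Elt ` (insert x X \<union> S \<union> T) \<union> flag_set New_a u \<union> flag_set New_b v"
    unfolding J' by auto
  ultimately show ?thesis
    using M_indep[OF xc c(2,3)] P.M_indep[of X S T u v] c xX g unfolding J' by auto
qed

end

theorem theorem4p1: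
  fixes L N :: "'a matroid" and p q :: 'a and A B :: "'a set" and xs ys :: "'a list"
  assumes "infinite (UNIV :: 'f::field set)"
    and "is_matroid L" and "is_matroid N" and "ground L \<inter> ground N = {}"
    and "p \<in> ground L" and "q \<in> ground L" and "p \<noteq> q"
    and "A \<union> B = ground N" and "A \<inter> B = {}" and "is_basis N A" and "is_basis N B"
    and "distinct xs" and "set xs = A" and "distinct ys" and "set ys = B"
    and "excluded_minor (representable TYPE('f)) L"
    and "incomparable_pair L p q"
    and "representable TYPE('f) (move L p q)" and "representable TYPE('f) (move L q p)"
    and "representable TYPE('f) N"
  shows "excluded_minor (representable TYPE('f)) (M_constr L p q N xs ys)"
proof -
  note inf = assms(1) and exL = assms(16) and inc = assms(17) and Np = assms(20)
    and Lp = assms(18) and Lq = assms(19)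
  interpret construction L N p q xs ys using assms by unfold_locales auto
  have mp: "is_matroid (move L p q)" and mq: "is_matroid (move L q p)"
    using Lp Lq representable_matroid by auto
  interpret P: construction "move L p q" N p q xs ys by (rule construction_move_p[OF mp])
  interpret Q: construction "move L q p" N p q xs ys by (rule construction_move_q[OF mq])
  have rP: "representable TYPE('f) P.M" and rQ: "representable TYPE('f) Q.M"
    using P.M_representable[OF inf Lp Np] Q.M_representable[OF inf Lq Np] .
  have gP: "ground P.M = ground M" and gQ: "ground Q.M = ground M"
    using move_indeps(1)[OF L p q pq] move_indeps(1)[OF L q p pq[symmetric]]
    by (auto simp: M_ground P.M_ground Q.M_ground)
  let ?CA = "Elt ` set xs \<union> {New_a}" and ?CB = "Elt ` set ys \<union> {New_b}"
  have pqL: "{p, q} \<in> indeps L" by (rule incomparable_indep[OF inc])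
  have CA: "?CA \<in> indeps M" and CB: "?CB \<in> indeps M"
    using M_indep_A(2)[of "{}"] M_indep_B(2)[of "{}"] indep_down[OF pqL] by auto
  show ?thesis unfolding excluded_minor_def
  proof (intro conjI allI impI M_matroid)
    show "\<not> representable TYPE('f) M"
      using L_representable_of_M[OF inc] exL by (auto simp: excluded_minor_def)
  next
    fix K assume "proper_minor K M"
    then obtain X Y where XY: "X \<subseteq> ground M" "Y \<subseteq> ground M" "X \<inter> Y = {}" "X \<union> Y \<noteq> {}"
      and K: "K = deletion (contraction M X) Y" unfolding proper_minor_def by blast
    \<comment> \<open>A single removed element decides which representable matroid takes the place
      of \<open>M\<close>; the other elements of \<open>X\<close> and \<open>Y\<close> are removed
      from its representation.\<close>
    obtain e where e: "e \<in> X \<union> Y" using XY(4) by blast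
    then have eM: "e \<in> ground M" using XY by blast
    then consider (L) x where "x \<in> E0" "e = Elt x" | (A) "e \<in> ?CA" | (B) "e \<in> ?CB"
      using AB by (auto simp: M_ground)
    then show "representable TYPE('f) K" unfolding K
    proof cases
      case (L x)
      have xg: "x \<in> ground L" using L by auto
      note ex = excluded_minor_representable[OF exL xg]
      show "representable TYPE('f) (deletion (contraction M X) Y)"
      proof (cases "e \<in> Y")
        case True
        have g: "ground (deletion L {x}) = ground L - {x}" by (simp add: deletion_def)
        interpret D: construction "deletion L {x}" N p q xs ys
          by (rule construction_change) (use is_matroid_deletion[OF \<open>is_matroid L\<close>] L p q g in auto)
        show ?thesis
        proof (rule representable_minor_via_deletion[OF M_matroid D.M_representable[OF inf ex(1) Np] XY(1,3) True])
          show "ground M - {e} \<subseteq> ground D.M" using L by (auto simp: M_ground D.M_ground g)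
        qed (use M_deletion_L[OF L(1)] L(2) in auto)
      next
        case False
        then have eX: "e \<in> X" using e by auto
        have g: "ground (contraction L {x}) = ground L - {x}" by (simp add: contraction_def)
        interpret D: construction "contraction L {x}" N p q xs ys
          by (rule construction_change) (use is_matroid_contraction[OF \<open>is_matroid L\<close>] L p q g in auto)
        show ?thesis
        proof (rule representable_minor_via_contraction[OF M_matroid D.M_representable[OF inf ex(2) Np] XY(1,3) eX])
          show "ground M - {e} \<subseteq> ground D.M" using L by (auto simp: M_ground D.M_ground g)
          show "{e} \<in> indeps M" using M_indep_L[of "{x}"] L ex(3) by auto
        qed (use M_contraction_L[OF L(1) ex(3)] L(2) in auto)
      qed
    next
      case A
      show "representable TYPE('f) (deletion (contraction M X) Y)"
      proof (cases "e \<in> Y")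
        case True
        show ?thesis
        proof (rule representable_minor_via_deletion[OF M_matroid rP XY(1,3) True])
          \<comment> \<open>\<open>J\<close> misses \<open>e\<close>, so it cannot contain all of
            \<open>A \<union> {a}\<close>, and the exceptional sets of \<open>M_move_p\<close> do
            not occur.\<close>
          fix J assume "J \<subseteq> ground M - {e}"
          then show "J \<in> indeps M \<longleftrightarrow> J \<in> indeps P.M" using A by (intro M_move_p[OF mp]) blast+
        qed (use gP in auto)
      next
        case False
        then have eX: "e \<in> X" using e by auto
        have eI: "{e} \<in> indeps M" by (rule matroidD(6)[OF M_matroid CA]) (use A in auto)
        have eQ: "{e} \<in> indeps Q.M" using M_move_q[OF mq, of "{e}"] eI eM A by auto
        have "representable TYPE('f) (contraction Q.M {e})"
          using eM gQ by (intro representable_contraction rQ) auto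
        then show ?thesis
        proof (rule representable_minor_via_contraction[OF M_matroid _ XY(1,3) eX eI])
          show "ground M - {e} \<subseteq> ground (contraction Q.M {e})" using gQ by (simp add: contraction_def)
          fix J assume J: "J \<subseteq> ground M - {e}"
          \<comment> \<open>The contracted \<open>e\<close> puts an element of
            \<open>A \<union> {a}\<close> into every set tested, whereas the exceptional sets of
            \<open>M_move_q\<close> avoid \<open>A \<union> {a}\<close>.\<close>
          have "insert e J \<in> indeps M \<longleftrightarrow> insert e J \<in> indeps Q.M"
            by (rule M_move_q[OF mq]) (use J eM A in auto)
          then show "insert e J \<in> indeps M \<longleftrightarrow> J \<in> indeps (contraction Q.M {e})"
            using J gQ by (simp add: contraction_single_indeps[OF Q.M_matroid eQ])
        qed
      qed
    next
      case B
      show "representable TYPE('f) (deletion (contraction M X) Y)"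
      proof (cases "e \<in> Y")
        case True
        show ?thesis
        proof (rule representable_minor_via_deletion[OF M_matroid rQ XY(1,3) True])
          fix J assume "J \<subseteq> ground M - {e}"
          \<comment> \<open>The roles are exchanged: without \<open>e\<close> the set cannot contain
            \<open>B \<union> {b}\<close>, so moving \<open>q\<close> to \<open>p\<close> goes
            unnoticed.\<close>
          then show "J \<in> indeps M \<longleftrightarrow> J \<in> indeps Q.M" using B by (intro M_move_q[OF mq]) blast+
        qed (use gQ in auto)
      next
        case False
        then have eX: "e \<in> X" using e by auto
        have eI: "{e} \<in> indeps M" by (rule matroidD(6)[OF M_matroid CB]) (use B in auto)
        have eP: "{e} \<in> indeps P.M" using M_move_p[OF mp, of "{e}"] eI eM B by auto
        have "representable TYPE('f) (contraction P.M {e})"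
          using eM gP by (intro representable_contraction rP) auto
        then show ?thesis
        proof (rule representable_minor_via_contraction[OF M_matroid _ XY(1,3) eX eI])
          show "ground M - {e} \<subseteq> ground (contraction P.M {e})" using gP by (simp add: contraction_def)
          fix J assume J: "J \<subseteq> ground M - {e}"
          have "insert e J \<in> indeps M \<longleftrightarrow> insert e J \<in> indeps P.M"
            by (rule M_move_p[OF mp]) (use J eM B in auto)
          then show "insert e J \<in> indeps M \<longleftrightarrow> J \<in> indeps (contraction P.M {e})"
            using J gP by (simp add: contraction_single_indeps[OF P.M_matroid eP])
        qed
      qed
    qed
  qed
qed

end
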